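(* Let $(M,\mu,d)$, $(\mathcal{E},\mathcal{F})$, $(X_t)$ be as in the context. Assume that there are $R_0>0$ and $\beta>1$ such that $E(x,r)\simeq r^{\beta}$ for all $x\in M$ and all $0<r<R_0$, i.e. there is a constant $C_0>0$ with $\frac{1}{C_0}<\frac{E(x,r)}{r^\beta}<C_0$ for all $x\in M$, $0<r<R_0$. Then: (i) There is a constant $c>0$ such that for all measurable sets $A,B\subset M$ with $0<\mu(A),\mu(B)<\infty$, $$\limsup_{t\to0}\,t^{\frac{1}{\beta-1}}\log P_t(A,B)\le -c\left[d(A,B)\right]^{\frac{\beta}{\beta-1}} .$$ (ii) If in addition the elliptic Harnack inequality holds on $M$, then there is a constant $C>0$ such that for all open and precompact sets $A,B\subset M$ with $0<\mu(A),\mu(B)<\infty$, $$\liminf_{t\to0}\,t^{\frac{1}{\beta-1}}\log P_t(A,B)\ge -C\left[d(A,B)\right]^{\frac{\beta}{\beta-1}} .$$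
   Context: Standing assumptions: $(M,\mu,d)$ is a locally compact separable metric measure space with a Radon measure $\mu$ of full support, and the metric $d$ is geodesic. $(\mathcal{E},\mathcal{F})$ is a strictly local (i.e. strongly local) regular Dirichlet form in $L^2(M,\mu)$, and $(X_t)$ is the associated diffusion process on $M$, with Feller semigroup $P_t$. $\mathbb{P}_x,\mathbb{E}_x$ denote probability and expectation given $X_0=x$. The process has a transition density $p_t(x,y)$ with respect to $\mu$ satisfying: $p_t(x,y)\ge 0$; $\int_M p_t(x,y)\,d\mu(y)=1$; $p_t(x,y)=p_t(y,x)$; $p_t(x,y)=\int_M p_s(x,z)p_{t-s}(z,y)\,d\mu(z)$ for $0<s<t$. Notation: $B(x,R)=\{y\in M:d(x,y)<R\}$. The exit time from $A\subset M$ is $T_A=\inf\{t>0:X_t\in A^c\}$, and $E(x,R)=\mathbb{E}_x[T_{B(x,R)}]$. For sets $A,B\subset M$: $d(A,B)=\inf_{x\in A,\,y\in B}d(x,y)$ and $P_t(A,B)=\int_A\int_B p_t(x,y)\,d\mu(y)\,d\mu(x)$. Convention: $\log 0=-\infty$. A function $h:M\to\mathbb{R}$ is harmonic on an open set $A\subset M$ if it is defined on $\overline{A}$ and $h(x)=\mathbb{E}_x\left(h(X_{T_A})\right)$ for all $x\in A$. The elliptic Harnack inequality holds on $M$ if there is a constant $H\ge 1$ such that for all $x\in M$, $R>0$ and every non-negative function $u$ harmonic in $B(x,2R)$, $\sup_{B(x,R)}u\le H\inf_{B(x,R)}u$. *)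

theory Defs
  imports "HOL-Probability.Probability"
begin

section \<open>The metric measure space\<close>

text \<open>The space is the whole of a type of sort \<^class>\<open>metric_space\<close>;
  separability is the sort \<^class>\<open>second_countable_topology\<close>, which for metric spaces is the same.\<close>

definition radon_measure :: "'a::metric_space measure \<Rightarrow> bool" where
  "radon_measure \<mu> \<longleftrightarrow>
     sets \<mu> = sets borel \<and>
     (\<forall>K. compact K \<longrightarrow> emeasure \<mu> K < \<infinity>) \<and>
     (\<forall>A\<in>sets borel. emeasure \<mu> A = (SUP K\<in>{K. compact K \<and> K \<subseteq> A}. emeasure \<mu> K))"

definition full_support :: "'a::metric_space measure \<Rightarrow> bool" where
  "full_support \<mu> \<longleftrightarrow> (\<forall>U. open U \<and> U \<noteq> {} \<longrightarrow> 0 < emeasure \<mu> U)"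

definition geodesic_metric :: "'a::metric_space itself \<Rightarrow> bool" where
  "geodesic_metric _ \<longleftrightarrow>
     (\<forall>x y :: 'a. \<exists>\<gamma> :: real \<Rightarrow> 'a. \<gamma> 0 = x \<and> \<gamma> (dist x y) = y \<and>
        (\<forall>s\<in>{0..dist x y}. \<forall>t\<in>{0..dist x y}. dist (\<gamma> s) (\<gamma> t) = \<bar>s - t\<bar>))"


section \<open>Function spaces\<close>

text \<open>Elements of $L^2(M,\mu)$ are represented by square integrable functions; everything below that
  concerns $L^2$ is required to be compatible with equality almost everywhere.\<close>

definition L2 :: "'a measure \<Rightarrow> ('a \<Rightarrow> real) set" where
  "L2 \<mu> = {f \<in> borel_measurable \<mu>. integrable \<mu> (\<lambda>x. (f x)\<^sup>2)}"

definition inner_L2 :: "'a measure \<Rightarrow> ('a \<Rightarrow> real) \<Rightarrow> ('a \<Rightarrow> real) \<Rightarrow> real" where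
  "inner_L2 \<mu> f g = (\<integral>x. f x * g x \<partial>\<mu>)"

definition Cc :: "('a::metric_space \<Rightarrow> real) set" where
  "Cc = {f. continuous_on UNIV f \<and> compact (closure {x. f x \<noteq> 0})}"

definition C0 :: "('a::metric_space \<Rightarrow> real) set" where
  "C0 = {f. continuous_on UNIV f \<and> (\<forall>\<epsilon>>0. \<exists>K. compact K \<and> (\<forall>x. x \<notin> K \<longrightarrow> \<bar>f x\<bar> < \<epsilon>))}"

definition ae_support :: "'a::metric_space measure \<Rightarrow> ('a \<Rightarrow> real) \<Rightarrow> 'a set" where
  "ae_support \<mu> f = - \<Union>{U. open U \<and> (AE x in \<mu>. x \<in> U \<longrightarrow> f x = 0)}"


section \<open>Dirichlet forms\<close>

text \<open>\<open>D\<close> is the domain (written $\mathcal F$ in the literature) and \<open>E\<close> the form, whose values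
  outside \<open>D\<close> are irrelevant.\<close>

definition energy1 ::
  "'a measure \<Rightarrow> (('a \<Rightarrow> real) \<Rightarrow> ('a \<Rightarrow> real) \<Rightarrow> real) \<Rightarrow> ('a \<Rightarrow> real) \<Rightarrow> real" where
  "energy1 \<mu> E f = E f f + inner_L2 \<mu> f f"

definition closed_symmetric_form ::
  "'a measure \<Rightarrow> (('a \<Rightarrow> real) \<Rightarrow> ('a \<Rightarrow> real) \<Rightarrow> real) \<Rightarrow> ('a \<Rightarrow> real) set \<Rightarrow> bool" where
  "closed_symmetric_form \<mu> E D \<longleftrightarrow>
     D \<subseteq> L2 \<mu> \<and>
     (\<forall>f\<in>D. \<forall>g\<in>borel_measurable \<mu>. (AE x in \<mu>. f x = g x) \<longrightarrow> g \<in> D \<and> (\<forall>h\<in>D. E f h = E g h)) \<and>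
     (\<lambda>_. 0) \<in> D \<and>
     (\<forall>f\<in>D. \<forall>g\<in>D. \<forall>a b. (\<lambda>x. a * f x + b * g x) \<in> D \<and>
        (\<forall>h\<in>D. E (\<lambda>x. a * f x + b * g x) h = a * E f h + b * E g h)) \<and>
     (\<forall>f\<in>D. \<forall>g\<in>D. E f g = E g f) \<and>
     (\<forall>f\<in>D. 0 \<le> E f f) \<and>
     (\<forall>f\<in>L2 \<mu>. \<forall>\<epsilon>>0. \<exists>g\<in>D. inner_L2 \<mu> (\<lambda>x. f x - g x) (\<lambda>x. f x - g x) < \<epsilon>) \<and>
     (\<forall>u :: nat \<Rightarrow> 'a \<Rightarrow> real.
        (\<forall>n. u n \<in> D) \<and>
        (\<forall>\<epsilon>>0. \<exists>N. \<forall>m\<ge>N. \<forall>n\<ge>N. energy1 \<mu> E (\<lambda>x. u m x - u n x) < \<epsilon>) \<longrightarrow>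
        (\<exists>v\<in>D. (\<lambda>n. energy1 \<mu> E (\<lambda>x. u n x - v x)) \<longlonglongrightarrow> 0))"

definition dirichlet_form ::
  "'a measure \<Rightarrow> (('a \<Rightarrow> real) \<Rightarrow> ('a \<Rightarrow> real) \<Rightarrow> real) \<Rightarrow> ('a \<Rightarrow> real) set \<Rightarrow> bool" where
  "dirichlet_form \<mu> E D \<longleftrightarrow>
     closed_symmetric_form \<mu> E D \<and>
     (\<forall>f\<in>D. (\<lambda>x. min (max (f x) 0) 1) \<in> D \<and>
        E (\<lambda>x. min (max (f x) 0) 1) (\<lambda>x. min (max (f x) 0) 1) \<le> E f f)"

definition regular_form :: "'a::metric_space measure \<Rightarrow>
    (('a \<Rightarrow> real) \<Rightarrow> ('a \<Rightarrow> real) \<Rightarrow> real) \<Rightarrow> ('a \<Rightarrow> real) set \<Rightarrow> bool" where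
  "regular_form \<mu> E D \<longleftrightarrow>
     (\<forall>f\<in>D. \<forall>\<epsilon>>0. \<exists>g\<in>D \<inter> Cc. energy1 \<mu> E (\<lambda>x. f x - g x) < \<epsilon>) \<and>
     (\<forall>f\<in>Cc. \<forall>\<epsilon>>0. \<exists>g\<in>D \<inter> Cc. \<forall>x. \<bar>f x - g x\<bar> < \<epsilon>)"

definition strongly_local :: "'a::metric_space measure \<Rightarrow>
    (('a \<Rightarrow> real) \<Rightarrow> ('a \<Rightarrow> real) \<Rightarrow> real) \<Rightarrow> ('a \<Rightarrow> real) set \<Rightarrow> bool" where
  "strongly_local \<mu> E D \<longleftrightarrow>
     (\<forall>f\<in>D. \<forall>g\<in>D. compact (ae_support \<mu> f) \<and> compact (ae_support \<mu> g) \<and>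
        (\<exists>U c. open U \<and> ae_support \<mu> g \<subseteq> U \<and> (AE x in \<mu>. x \<in> U \<longrightarrow> f x = c)) \<longrightarrow>
        E f g = 0)"


section \<open>The diffusion process\<close>

text \<open>\<open>P x\<close> is the law of the process started at \<open>x\<close>, on a common measurable space of outcomes;
  \<open>X t\<close> is the position at time \<open>t\<close>, of which only the times \<open>t \<ge> 0\<close> matter.\<close>

definition natural_filtration ::
  "'w set \<Rightarrow> (real \<Rightarrow> 'w \<Rightarrow> 'a::metric_space) \<Rightarrow> real \<Rightarrow> 'w measure" where
  "natural_filtration \<Omega> X s =
     sigma \<Omega> {X u -` B \<inter> \<Omega> | u B. 0 \<le> u \<and> u \<le> s \<and> B \<in> sets borel}"

definition transition ::
  "('a \<Rightarrow> 'w measure) \<Rightarrow> (real \<Rightarrow> 'w \<Rightarrow> 'a::metric_space) \<Rightarrow> real \<Rightarrow> 'a \<Rightarrow> 'a measure" where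
  "transition P X t x = distr (P x) borel (X t)"

text \<open>A conservative (infinite lifetime) Markov process with continuous paths. The strong Markov
  property follows from the simple one stated here, path continuity and the Feller property below.\<close>

definition diffusion_process ::
  "('a::metric_space \<Rightarrow> 'w measure) \<Rightarrow> (real \<Rightarrow> 'w \<Rightarrow> 'a) \<Rightarrow> bool" where
  "diffusion_process P X \<longleftrightarrow>
     (\<forall>x. prob_space (P x)) \<and>
     (\<forall>x y. sets (P x) = sets (P y)) \<and>
     (\<forall>x. \<forall>t\<ge>0. X t \<in> measurable (P x) borel) \<and>
     (\<forall>x. \<forall>\<omega>\<in>space (P x). continuous_on {0..} (\<lambda>t. X t \<omega>)) \<and>
     (\<forall>x. AE \<omega> in P x. X 0 \<omega> = x) \<and>
     (\<forall>t\<ge>0. transition P X t \<in> measurable borel (prob_algebra borel)) \<and>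
     (\<forall>x. \<forall>s\<ge>0. \<forall>t\<ge>0. \<forall>B\<in>sets borel. AE \<omega> in P x.
        real_cond_exp (P x) (natural_filtration (space (P x)) X s) (\<lambda>\<omega>'. indicator B (X (s + t) \<omega>')) \<omega>
        = measure (transition P X t (X s \<omega>)) B)"

definition semigroup_op ::
  "('a \<Rightarrow> 'w measure) \<Rightarrow> (real \<Rightarrow> 'w \<Rightarrow> 'a) \<Rightarrow> real \<Rightarrow> ('a \<Rightarrow> real) \<Rightarrow> 'a \<Rightarrow> real" where
  "semigroup_op P X t f x = (\<integral>\<omega>. f (X t \<omega>) \<partial>P x)"

definition feller ::
  "('a::metric_space \<Rightarrow> 'w measure) \<Rightarrow> (real \<Rightarrow> 'w \<Rightarrow> 'a) \<Rightarrow> bool" where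
  "feller P X \<longleftrightarrow>
     (\<forall>f\<in>C0. \<forall>t\<ge>0. semigroup_op P X t f \<in> C0) \<and>
     (\<forall>f\<in>C0. uniform_limit UNIV (\<lambda>t. semigroup_op P X t f) f (at_right 0))"

text \<open>The process is associated with the form: with $T_t$ its semigroup on $L^2(M,\mu)$, the domain
  consists of those $f$ for which $\frac1t\langle f - T_t f, f\rangle$ has a finite limit as $t \to 0$,
  and the form is the polarised limit. A symmetric strongly continuous contraction semigroup and its
  closed form determine each other in this way.\<close>

definition associated_with_form :: "'a measure \<Rightarrow> (('a \<Rightarrow> real) \<Rightarrow> ('a \<Rightarrow> real) \<Rightarrow> real) \<Rightarrow>
    ('a \<Rightarrow> real) set \<Rightarrow> ('a \<Rightarrow> 'w measure) \<Rightarrow> (real \<Rightarrow> 'w \<Rightarrow> 'a) \<Rightarrow> bool" where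
  "associated_with_form \<mu> E D P X \<longleftrightarrow>
     D = {f \<in> L2 \<mu>. \<exists>l. ((\<lambda>t. inner_L2 \<mu> (\<lambda>x. f x - semigroup_op P X t f x) f / t) \<longlongrightarrow> l) (at_right 0)} \<and>
     (\<forall>f\<in>D. \<forall>g\<in>D.
        ((\<lambda>t. inner_L2 \<mu> (\<lambda>x. f x - semigroup_op P X t f x) g / t) \<longlongrightarrow> E f g) (at_right 0))"

definition transition_density :: "'a::metric_space measure \<Rightarrow> ('a \<Rightarrow> 'w measure) \<Rightarrow>
    (real \<Rightarrow> 'w \<Rightarrow> 'a) \<Rightarrow> (real \<Rightarrow> 'a \<Rightarrow> 'a \<Rightarrow> real) \<Rightarrow> bool" where
  "transition_density \<mu> P X p \<longleftrightarrow>
     (\<forall>t>0. (\<lambda>(x, y). p t x y) \<in> borel_measurable (\<mu> \<Otimes>\<^sub>M \<mu>)) \<and>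
     (\<forall>t>0. \<forall>x. distributed (P x) \<mu> (X t) (\<lambda>y. ennreal (p t x y))) \<and>
     (\<forall>t>0. \<forall>x y. 0 \<le> p t x y) \<and>
     (\<forall>t>0. \<forall>x. has_bochner_integral \<mu> (\<lambda>y. p t x y) 1) \<and>
     (\<forall>t>0. \<forall>x y. p t x y = p t y x) \<and>
     (\<forall>s t x y. 0 < s \<and> s < t \<longrightarrow> has_bochner_integral \<mu> (\<lambda>z. p s x z * p (t - s) z y) (p t x y))"


section \<open>Exit times, harmonic functions and the elliptic Harnack inequality\<close>

text \<open>The infimum over the empty set is \<open>\<infinity>\<close>.\<close>

definition exit_time :: "(real \<Rightarrow> 'w \<Rightarrow> 'a) \<Rightarrow> 'a set \<Rightarrow> 'w \<Rightarrow> ennreal" where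
  "exit_time X A \<omega> = (INF t\<in>{t. 0 < t \<and> X t \<omega> \<in> - A}. ennreal t)"

definition mean_exit_time ::
  "('a::metric_space \<Rightarrow> 'w measure) \<Rightarrow> (real \<Rightarrow> 'w \<Rightarrow> 'a) \<Rightarrow> 'a \<Rightarrow> real \<Rightarrow> ennreal" where
  "mean_exit_time P X x R = (\<integral>\<^sup>+\<omega>. exit_time X (ball x R) \<omega> \<partial>P x)"

text \<open>The usual convention \<open>h (X\<^sub>\<infinity>) = 0\<close>: paths that never leave \<open>A\<close> do not contribute.\<close>

definition exit_value ::
  "(real \<Rightarrow> 'w \<Rightarrow> 'a) \<Rightarrow> ('a \<Rightarrow> real) \<Rightarrow> 'a set \<Rightarrow> 'w \<Rightarrow> real" where
  "exit_value X h A \<omega> =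
     (if exit_time X A \<omega> = \<infinity> then 0 else h (X (enn2real (exit_time X A \<omega>)) \<omega>))"

text \<open>Only the restriction of \<open>h\<close> to \<open>closure A\<close> matters: paths are continuous, so the exit position
  lies in \<open>closure A\<close>.\<close>

definition harmonic_on :: "('a::metric_space \<Rightarrow> 'w measure) \<Rightarrow> (real \<Rightarrow> 'w \<Rightarrow> 'a) \<Rightarrow>
    ('a \<Rightarrow> real) \<Rightarrow> 'a set \<Rightarrow> bool" where
  "harmonic_on P X h A \<longleftrightarrow>
     open A \<and>
     h \<in> borel_measurable (restrict_space borel (closure A)) \<and>
     (\<forall>x\<in>A. has_bochner_integral (P x) (exit_value X h A) (h x))"

definition elliptic_harnack ::
  "('a::metric_space \<Rightarrow> 'w measure) \<Rightarrow> (real \<Rightarrow> 'w \<Rightarrow> 'a) \<Rightarrow> bool" where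
  "elliptic_harnack P X \<longleftrightarrow>
     (\<exists>H\<ge>1. \<forall>x. \<forall>R>0. \<forall>u.
        harmonic_on P X u (ball x (2 * R)) \<and> (\<forall>y\<in>closure (ball x (2 * R)). 0 \<le> u y) \<longrightarrow>
        (SUP y\<in>ball x R. ereal (u y)) \<le> ereal H * (INF y\<in>ball x R. ereal (u y)))"


section \<open>Transition between sets\<close>

definition transition_between ::
  "'a measure \<Rightarrow> (real \<Rightarrow> 'a \<Rightarrow> 'a \<Rightarrow> real) \<Rightarrow> real \<Rightarrow> 'a set \<Rightarrow> 'a set \<Rightarrow> real" where
  "transition_between \<mu> p t A B = (LINT x:A|\<mu>. (LINT y:B|\<mu>. p t x y))"

definition elog :: "real \<Rightarrow> ereal" where
  "elog u = (if 0 < u then ereal (ln u) else -\<infinity>)"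

end

theory Submission
  imports Defs "HOL-Real_Asymp.Real_Asymp"
begin

text \<open>Write $Q_t^K f(x) = E_x[f(X_t);\, X_u \in K \mbox{ for all } u \le t]$ for the semigroup killed
  on leaving a closed set $K$. It is a limit of integrals over the positions at finitely many
  equidistant times, and the Feller property makes the approximating functions continuous. This gives
  the strong Markov property at exit times from open sets for precisely the functionals that are
  needed, hence Dynkin's formula for the resolvents of $Q^K$.

  (i) The Markov property and the two-sided bound on mean exit times show that, with $\lambda$ a
  constant times $r^{-\beta}$, the Laplace transform $E_x e^{-\lambda T}$ of the exit time from a ball
  of radius $r$ is at most some $\rho < 1$. A path that travels a distance $n r$ makes $n$ successive
  exits, so it does so before time $t$ with probability at most $e^{\lambda t} \rho^n$. One optimises
  over $n$, with $n r = d(A,B)/2$.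

  (ii) Let $g_b$ be the Green potential of a small bump at $b$, killed outside a large ball. It is
  harmonic away from $b$, and $(a,b) \mapsto g_b(a)$ is symmetric up to averaging and a constant power
  of the Harnack constant. If $v$ and $w$ lie in a fixed annulus around $y$, then either a geodesic
  from $v$ to $w$ stays away from $y$, or geodesics from $y$ to $w$ and from $v$ to $y$ stay away from
  $v$ and $w$ respectively; Harnack chains and symmetry give $g_y(v) \le M g_y(w)$ in both cases.
  Evaluating $g_y$ at the exit from the annulus bounds from below the probability of coming close to
  $y$, within time of order $r^\beta$. Chaining $n$ such moves along a geodesic, with $n$ of order
  $(D^\beta / t)^{1/(\beta-1)}$ for $D$ slightly larger than $d(A,B)$, yields the lower bound.\<close>


section \<open>The Markov property\<close>

text \<open>The outcome space carries no shift, and the Markov property is given only as a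
  conditional expectation at fixed times. Path functionals therefore carry their starting time as an
  argument, and all later identities are between integrals of nonnegative functions. In (ii) neither
  continuity of the transition density nor any comparison of volumes of balls is available.
  Potentials of bumps, divided by the mass of the bump, replace the Green function, and the masses
  cancel where potentials with the same pole are compared. The annulus around \<open>y\<close> may
  be disconnected, as on the real line; a Harnack chain between two of its points can then be forced
  through the pole, and moving the pole by symmetry is the way around this. The exponent has the
  same origin in both parts: \<open>n\<close> moves over distance D / n take time of order n (D /
  n)^\<beta>, and equating this with t gives n of order (D^\<beta> / t)^(1/(\<beta>-1)), each move
  costing a constant factor of probability.\<close>

locale feller_diffusion =
  fixes P :: "'a::{metric_space, second_countable_topology} \<Rightarrow> 'w measure"
    and X :: "real \<Rightarrow> 'w \<Rightarrow> 'a"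
  assumes diffusion: "diffusion_process P X" and feller: "feller P X"
begin

abbreviation \<F> :: "'a \<Rightarrow> real \<Rightarrow> 'w measure" where
  "\<F> x s \<equiv> natural_filtration (space (P x)) X s"

lemma prob_space_P: "prob_space (P x)"
  using diffusion by (simp add: diffusion_process_def)

lemma emeasure_space_P [simp]: "emeasure (P x) (space (P x)) = 1"
  using prob_space_P prob_space.emeasure_space_1 by blast

lemma sets_P: "sets (P x) = sets (P y)"
  using diffusion by (auto simp: diffusion_process_def)

lemma X_measurable: "0 \<le> t \<Longrightarrow> X t \<in> measurable (P x) borel"
  using diffusion by (auto simp: diffusion_process_def)

lemma X_continuous: "\<omega> \<in> space (P x) \<Longrightarrow> continuous_on {0..} (\<lambda>t. X t \<omega>)"
  using diffusion by (auto simp: diffusion_process_def)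

lemma X_start: "AE \<omega> in P x. X 0 \<omega> = x"
  using diffusion by (auto simp: diffusion_process_def)

lemma transition_measurable: "0 \<le> t \<Longrightarrow> transition P X t \<in> measurable borel (prob_algebra borel)"
  using diffusion by (auto simp: diffusion_process_def)

lemma X_in_filtration:
  assumes "0 \<le> u" "u \<le> s"
  shows "X u \<in> measurable (\<F> x s) borel"
proof (rule measurableI)
  fix A :: "'a set" assume "A \<in> sets borel"
  have "X u -` A \<inter> space (\<F> x s) = X u -` A \<inter> space (P x)"
    unfolding natural_filtration_def by (subst space_measure_of) auto
  moreover have "X u -` A \<inter> space (P x) \<in> sets (\<F> x s)"
    unfolding natural_filtration_def using assms \<open>A \<in> sets borel\<close>
    by (subst sets_measure_of) (auto intro!: sigma_sets.Basic)
  ultimately show "X u -` A \<inter> space (\<F> x s) \<in> sets (\<F> x s)" by simp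
qed auto

lemma space_filtration [simp]: "space (\<F> x s) = space (P x)"
  unfolding natural_filtration_def by (subst space_measure_of) auto

lemma subalgebra_filtration: "subalgebra (P x) (\<F> x s)"
proof -
  have "sigma_sets (space (P x)) {X u -` B \<inter> space (P x) | u B. 0 \<le> u \<and> u \<le> s \<and> B \<in> sets borel}
     \<subseteq> sets (P x)"
    using X_measurable by (intro sets.sigma_sets_subset) (auto intro: measurable_sets)
  then show ?thesis
    unfolding subalgebra_def using space_filtration unfolding natural_filtration_def
    by (subst sets_measure_of) auto
qed

lemma filtration_measurable:
  "G \<in> measurable (\<F> x s) N \<Longrightarrow> G \<in> measurable (P x) N"
  using measurable_from_subalg subalgebra_filtration by blast

lemma filtration_mono:
  assumes "s \<le> t"
  shows "G \<in> measurable (\<F> x s) N \<Longrightarrow> G \<in> measurable (\<F> x t) N"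
proof -
  have "sets (\<F> x s) \<subseteq> sets (\<F> x t)"
    unfolding natural_filtration_def
    by (subst (1 2) sets_measure_of) (use assms in \<open>force intro!: sigma_sets_mono'\<close>)+
  then have "subalgebra (\<F> x t) (\<F> x s)" by (simp add: subalgebra_def)
  then show "G \<in> measurable (\<F> x s) N \<Longrightarrow> G \<in> measurable (\<F> x t) N"
    using measurable_from_subalg by blast
qed

text \<open>The transition operator of time \<open>h\<close>, acting on functions with values in
  [0,\<infinity>] so that no integrability conditions arise later.\<close>

definition step :: "real \<Rightarrow> ('a \<Rightarrow> ennreal) \<Rightarrow> 'a \<Rightarrow> ennreal" where
  "step h f z = (\<integral>\<^sup>+\<omega>. f (X h \<omega>) \<partial>P z)"

lemma step_transition:
  "0 \<le> h \<Longrightarrow> f \<in> borel_measurable borel \<Longrightarrow> step h f z = (\<integral>\<^sup>+y. f y \<partial>transition P X h z)"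
  unfolding step_def transition_def by (subst nn_integral_distr) (auto intro: X_measurable)

lemma step_measurable [measurable]:
  assumes "0 \<le> h" and [measurable]: "f \<in> borel_measurable borel"
  shows "step h f \<in> borel_measurable borel"
proof -
  have [measurable]: "transition P X h \<in> measurable borel (subprob_algebra borel)"
    using transition_measurable[OF assms(1)] by (rule measurable_prob_algebraD)
  have "(\<lambda>z. \<integral>\<^sup>+y. f y \<partial>transition P X h z) \<in> borel_measurable borel"
    by measurable
  then show ?thesis using step_transition[OF assms(1) assms(2)] by (simp cong: measurable_cong)
qed

text \<open>The assumed Markov property is, for each \<open>B\<close>, an almost sure identity for a
  real conditional expectation. Integrating it over an event \<open>A\<close> of the past removes
  the exceptional set and gives an identity between nonnegative integrals.\<close>

lemma markov_sets:
  assumes "0 \<le> s" "0 \<le> t" and A: "A \<in> sets (\<F> x s)" and B: "B \<in> sets borel"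
  shows "(\<integral>\<^sup>+\<omega>. indicator A \<omega> * indicator B (X (s + t) \<omega>) \<partial>P x)
       = (\<integral>\<^sup>+\<omega>. indicator A \<omega> * step t (indicator B) (X s \<omega>) \<partial>P x)"
proof -
  interpret prob_space "P x" by (rule prob_space_P)
  interpret finite_measure_subalgebra "P x" "\<F> x s"
    by unfold_locales (rule subalgebra_filtration)
  note [measurable] = X_measurable[of "s + t" x] X_measurable[of s x] B
  have AP [measurable]: "A \<in> sets (P x)"
    using A subalgebra_filtration[of x s] by (auto simp: subalgebra_def)
  have [simp]: "0 \<le> s + t" using assms by simp
  have [measurable]: "X (s + t) \<in> measurable (P x) borel" "X s \<in> measurable (P x) borel"
    using X_measurable assms by auto
  have step_eq: "step t (indicator B) z = ennreal (measure (transition P X t z) B)" for z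
  proof -
    interpret T: prob_space "transition P X t z"
      unfolding transition_def using X_measurable[OF assms(2)] prob_space_P
      by (intro prob_space.prob_space_distr) auto
    have "B \<in> sets (transition P X t z)" using B by (simp add: transition_def)
    then show ?thesis
      using step_transition[OF assms(2), of "indicator B"] B by (simp add: T.emeasure_eq_measure)
  qed
  have mm: "(\<lambda>z. measure (transition P X t z) B) \<in> borel_measurable borel"
  proof -
    have "(\<lambda>z. enn2real (step t (indicator B) z)) \<in> borel_measurable borel"
      using step_measurable[OF assms(2)] B by measurable
    then show ?thesis by (simp add: step_eq)
  qed
  have le1: "measure (transition P X t z) B \<le> 1" for z
  proof -
    have "prob_space (transition P X t z)"
      unfolding transition_def using X_measurable[OF assms(2)] prob_space_P
      by (intro prob_space.prob_space_distr) auto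
    then show ?thesis by (rule prob_space.prob_le_1)
  qed
  have int: "integrable (P x) (\<lambda>\<omega>. indicator B (X (s + t) \<omega>) :: real)"
    by (rule integrable_const_bound[where B = 1]) (auto simp: indicator_def)
  have int2: "integrable (P x) (\<lambda>\<omega>. indicator A \<omega> * measure (transition P X t (X s \<omega>)) B)"
    using le1 mm by (intro integrable_const_bound[where B = 1]) (auto simp: indicator_def)
  have int1: "integrable (P x) (\<lambda>\<omega>. indicator A \<omega> * indicator B (X (s + t) \<omega>) :: real)"
    by (rule integrable_const_bound[where B = 1]) (auto simp: indicator_def)
  have ce: "AE \<omega> in P x. real_cond_exp (P x) (\<F> x s) (\<lambda>\<omega>'. indicator B (X (s + t) \<omega>')) \<omega>
        = measure (transition P X t (X s \<omega>)) B"
    using diffusion assms B by (auto simp: diffusion_process_def)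
  have "(\<integral>\<omega>. indicator A \<omega> * indicator B (X (s + t) \<omega>) \<partial>P x)
      = (\<integral>\<omega>. indicator A \<omega> * real_cond_exp (P x) (\<F> x s) (\<lambda>\<omega>'. indicator B (X (s + t) \<omega>')) \<omega> \<partial>P x)"
    using real_cond_exp_intA[OF int A] by (simp add: set_lebesgue_integral_def)
  also have "\<dots> = (\<integral>\<omega>. indicator A \<omega> * measure (transition P X t (X s \<omega>)) B \<partial>P x)"
    using ce mm by (intro integral_cong_AE) (auto intro: measurable_from_subalg[OF subalgebra_filtration])
  finally have eq: "(\<integral>\<omega>. indicator A \<omega> * indicator B (X (s + t) \<omega>) \<partial>P x)
     = (\<integral>\<omega>. indicator A \<omega> * measure (transition P X t (X s \<omega>)) B \<partial>P x)" .
  have "(\<integral>\<^sup>+\<omega>. ennreal (indicator A \<omega> * indicator B (X (s + t) \<omega>)) \<partial>P x)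
      = (\<integral>\<^sup>+\<omega>. ennreal (indicator A \<omega> * measure (transition P X t (X s \<omega>)) B) \<partial>P x)"
    using eq int1 int2 by (subst (1 2) nn_integral_eq_integral) (auto simp: indicator_def)
  moreover have "ennreal (indicator A \<omega> * indicator B (X (s + t) \<omega>))
      = indicator A \<omega> * indicator B (X (s + t) \<omega>)" for \<omega>
    by (simp add: ennreal_mult' ennreal_indicator)
  moreover have "ennreal (indicator A \<omega> * measure (transition P X t (X s \<omega>)) B)
      = indicator A \<omega> * step t (indicator B) (X s \<omega>)" for \<omega>
    by (simp add: ennreal_mult' ennreal_indicator step_eq)
  ultimately show ?thesis by simp
qed

lemma step_add:
  assumes "0 \<le> h" and [measurable]: "f \<in> borel_measurable borel" "g \<in> borel_measurable borel"
  shows "step h (\<lambda>z. f z + g z) z = step h f z + step h g z"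
proof -
  have [measurable]: "X h \<in> measurable (P z) borel" using X_measurable assms(1) .
  show ?thesis unfolding step_def by (intro nn_integral_add) measurable
qed

lemma step_cmult:
  assumes "0 \<le> h" and [measurable]: "f \<in> borel_measurable borel"
  shows "step h (\<lambda>z. c * f z) z = c * step h f z"
proof -
  have [measurable]: "X h \<in> measurable (P z) borel" using X_measurable assms(1) .
  show ?thesis unfolding step_def by (intro nn_integral_cmult) measurable
qed

lemma step_mono: "(\<And>z. f z \<le> g z) \<Longrightarrow> step h f z \<le> step h g z"
  unfolding step_def by (intro nn_integral_mono) auto

lemma step_SUP:
  assumes "0 \<le> h" "incseq F" and [measurable]: "\<And>i. F i \<in> borel_measurable borel"
  shows "step h (\<lambda>z. SUP i. F i z) z = (SUP i. step h (F i) z)"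
  unfolding step_def using assms X_measurable[OF assms(1), of z]
  by (intro nn_integral_monotone_convergence_SUP) (auto simp: incseq_def le_fun_def)

text \<open>Two monotone class inductions starting from \<open>markov_sets\<close>: over
  \<open>f\<close> with an event of the past fixed, then over \<open>G\<close> with \<open>f\<close>
  fixed.\<close>

lemma markov:
  assumes "0 \<le> s" "0 \<le> t" and G: "G \<in> borel_measurable (\<F> x s)"
    and f: "f \<in> borel_measurable borel"
  shows "(\<integral>\<^sup>+\<omega>. G \<omega> * f (X (s + t) \<omega>) \<partial>P x) = (\<integral>\<^sup>+\<omega>. G \<omega> * step t f (X s \<omega>) \<partial>P x)"
proof -
  have [measurable]: "X (s + t) \<in> measurable (P x) borel" "X s \<in> measurable (P x) borel"
    using X_measurable assms by auto
  note [measurable] = step_measurable[OF assms(2)]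
  have one: "(\<integral>\<^sup>+\<omega>. indicator A \<omega> * f (X (s + t) \<omega>) \<partial>P x)
      = (\<integral>\<^sup>+\<omega>. indicator A \<omega> * step t f (X s \<omega>) \<partial>P x)" if A: "A \<in> sets (\<F> x s)" for A
    using f
  proof (induction rule: borel_measurable_induct)
    case (cong f g)
    then have "f = g" by auto
    then show ?case using cong by simp
  next
    case (set B)
    then show ?case using markov_sets[OF assms(1,2) A] by simp
  next
    case (mult u c)
    have [measurable]: "A \<in> sets (P x)"
      using A subalgebra_filtration[of x s] by (auto simp: subalgebra_def)
    note [measurable] = mult.hyps(2)
    have "(\<integral>\<^sup>+\<omega>. indicator A \<omega> * (c * u (X (s + t) \<omega>)) \<partial>P x) 
        = c * (\<integral>\<^sup>+\<omega>. indicator A \<omega> * u (X (s + t) \<omega>) \<partial>P x)"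
      by (subst nn_integral_cmult[symmetric]) (auto intro!: nn_integral_cong simp: mult_ac)
    moreover have "(\<integral>\<^sup>+\<omega>. indicator A \<omega> * (c * step t u (X s \<omega>)) \<partial>P x) 
        = c * (\<integral>\<^sup>+\<omega>. indicator A \<omega> * step t u (X s \<omega>) \<partial>P x)"
      by (subst nn_integral_cmult[symmetric]) (auto intro!: nn_integral_cong simp: mult_ac)
    ultimately show ?case using mult by (simp add: step_cmult[OF assms(2)])
  next
    case (add u v)
    have [measurable]: "A \<in> sets (P x)"
      using A subalgebra_filtration[of x s] by (auto simp: subalgebra_def)
    note [measurable] = add.hyps(1,3)
    show ?case using add
      by (simp add: step_add[OF assms(2)] distrib_left nn_integral_add)
  next
    case (seq U)
    have [measurable]: "A \<in> sets (P x)"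
      using A subalgebra_filtration[of x s] by (auto simp: subalgebra_def)
    note [measurable] = seq.hyps(1)
    have sup: "Sup (range U) = (\<lambda>z. SUP i. U i z)" by (simp add: fun_eq_iff image_comp)
    have st: "step t (\<lambda>z. SUP i. U i z) z = (SUP i. step t (U i) z)" for z
      using step_SUP[OF assms(2) seq.hyps(3), of z] seq.hyps(1) by simp
    have m1: "incseq (\<lambda>i \<omega>. indicator A \<omega> * U i (X (s + t) \<omega>))"
      using seq.hyps(3) by (auto simp: incseq_def le_fun_def intro!: mult_left_mono)
    have m2: "incseq (\<lambda>i \<omega>. indicator A \<omega> * step t (U i) (X s \<omega>))"
      using seq.hyps(3) by (auto simp: incseq_def le_fun_def intro!: mult_left_mono step_mono)
    have "(\<integral>\<^sup>+\<omega>. indicator A \<omega> * Sup (range U) (X (s + t) \<omega>) \<partial>P x)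
        = (\<integral>\<^sup>+\<omega>. (SUP i. indicator A \<omega> * U i (X (s + t) \<omega>)) \<partial>P x)"
      by (simp add: sup SUP_mult_left_ennreal)
    also have "\<dots> = (SUP i. \<integral>\<^sup>+\<omega>. indicator A \<omega> * U i (X (s + t) \<omega>) \<partial>P x)"
      using m1 by (intro nn_integral_monotone_convergence_SUP) auto
    also have "\<dots> = (SUP i. \<integral>\<^sup>+\<omega>. indicator A \<omega> * step t (U i) (X s \<omega>) \<partial>P x)"
      using seq by simp
    also have "\<dots> = (\<integral>\<^sup>+\<omega>. (SUP i. indicator A \<omega> * step t (U i) (X s \<omega>)) \<partial>P x)"
      using m2 by (intro nn_integral_monotone_convergence_SUP[symmetric]) auto
    finally show ?case by (simp add: sup st SUP_mult_left_ennreal)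
  qed
  note [measurable] = f
  from G show ?thesis
  proof (induction rule: borel_measurable_induct)
    case (cong g h)
    then have "(\<integral>\<^sup>+\<omega>. h \<omega> * u \<omega> \<partial>P x) = (\<integral>\<^sup>+\<omega>. g \<omega> * u \<omega> \<partial>P x)" for u
      by (intro nn_integral_cong) auto
    then show ?case using cong by simp
  next
    case (set B)
    then show ?case using one by simp
  next
    case (mult u c)
    note [measurable] = filtration_measurable[OF mult.hyps(2)]
    show ?case using mult by (simp add: mult.assoc nn_integral_cmult)
  next
    case (add u v)
    note [measurable] = filtration_measurable[OF add.hyps(1)] filtration_measurable[OF add.hyps(3)]
    show ?case using add by (simp add: distrib_right nn_integral_add)
  next
    case (seq U)
    note [measurable] = filtration_measurable[OF seq.hyps(1)]
    have m1: "incseq (\<lambda>i \<omega>. U i \<omega> * u \<omega>)" for u :: "'w \<Rightarrow> ennreal"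
      using seq.hyps(3) by (auto simp: incseq_def le_fun_def intro!: mult_right_mono)
    have *: "(\<integral>\<^sup>+\<omega>. Sup (range U) \<omega> * u \<omega> \<partial>P x) = (SUP i. \<integral>\<^sup>+\<omega>. U i \<omega> * u \<omega> \<partial>P x)"
      if [measurable]: "u \<in> borel_measurable (P x)" for u
    proof -
      have "(\<integral>\<^sup>+\<omega>. Sup (range U) \<omega> * u \<omega> \<partial>P x) = (\<integral>\<^sup>+\<omega>. (SUP i. U i \<omega> * u \<omega>) \<partial>P x)"
        by (simp add: image_comp SUP_mult_right_ennreal)
      also have "\<dots> = (SUP i. \<integral>\<^sup>+\<omega>. U i \<omega> * u \<omega> \<partial>P x)"
        using m1 by (intro nn_integral_monotone_convergence_SUP) auto
      finally show ?thesis .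
    qed
    show ?case using seq by (subst (1 2) *) auto
  qed
qed

section \<open>Weights collected at equidistant times\<close>

lemma step_0:
  assumes [measurable]: "f \<in> borel_measurable borel" shows "step 0 f z = f z"
proof -
  have "step 0 f z = (\<integral>\<^sup>+\<omega>. f z \<partial>P z)"
    unfolding step_def using X_start[of z] by (intro nn_integral_cong_AE) auto
  then show ?thesis by simp
qed

text \<open>A discrete Feynman-Kac operator: \<open>chain_eq\<close> reads it as an expectation with
  weight \<phi> at each of the \<open>N + 1\<close> times 0, h, ..., N h. Weighting both end points
  is what makes it symmetric in \<open>chain_symmetric\<close>.\<close>

primrec chain :: "('a \<Rightarrow> ennreal) \<Rightarrow> real \<Rightarrow> nat \<Rightarrow> ('a \<Rightarrow> ennreal) \<Rightarrow> 'a \<Rightarrow> ennreal" where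
  "chain \<phi> h 0 f = (\<lambda>z. \<phi> z * f z)"
| "chain \<phi> h (Suc N) f = (\<lambda>z. \<phi> z * step h (chain \<phi> h N f) z)"

lemma chain_measurable:
  assumes h: "0 \<le> h" and [measurable]: "\<phi> \<in> borel_measurable borel" "f \<in> borel_measurable borel"
  shows "chain \<phi> h N f \<in> borel_measurable borel"
proof (induction N)
  case 0
  then show ?case by simp
next
  case (Suc N)
  note [measurable] = step_measurable[OF h Suc]
  show ?case by simp
qed

text \<open>The time \<open>s\<close> and the factor \<open>G\<close> vary in the induction: the
  first weight is absorbed into \<open>G\<close>, which is then part of the past at time
  \<open>s + h\<close>, and one application of \<open>markov\<close> leads back to time
  \<open>s\<close>.\<close>

lemma markov_chain:
  assumes "0 \<le> s" and h: "0 \<le> h" and G: "G \<in> borel_measurable (\<F> x s)"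
    and \<phi>: "\<phi> \<in> borel_measurable borel" and f: "f \<in> borel_measurable borel"
  shows "(\<integral>\<^sup>+\<omega>. G \<omega> * ((\<Prod>k\<le>N. \<phi> (X (s + real k * h) \<omega>)) * f (X (s + real N * h) \<omega>)) \<partial>P x)
       = (\<integral>\<^sup>+\<omega>. G \<omega> * chain \<phi> h N f (X s \<omega>) \<partial>P x)"
  using assms(1) G
proof (induction N arbitrary: s G)
  case 0
  then show ?case by (simp add: mult.assoc)
next
  case (Suc N)
  note [measurable] = \<phi> f
  have [measurable]: "X s \<in> measurable (\<F> x s) borel" by (rule X_in_filtration) (use Suc in auto)
  note [measurable] = Suc.prems(2)
  have G': "(\<lambda>\<omega>. G \<omega> * \<phi> (X s \<omega>)) \<in> borel_measurable (\<F> x s)" by measurable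
  have G'': "(\<lambda>\<omega>. G \<omega> * \<phi> (X s \<omega>)) \<in> borel_measurable (\<F> x (s + h))"
    by (rule filtration_mono[OF _ G']) (use h in simp)
  have "(\<Prod>k\<le>Suc N. \<phi> (X (s + real k * h) \<omega>)) * f (X (s + real (Suc N) * h) \<omega>)
     = \<phi> (X s \<omega>) * ((\<Prod>k\<le>N. \<phi> (X (s + h + real k * h) \<omega>)) * f (X (s + h + real N * h) \<omega>))" for \<omega>
    by (subst prod.atMost_Suc_shift) (simp add: algebra_simps)
  then have "(\<integral>\<^sup>+\<omega>. G \<omega> * ((\<Prod>k\<le>Suc N. \<phi> (X (s + real k * h) \<omega>)) * f (X (s + real (Suc N) * h) \<omega>)) \<partial>P x)
     = (\<integral>\<^sup>+\<omega>. (G \<omega> * \<phi> (X s \<omega>)) * ((\<Prod>k\<le>N. \<phi> (X (s + h + real k * h) \<omega>)) * f (X (s + h + real N * h) \<omega>)) \<partial>P x)"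
    by (simp add: mult.assoc)
  also have "\<dots> = (\<integral>\<^sup>+\<omega>. (G \<omega> * \<phi> (X s \<omega>)) * chain \<phi> h N f (X (s + h) \<omega>) \<partial>P x)"
    using Suc.prems h by (intro Suc.IH G'') auto
  also have "\<dots> = (\<integral>\<^sup>+\<omega>. (G \<omega> * \<phi> (X s \<omega>)) * step h (chain \<phi> h N f) (X s \<omega>) \<partial>P x)"
    using Suc.prems h by (intro markov G' chain_measurable \<phi> f) auto
  finally show ?case by (simp add: mult.assoc)
qed

lemma chain_eq:
  assumes h: "0 \<le> h" and \<phi>: "\<phi> \<in> borel_measurable borel" and f: "f \<in> borel_measurable borel"
  shows "chain \<phi> h N f z
    = (\<integral>\<^sup>+\<omega>. (\<Prod>k\<le>N. \<phi> (X (real k * h) \<omega>)) * f (X (real N * h) \<omega>) \<partial>P z)"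
  using markov_chain[where G = "\<lambda>_. 1" and s = 0 and x = z and N = N, OF _ h _ \<phi> f]
    step_0[OF chain_measurable[OF h \<phi> f], of N z]
  by (simp add: step_def)

end

section \<open>Survival in a closed set\<close>

text \<open>The time is replaced by the largest multiple of \<open>1 / (n + 1)\<close> strictly
  below \<open>s\<close>, or by 0 if \<open>s\<close> is not positive. Only countably many functions
  of \<open>z\<close> occur, so measurability for each fixed time suffices. Subtracting 1 from the
  ceiling makes the approximation strict, so that left limits are all that is needed.\<close>

lemma caratheodory_step_measurable:
  fixes f :: "real \<Rightarrow> 'b \<Rightarrow> 'c"
  assumes "\<And>s. 0 \<le> s \<Longrightarrow> f s \<in> measurable M N"
  shows "(\<lambda>(s, z). f (real_of_int (max 0 (\<lceil>(real n + 1) * s\<rceil> - 1)) / (real n + 1)) z)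
    \<in> measurable (borel \<Otimes>\<^sub>M M) N"
proof -
  have "(\<lambda>w. (\<lambda>j w. f (real_of_int (max 0 (j - 1)) / (real n + 1)) (snd w)) \<lceil>(real n + 1) * fst w\<rceil> w)
      \<in> measurable (borel \<Otimes>\<^sub>M M) N"
  proof (rule measurable_compose_countable[where g = "\<lambda>w. \<lceil>(real n + 1) * fst w\<rceil>"])
    show "(\<lambda>w. f (real_of_int (max 0 (j - 1)) / (real n + 1)) (snd w)) \<in> measurable (borel \<Otimes>\<^sub>M M) N"
      for j :: int
      by (rule measurable_compose[OF measurable_snd assms]) simp
    show "(\<lambda>w::real \<times> 'b. \<lceil>(real n + 1) * fst w\<rceil>) \<in> measurable (borel \<Otimes>\<^sub>M M) (count_space UNIV)"
      by measurable
  qed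
  then show ?thesis by (simp add: case_prod_beta')
qed

lemma caratheodory_approx:
  assumes "0 < s"
  defines "r \<equiv> \<lambda>n::nat. real_of_int (max 0 (\<lceil>(real n + 1) * s\<rceil> - 1)) / (real n + 1)"
  shows "0 \<le> r n" "r n < s" "r \<longlonglongrightarrow> s"
proof -
  show "0 \<le> r n" for n unfolding r_def by simp
  show less: "r n < s" for n
  proof -
    have "0 < (real n + 1) * s" using assms(1) by simp
    then have "real_of_int (max 0 (\<lceil>(real n + 1) * s\<rceil> - 1)) < (real n + 1) * s"
      by (auto simp: max_def) linarith
    then show ?thesis unfolding r_def by (simp add: field_simps)
  qed
  have lower: "s - 1 / (real n + 1) \<le> r n" for n
  proof -
    have "(real n + 1) * s - 1 \<le> real_of_int (max 0 (\<lceil>(real n + 1) * s\<rceil> - 1))" by linarith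
    then have "((real n + 1) * s - 1) / (real n + 1) \<le> r n"
      unfolding r_def by (intro divide_right_mono) auto
    then show ?thesis by (simp add: diff_divide_distrib)
  qed
  have "(\<lambda>n. s - 1 / (real n + 1)) \<longlonglongrightarrow> s"
    using tendsto_diff[OF tendsto_const[of s] LIMSEQ_inverse_real_of_nat]
    by (simp add: inverse_eq_divide add.commute)
  then show "r \<longlonglongrightarrow> s"
    by (rule tendsto_sandwich[rotated 2, OF _ tendsto_const])
       (use lower less in \<open>auto intro!: always_eventually less_imp_le\<close>)
qed

lemma caratheodory_LIMSEQ:
  fixes f :: "real \<Rightarrow> 'b \<Rightarrow> 'c::topological_space"
  assumes "\<And>r. 0 < s \<Longrightarrow> (\<And>n. 0 \<le> r n) \<Longrightarrow> (\<And>n. r n < s) \<Longrightarrow> r \<longlonglongrightarrow> s \<Longrightarrow> (\<lambda>n. f (r n) z) \<longlonglongrightarrow> f s z"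
  shows "(\<lambda>n. f (real_of_int (max 0 (\<lceil>(real n + 1) * s\<rceil> - 1)) / (real n + 1)) z) \<longlonglongrightarrow> f (max 0 s) z"
proof (cases "0 < s")
  case True
  then show ?thesis using assms[OF True caratheodory_approx[OF True]] by simp
next
  case False
  then have "\<lceil>(real n + 1) * s\<rceil> \<le> 0" for n :: nat
    by (simp add: mult_nonneg_nonpos)
  then have "max 0 (\<lceil>(real n + 1) * s\<rceil> - 1) = 0" for n :: nat
    by (smt (verit))
  then show ?thesis using False by simp
qed

text \<open>The approximations converge from the left, so left continuity in time is enough. Right
  continuity can fail for killed functionals, which drop to 0 after the path has left the closed
  set.\<close>

lemma caratheodory_measurable_metric:
  fixes f :: "real \<Rightarrow> 'b \<Rightarrow> 'c::metric_space"
  assumes "\<And>s. 0 \<le> s \<Longrightarrow> f s \<in> borel_measurable M"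
    and "\<And>s z r. 0 < s \<Longrightarrow> z \<in> space M \<Longrightarrow> (\<And>n. 0 \<le> r n) \<Longrightarrow> (\<And>n. r n < s) \<Longrightarrow> r \<longlonglongrightarrow> s \<Longrightarrow>
      (\<lambda>n. f (r n) z) \<longlonglongrightarrow> f s z"
  shows "(\<lambda>(s, z). f (max 0 s) z) \<in> borel_measurable (borel \<Otimes>\<^sub>M M)"
  by (rule borel_measurable_LIMSEQ_metric[OF caratheodory_step_measurable[OF assms(1)]])
     (use assms(2) in \<open>auto simp: space_pair_measure intro!: caratheodory_LIMSEQ\<close>)

lemma caratheodory_measurable_ennreal:
  fixes f :: "real \<Rightarrow> 'b \<Rightarrow> ennreal"
  assumes "\<And>s. 0 \<le> s \<Longrightarrow> f s \<in> borel_measurable M"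
    and "\<And>s z r. 0 < s \<Longrightarrow> z \<in> space M \<Longrightarrow> (\<And>n. 0 \<le> r n) \<Longrightarrow> (\<And>n. r n < s) \<Longrightarrow> r \<longlonglongrightarrow> s \<Longrightarrow>
      (\<lambda>n. f (r n) z) \<longlonglongrightarrow> f s z"
  shows "(\<lambda>(s, z). f (max 0 s) z) \<in> borel_measurable (borel \<Otimes>\<^sub>M M)"
  by (rule borel_measurable_LIMSEQ_order[OF _ caratheodory_step_measurable[OF assms(1)]])
     (use assms(2) in \<open>auto simp: space_pair_measure intro!: caratheodory_LIMSEQ\<close>)

text \<open>Replacing the indicator of the closed set by these continuous functions, which decrease to it,
  makes the approximations of the killed semigroup preserve continuity.\<close>

definition bump :: "'a::metric_space set \<Rightarrow> nat \<Rightarrow> 'a \<Rightarrow> real" where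
  "bump K n z = max 0 (1 - real n * infdist z K)"

lemma bump_nonneg [simp]: "0 \<le> bump K n z" and bump_le_1 [simp]: "bump K n z \<le> 1"
  by (auto simp: bump_def infdist_nonneg)

lemma continuous_bump: "continuous_on UNIV (bump K n)"
  unfolding bump_def by (intro continuous_intros)

lemma bump_measurable [measurable]: "bump K n \<in> borel_measurable borel"
  by (rule borel_measurable_continuous_onI[OF continuous_bump])

text \<open>The mesh of the grid and the steepness of \<open>bump K n\<close> are tied to the same
  \<open>n\<close>. A path outside \<open>K\<close> at time \<open>u\<close> has there a positive
  distance \<epsilon> from \<open>K\<close>; a grid time close to \<open>u\<close> keeps half of it,
  and once \<open>n * \<epsilon> / 2\<close> is at least 1 the corresponding factor, hence the
  product, vanishes.\<close>

lemma prod_bump_LIMSEQ: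
  fixes \<gamma> :: "real \<Rightarrow> 'a::metric_space"
  assumes \<gamma>: "continuous_on {0..} \<gamma>" and s: "0 \<le> s" and K: "closed K" "K \<noteq> {}"
  shows "(\<lambda>n. \<Prod>k\<le>Suc n. ennreal (bump K n (\<gamma> (real k * (s / real (Suc n))))))
    \<longlonglongrightarrow> (if \<forall>u\<in>{0..s}. \<gamma> u \<in> K then 1 else 0)"
proof (cases "\<forall>u\<in>{0..s}. \<gamma> u \<in> K")
  case True
  have "real k * (s / real (Suc n)) \<in> {0..s}" if "k \<le> Suc n" for k n
  proof -
    have "real k / real (Suc n) \<le> 1" using that by simp
    then have "real k / real (Suc n) * s \<le> 1 * s" using s by (intro mult_right_mono) auto
    then show ?thesis using s by simp
  qed
  then have "(\<Prod>k\<le>Suc n. ennreal (bump K n (\<gamma> (real k * (s / real (Suc n)))))) = 1" for n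
    using True by (intro prod.neutral) (auto simp: bump_def)
  then show ?thesis using True by simp
next
  case False
  then obtain u where u: "0 \<le> u" "u \<le> s" "\<gamma> u \<notin> K" by auto
  define \<epsilon> where "\<epsilon> = infdist (\<gamma> u) K"
  have "\<epsilon> > 0" unfolding \<epsilon>_def using K u(3) by (simp add: infdist_pos_not_in_closed)
  then obtain \<delta> where \<delta>: "\<delta> > 0" "\<And>v. 0 \<le> v \<Longrightarrow> dist v u < \<delta> \<Longrightarrow> dist (\<gamma> v) (\<gamma> u) < \<epsilon> / 2"
    using \<gamma> u(1) unfolding continuous_on_iff by (metis atLeast_iff half_gt_zero)
  obtain N1 :: nat where N1: "real N1 > 2 / \<epsilon>" using reals_Archimedean2 by blast
  obtain N2 :: nat where N2: "real N2 > s / \<delta>" using reals_Archimedean2 by blast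
  have "(\<Prod>k\<le>Suc n. ennreal (bump K n (\<gamma> (real k * (s / real (Suc n)))))) = 0"
    if n: "n \<ge> max N1 N2" for n
  proof -
    \<comment> \<open>The index of the last grid time not after \<open>u\<close>. For
      \<open>s = 0\<close> the quotient is 0 by convention, so that \<open>k = 0\<close> and
      \<open>v = u = 0\<close>.\<close>
    define k where "k = nat \<lfloor>u * real (Suc n) / s\<rfloor>"
    define v where "v = real k * (s / real (Suc n))"
    have "k \<le> Suc n \<and> \<bar>v - u\<bar> \<le> s / real (Suc n)"
    proof (cases "s = 0")
      case True
      then show ?thesis using u by (simp add: k_def v_def)
    next
      case False
      then have sp: "s > 0" using s by simp
      have le: "u * real (Suc n) / s \<le> real (Suc n)"
        using u sp by (simp add: divide_le_eq mult.commute mult_left_mono)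
      have ge0: "0 \<le> u * real (Suc n) / s" using u sp by simp
      have k1: "k \<le> Suc n" unfolding k_def using le by linarith
      have rk: "real k \<le> u * real (Suc n) / s" "u * real (Suc n) / s \<le> real k + 1"
        unfolding k_def using ge0 by (auto simp: of_nat_nat) 
      define d where "d = s / real (Suc n)"
      have d: "d > 0" using sp by (simp add: d_def)
      have ud: "u * real (Suc n) / s = u / d" by (simp add: d_def)
      have vd: "v = real k * d" by (simp add: v_def d_def)
      have "v \<le> u" using rk(1) d unfolding ud vd by (simp add: pos_le_divide_eq)
      moreover have "u \<le> v + s / real (Suc n)"
        using rk(2) d unfolding ud vd d_def[symmetric] by (simp add: pos_divide_le_eq distrib_right)
      ultimately show ?thesis using k1 by auto
    qed
    then have k: "k \<le> Suc n" and v: "\<bar>v - u\<bar> \<le> s / real (Suc n)" by auto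
    have "s < real N2 * \<delta>" using N2 \<delta>(1) by (simp add: divide_less_eq)
    also have "\<dots> \<le> real (Suc n) * \<delta>" using n \<delta>(1) by (intro mult_right_mono) auto
    finally have "s / real (Suc n) < \<delta>" by (simp add: divide_less_eq mult.commute)
    then have "dist v u < \<delta>" using v by (simp add: dist_real_def)
    moreover have "0 \<le> v" unfolding v_def using s by simp
    ultimately have "dist (\<gamma> v) (\<gamma> u) < \<epsilon> / 2" using \<delta>(2) by blast
    then have inf: "\<epsilon> / 2 \<le> infdist (\<gamma> v) K"
      using infdist_triangle[of "\<gamma> u" K "\<gamma> v"] by (simp add: \<epsilon>_def dist_commute)
    have "2 < real N1 * \<epsilon>" using N1 \<open>\<epsilon> > 0\<close> by (simp add: divide_less_eq)
    also have "\<dots> \<le> real n * \<epsilon>" using n \<open>\<epsilon> > 0\<close> by (intro mult_right_mono) auto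
    finally have "1 \<le> real n * (\<epsilon> / 2)" by simp
    also have "\<dots> \<le> real n * infdist (\<gamma> v) K" using inf by (intro mult_left_mono) auto
    finally have "bump K n (\<gamma> v) = 0" by (simp add: bump_def)
    then show ?thesis using k unfolding v_def by (intro prod_zero) (auto intro!: bexI[of _ k])
  qed
  then have "\<forall>\<^sub>F n in sequentially. (\<Prod>k\<le>Suc n. ennreal (bump K n (\<gamma> (real k * (s / real (Suc n)))))) = 0"
    using eventually_sequentially by blast
  then show ?thesis using False by (auto intro: tendsto_eventually)
qed

text \<open>A path that is in \<open>K\<close> before time \<open>s\<close> is in \<open>K\<close>
  at \<open>s\<close> as well, because \<open>K\<close> is closed; if it has been outside
  \<open>K\<close> before \<open>s\<close>, the values at times close to \<open>s\<close> are
  already 0.\<close>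

lemma stay_left_continuous:
  fixes \<gamma> :: "real \<Rightarrow> 'a::metric_space" and f :: "'a \<Rightarrow> real"
  assumes \<gamma>: "continuous_on {0..} \<gamma>" and K: "closed K" and f: "continuous_on UNIV f"
    and s: "0 < s" and r: "\<And>n. 0 \<le> r n" "\<And>n. r n < s" "r \<longlonglongrightarrow> s"
  shows "(\<lambda>n. (if \<forall>u\<in>{0..r n}. \<gamma> u \<in> K then ennreal (f (\<gamma> (r n))) else 0))
    \<longlonglongrightarrow> (if \<forall>u\<in>{0..s}. \<gamma> u \<in> K then ennreal (f (\<gamma> s)) else 0)"
proof -
  have "isCont f (\<gamma> s)" using f by (simp add: continuous_on_eq_continuous_at)
  have \<gamma>r: "(\<lambda>n. \<gamma> (r n)) \<longlonglongrightarrow> \<gamma> s"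
    using continuous_on_tendsto_compose[OF \<gamma> r(3)] s r(1) by auto
  have lim: "(\<lambda>n. ennreal (f (\<gamma> (r n)))) \<longlonglongrightarrow> ennreal (f (\<gamma> s))"
    using isCont_tendsto_compose[OF \<open>isCont f (\<gamma> s)\<close> \<gamma>r] by (rule tendsto_ennrealI)
  show ?thesis
  proof (cases "\<forall>u\<in>{0..<s}. \<gamma> u \<in> K")
    case True
    then have *: "\<forall>u\<in>{0..r n}. \<gamma> u \<in> K" for n using r(2)[of n] by auto
    have "\<gamma> (r n) \<in> K" for n using *[of n] r(1)[of n] by auto
    then have "\<gamma> s \<in> K" by (rule closed_sequentially[OF K _ \<gamma>r])
    then have "\<forall>u\<in>{0..s}. \<gamma> u \<in> K" using True
      by (metis atLeastAtMost_iff atLeastLessThan_iff order_le_less)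
    then show ?thesis using lim unfolding if_P[OF *] by (subst if_P)
  next
    case False
    then obtain u where u: "0 \<le> u" "u < s" "\<gamma> u \<notin> K" by auto
    have "\<forall>\<^sub>F n in sequentially. u < r n" using r(3) u(2) by (rule order_tendstoD)
    then have "\<forall>\<^sub>F n in sequentially. (if \<forall>u\<in>{0..r n}. \<gamma> u \<in> K then ennreal (f (\<gamma> (r n))) else 0) = 0"
      by eventually_elim (use u in auto)
    moreover have "\<not> (\<forall>u\<in>{0..s}. \<gamma> u \<in> K)" using u by auto
    ultimately show ?thesis by (subst if_not_P) (auto intro: tendsto_eventually)
  qed
qed

section \<open>Path functionals after a random time, and the killed semigroup\<close>

context feller_diffusion
begin

lemma X_joint_measurable:
  "(\<lambda>(s, \<omega>). X (max 0 s) \<omega>) \<in> borel_measurable (borel \<Otimes>\<^sub>M P x)"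
proof (rule caratheodory_measurable_metric)
  show "X s \<in> borel_measurable (P x)" if "0 \<le> s" for s using X_measurable[OF that] .
  fix s :: real and \<omega> r
  assume "0 < s" "\<omega> \<in> space (P x)" "\<And>n. 0 \<le> r n" "r \<longlonglongrightarrow> s"
  then show "(\<lambda>n. X (r n) \<omega>) \<longlonglongrightarrow> X s \<omega>"
    using continuous_on_tendsto_compose[OF X_continuous, of \<omega> x r s sequentially] by auto
qed

lemma X_at_measurable:
  assumes [measurable]: "\<tau> \<in> borel_measurable (P x)" and "\<And>\<omega>. 0 \<le> \<tau> \<omega>"
  shows "(\<lambda>\<omega>. X (\<tau> \<omega>) \<omega>) \<in> borel_measurable (P x)"
proof -
  have "(\<lambda>\<omega>. (\<tau> \<omega>, \<omega>)) \<in> measurable (P x) (borel \<Otimes>\<^sub>M P x)" by measurable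
  from measurable_compose[OF this X_joint_measurable] show ?thesis
    using assms(2) by (simp add: max_def)
qed

lemma path_after_continuous:
  "\<omega> \<in> space (P x) \<Longrightarrow> 0 \<le> t \<Longrightarrow> continuous_on {0..} (\<lambda>u. X (t + u) \<omega>)"
  by (rule continuous_on_compose2[OF X_continuous]) (auto intro!: continuous_intros)

text \<open>An uncountable intersection over times, made measurable by writing its indicator as a
  limit of finite products of \<open>bump\<close> factors.\<close>

lemma stays_after_measurable:
  assumes s: "0 \<le> s" and \<tau> [measurable]: "\<tau> \<in> borel_measurable (P x)" and \<tau>0: "\<And>\<omega>. 0 \<le> \<tau> \<omega>"
    and K: "closed K"
  shows "Measurable.pred (P x) (\<lambda>\<omega>. \<forall>u\<in>{0..s}. X (\<tau> \<omega> + u) \<omega> \<in> K)"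
proof (cases "K = {}")
  case True
  then have "(\<lambda>\<omega>. \<forall>u\<in>{0..s}. X (\<tau> \<omega> + u) \<omega> \<in> K) = (\<lambda>_. False)" using s by (auto simp: fun_eq_iff)
  then show ?thesis by simp
next
  case False
  have [measurable]: "(\<lambda>\<omega>. X (\<tau> \<omega> + real k * (s / real (Suc n))) \<omega>) \<in> borel_measurable (P x)" for k n
    by (rule X_at_measurable) (use s \<tau>0 in auto)
  have "(\<lambda>\<omega>. if \<forall>u\<in>{0..s}. X (\<tau> \<omega> + u) \<omega> \<in> K then 1 else 0 :: ennreal) \<in> borel_measurable (P x)"
  proof (rule borel_measurable_LIMSEQ_order)
    show "(\<lambda>n. \<Prod>k\<le>Suc n. ennreal (bump K n (X (\<tau> \<omega> + real k * (s / real (Suc n))) \<omega>)))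
      \<longlonglongrightarrow> (if \<forall>u\<in>{0..s}. X (\<tau> \<omega> + u) \<omega> \<in> K then 1 else 0)" if "\<omega> \<in> space (P x)" for \<omega>
      using prod_bump_LIMSEQ[OF path_after_continuous[OF that \<tau>0] s K False] .
    show "(\<lambda>\<omega>. \<Prod>k\<le>Suc n. ennreal (bump K n (X (\<tau> \<omega> + real k * (s / real (Suc n))) \<omega>)))
      \<in> borel_measurable (P x)" for n
      by (rule borel_measurable_prod_ennreal) (auto simp del: times_divide_eq_right of_nat_Suc)
  qed
  then have "Measurable.pred (P x)
      (\<lambda>\<omega>. (if \<forall>u\<in>{0..s}. X (\<tau> \<omega> + u) \<omega> \<in> K then 1 else 0 :: ennreal) = 1)"
    by measurable
  moreover have "(\<lambda>\<omega>. (if \<forall>u\<in>{0..s}. X (\<tau> \<omega> + u) \<omega> \<in> K then 1 else 0 :: ennreal) = 1)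
     = (\<lambda>\<omega>. \<forall>u\<in>{0..s}. X (\<tau> \<omega> + u) \<omega> \<in> K)" by auto
  ultimately show ?thesis by simp
qed

definition stays :: "'a set \<Rightarrow> real \<Rightarrow> 'w \<Rightarrow> bool" where
  "stays K s \<omega> \<longleftrightarrow> (\<forall>u\<in>{0..s}. X u \<omega> \<in> K)"

text \<open>All grid times lie in [0,s], so the approximating products, and with them their limit,
  depend only on the past up to \<open>s\<close>.\<close>

lemma stays_filtration:
  assumes s: "0 \<le> s" and K: "closed K"
  shows "Measurable.pred (\<F> x s) (stays K s)"
proof (cases "K = {}")
  case True
  then have "stays K s = (\<lambda>_. False)" using s by (auto simp: stays_def fun_eq_iff)
  then show ?thesis by simp
next
  case False
  have [measurable]: "X (real k * (s / real (Suc n))) \<in> borel_measurable (\<F> x s)" if "k \<le> Suc n" for k n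
  proof (rule X_in_filtration)
    have "real k / real (Suc n) * s \<le> 1 * s" using s that by (intro mult_right_mono) auto
    then show "real k * (s / real (Suc n)) \<le> s" by simp
  qed (use s in simp)
  have "(\<lambda>\<omega>. if stays K s \<omega> then 1 else 0 :: ennreal) \<in> borel_measurable (\<F> x s)"
  proof (rule borel_measurable_LIMSEQ_order)
    show "(\<lambda>n. \<Prod>k\<le>Suc n. ennreal (bump K n (X (real k * (s / real (Suc n))) \<omega>)))
      \<longlonglongrightarrow> (if stays K s \<omega> then 1 else 0)" if "\<omega> \<in> space (\<F> x s)" for \<omega>
      using prod_bump_LIMSEQ[of "\<lambda>t. X t \<omega>" s K] X_continuous[of \<omega> x] that s K False
      by (simp add: stays_def)
    show "(\<lambda>\<omega>. \<Prod>k\<le>Suc n. ennreal (bump K n (X (real k * (s / real (Suc n))) \<omega>))) \<in> borel_measurable (\<F> x s)" for n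
      by (rule borel_measurable_prod_ennreal) (auto simp del: times_divide_eq_right of_nat_Suc)
  qed
  then have "Measurable.pred (\<F> x s) (\<lambda>\<omega>. (if stays K s \<omega> then 1 else 0 :: ennreal) = 1)"
    by measurable
  moreover have "(\<lambda>\<omega>. (if stays K s \<omega> then 1 else 0 :: ennreal) = 1) = stays K s" by auto
  ultimately show ?thesis by simp
qed

lemma stays_measurable:
  "0 \<le> s \<Longrightarrow> closed K \<Longrightarrow> Measurable.pred (P x) (stays K s)"
  by (rule filtration_measurable[OF stays_filtration])

text \<open>The integrand of the killed semigroup for the path observed from time \<open>t\<close>
  on. In the strong Markov property \<open>t\<close> becomes an exit time.\<close>

definition killed :: "'a set \<Rightarrow> ('a \<Rightarrow> real) \<Rightarrow> real \<Rightarrow> real \<Rightarrow> 'w \<Rightarrow> ennreal" where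
  "killed K f t s \<omega> = (if \<forall>u\<in>{0..s}. X (t + u) \<omega> \<in> K then ennreal (f (X (t + s) \<omega>)) else 0)"

lemma killed_0: "killed K f 0 s \<omega> = (if stays K s \<omega> then ennreal (f (X s \<omega>)) else 0)"
  by (simp add: killed_def stays_def cong: if_cong)

lemma killed_le: "(\<And>z. f z \<le> c) \<Longrightarrow> killed K f t s \<omega> \<le> ennreal c"
  by (simp add: killed_def ennreal_leI)

lemma killed_measurable:
  assumes s: "0 \<le> s" and \<tau>: "\<tau> \<in> borel_measurable (P x)" "\<And>\<omega>. 0 \<le> \<tau> \<omega>"
    and K: "closed K" and [measurable]: "f \<in> borel_measurable borel"
  shows "(\<lambda>\<omega>. killed K f (\<tau> \<omega>) s \<omega>) \<in> borel_measurable (P x)"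
proof -
  have [measurable]: "(\<lambda>\<omega>. X (\<tau> \<omega> + s) \<omega>) \<in> borel_measurable (P x)"
    by (rule X_at_measurable) (use s \<tau> in auto)
  show ?thesis unfolding killed_def using stays_after_measurable[OF s \<tau> K] by measurable
qed

text \<open>The killed semigroup at time \<open>s\<close>; for \<open>f = 1\<close> it is the
  probability of surviving in \<open>K\<close> up to time \<open>s\<close>, whence the name.\<close>

definition surv :: "'a set \<Rightarrow> real \<Rightarrow> ('a \<Rightarrow> real) \<Rightarrow> 'a \<Rightarrow> ennreal" where
  "surv K s f z = (\<integral>\<^sup>+\<omega>. killed K f 0 s \<omega> \<partial>P z)"

lemma surv_le:
  assumes "\<And>z. f z \<le> c"
  shows "surv K s f z \<le> ennreal c"
proof -
  have "surv K s f z \<le> (\<integral>\<^sup>+\<omega>. ennreal c \<partial>P z)"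
    unfolding surv_def using assms by (intro nn_integral_mono killed_le)
  then show ?thesis by simp
qed

text \<open>\<open>grid\<close> and \<open>grid_path\<close> approximate \<open>surv\<close> and
  \<open>killed\<close>: survival in \<open>K\<close> is replaced by the weights
  \<open>bump K n\<close> at the \<open>n + 2\<close> times with spacing
  \<open>s / (n + 1)\<close>.\<close>

abbreviation grid :: "'a set \<Rightarrow> real \<Rightarrow> nat \<Rightarrow> ('a \<Rightarrow> real) \<Rightarrow> 'a \<Rightarrow> ennreal" where
  "grid K s n f \<equiv> chain (\<lambda>z. ennreal (bump K n z)) (s / real (Suc n)) (Suc n) (\<lambda>z. ennreal (f z))"

definition grid_path :: "'a set \<Rightarrow> real \<Rightarrow> nat \<Rightarrow> ('a \<Rightarrow> real) \<Rightarrow> real \<Rightarrow> 'w \<Rightarrow> ennreal" where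
  "grid_path K s n f t \<omega> =
    (\<Prod>k\<le>Suc n. ennreal (bump K n (X (t + real k * (s / real (Suc n))) \<omega>))) * ennreal (f (X (t + s) \<omega>))"

lemma prod_bump_le_1: "(\<Prod>k\<in>A. ennreal (bump K n (g k))) \<le> 1"
  by (intro prod_le_1) (auto simp: ennreal_le_1)

lemma grid_path_le:
  assumes "\<And>z. f z \<le> c"
  shows "grid_path K s n f t \<omega> \<le> ennreal c"
  unfolding grid_path_def by (rule order_trans[OF mult_mono[OF prod_bump_le_1 ennreal_leI[OF assms]]]) auto

lemma grid_path_measurable:
  assumes s: "0 \<le> s" and \<tau>: "\<tau> \<in> borel_measurable (P x)" "\<And>\<omega>. 0 \<le> \<tau> \<omega>"
    and [measurable]: "f \<in> borel_measurable borel"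
  shows "(\<lambda>\<omega>. grid_path K s n f (\<tau> \<omega>) \<omega>) \<in> borel_measurable (P x)"
proof -
  have Xm [measurable]: "(\<lambda>\<omega>. X (\<tau> \<omega> + a) \<omega>) \<in> borel_measurable (P x)" if "0 \<le> a" for a
    by (rule X_at_measurable) (use that \<tau> in auto)
  have [measurable]: "(\<lambda>\<omega>. X (\<tau> \<omega> + s) \<omega>) \<in> borel_measurable (P x)" using Xm[OF s] .
  have [measurable]: "(\<lambda>\<omega>. X (\<tau> \<omega> + real k * (s / real (Suc n))) \<omega>) \<in> borel_measurable (P x)" for k
    by (rule Xm) (use s in simp)
  have "(\<lambda>\<omega>. ennreal (bump K n (X (\<tau> \<omega> + real k * (s / real (Suc n))) \<omega>))) \<in> borel_measurable (P x)" for k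
    by measurable
  then show ?thesis unfolding grid_path_def by (intro borel_measurable_times_ennreal borel_measurable_prod_ennreal) auto
qed

lemma grid_path_LIMSEQ:
  assumes "\<omega> \<in> space (P x)" "0 \<le> t" "0 \<le> s" "closed K" "K \<noteq> {}"
  shows "(\<lambda>n. grid_path K s n f t \<omega>) \<longlonglongrightarrow> killed K f t s \<omega>"
proof -
  have killed: "killed K f t s \<omega> = (if \<forall>u\<in>{0..s}. X (t + u) \<omega> \<in> K then 1 else 0) * ennreal (f (X (t + s) \<omega>))"
    unfolding killed_def by (rule if_split[THEN iffD2]) auto
  show ?thesis
    unfolding grid_path_def killed
    by (intro tendsto_mult_ennreal tendsto_const prod_bump_LIMSEQ path_after_continuous[of \<omega> x] assms) auto
qed

lemma grid_measurable:
  assumes "0 \<le> s" "f \<in> borel_measurable borel"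
  shows "grid K s n f \<in> borel_measurable borel"
  using assms by (intro chain_measurable) auto

lemma grid_eq:
  assumes s: "0 \<le> s" and f: "f \<in> borel_measurable borel"
  shows "grid K s n f z = (\<integral>\<^sup>+\<omega>. grid_path K s n f 0 \<omega> \<partial>P z)"
proof -
  have cancel: "real (Suc n) * (s / real (Suc n)) = s" by simp
  have h: "0 \<le> s / real (Suc n)" using s by simp
  have fm: "(\<lambda>z. ennreal (f z)) \<in> borel_measurable borel" using f by measurable
  have bm: "(\<lambda>z. ennreal (bump K n z)) \<in> borel_measurable borel" by measurable
  show ?thesis using chain_eq[OF h bm fm, of "Suc n" z] unfolding cancel grid_path_def by simp
qed

lemma grid_le:
  assumes s: "0 \<le> s" and f: "f \<in> borel_measurable borel" "\<And>z. f z \<le> c"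
  shows "grid K s n f z \<le> ennreal c"
proof -
  have "grid K s n f z \<le> (\<integral>\<^sup>+\<omega>. ennreal c \<partial>P z)"
    unfolding grid_eq[OF s f(1)] by (intro nn_integral_mono grid_path_le f)
  then show ?thesis by simp
qed

lemma grid_LIMSEQ:
  assumes s: "0 \<le> s" and K: "closed K" "K \<noteq> {}" and f: "f \<in> borel_measurable borel" "\<And>z. f z \<le> c"
  shows "(\<lambda>n. grid K s n f z) \<longlonglongrightarrow> surv K s f z"
  unfolding grid_eq[OF s f(1)] surv_def
proof (rule nn_integral_dominated_convergence[where w = "\<lambda>_. ennreal c"])
  show "grid_path K s n f 0 \<in> borel_measurable (P z)" for n
    using grid_path_measurable[OF s _ _ f(1), of "\<lambda>_. 0"] by simp
  show "killed K f 0 s \<in> borel_measurable (P z)"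
    using killed_measurable[OF s _ _ K(1) f(1), of "\<lambda>_. 0"] by simp
  show "AE \<omega> in P z. (\<lambda>n. grid_path K s n f 0 \<omega>) \<longlonglongrightarrow> killed K f 0 s \<omega>"
    by (intro AE_I2 grid_path_LIMSEQ s K) auto
qed (use grid_path_le f in \<open>auto simp: ennreal_mult_less_top\<close>)

lemma surv_measurable:
  assumes s: "0 \<le> s" and K: "closed K" "K \<noteq> {}" and f: "f \<in> borel_measurable borel" "\<And>z. f z \<le> c"
  shows "surv K s f \<in> borel_measurable borel"
  by (rule borel_measurable_LIMSEQ_order[OF grid_LIMSEQ[OF s K f] grid_measurable[OF s f(1)]])

text \<open>The passage from grids to survival in \<open>K\<close> is the same for the Markov
  property at a fixed time and for the strong Markov property at an exit time, and is isolated here.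
  Both sides of the grid identity converge by dominated convergence with the constant bound
  \<open>c\<close>.\<close>

lemma killed_identity_limit:
  assumes s: "0 \<le> s" and K: "closed K" "K \<noteq> {}" and f: "f \<in> borel_measurable borel" "\<And>z. f z \<le> c"
    and \<tau>: "\<tau> \<in> borel_measurable (P x)" "\<And>\<omega>. 0 \<le> \<tau> \<omega>"
    and G: "G \<in> borel_measurable (P x)" "\<And>\<omega>. G \<omega> \<le> 1"
    and grid: "\<And>n. (\<integral>\<^sup>+\<omega>. G \<omega> * grid_path K s n f (\<tau> \<omega>) \<omega> \<partial>P x) = (\<integral>\<^sup>+\<omega>. G \<omega> * grid K s n f (X (\<tau> \<omega>) \<omega>) \<partial>P x)"
  shows "(\<integral>\<^sup>+\<omega>. G \<omega> * killed K f (\<tau> \<omega>) s \<omega> \<partial>P x) = (\<integral>\<^sup>+\<omega>. G \<omega> * surv K s f (X (\<tau> \<omega>) \<omega>) \<partial>P x)"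
proof -
  have fin: "G \<omega> \<noteq> \<top>" for \<omega> using G(2)[of \<omega>] by (auto simp: top_unique)
  have Gc: "G \<omega> * e \<le> ennreal c" if "e \<le> ennreal c" for \<omega> e
    using mult_mono[OF G(2) that, of \<omega>] by simp
  have Xm: "(\<lambda>\<omega>. X (\<tau> \<omega>) \<omega>) \<in> borel_measurable (P x)" by (rule X_at_measurable[OF \<tau>])
  have L: "(\<lambda>n. \<integral>\<^sup>+\<omega>. G \<omega> * grid_path K s n f (\<tau> \<omega>) \<omega> \<partial>P x) \<longlonglongrightarrow> (\<integral>\<^sup>+\<omega>. G \<omega> * killed K f (\<tau> \<omega>) s \<omega> \<partial>P x)"
  proof (rule nn_integral_dominated_convergence[where w = "\<lambda>_. ennreal c"])
    show "AE \<omega> in P x. (\<lambda>n. G \<omega> * grid_path K s n f (\<tau> \<omega>) \<omega>) \<longlonglongrightarrow> G \<omega> * killed K f (\<tau> \<omega>) s \<omega>"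
    proof (rule AE_I2)
      fix \<omega> assume \<omega>: "\<omega> \<in> space (P x)"
      have "killed K f (\<tau> \<omega>) s \<omega> \<noteq> \<top>" by (simp add: killed_def)
      then show "(\<lambda>n. G \<omega> * grid_path K s n f (\<tau> \<omega>) \<omega>) \<longlonglongrightarrow> G \<omega> * killed K f (\<tau> \<omega>) s \<omega>"
        using fin by (intro tendsto_mult_ennreal tendsto_const grid_path_LIMSEQ[OF \<omega> \<tau>(2) s K]) auto
    qed
    show "(\<lambda>\<omega>. G \<omega> * grid_path K s n f (\<tau> \<omega>) \<omega>) \<in> borel_measurable (P x)" for n
      using G(1) grid_path_measurable[OF s \<tau> f(1)] by (rule borel_measurable_times_ennreal)
    show "(\<lambda>\<omega>. G \<omega> * killed K f (\<tau> \<omega>) s \<omega>) \<in> borel_measurable (P x)"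
      using G(1) killed_measurable[OF s \<tau> K(1) f(1)] by (rule borel_measurable_times_ennreal)
  qed (use Gc grid_path_le f in \<open>auto simp: ennreal_mult_less_top\<close>)
  have R: "(\<lambda>n. \<integral>\<^sup>+\<omega>. G \<omega> * grid K s n f (X (\<tau> \<omega>) \<omega>) \<partial>P x) \<longlonglongrightarrow> (\<integral>\<^sup>+\<omega>. G \<omega> * surv K s f (X (\<tau> \<omega>) \<omega>) \<partial>P x)"
  proof (rule nn_integral_dominated_convergence[where w = "\<lambda>_. ennreal c"])
    have "surv K s f z \<noteq> \<top>" for z using surv_le[of f c K s z] f(2) by (auto simp: top_unique)
    then show "AE \<omega> in P x. (\<lambda>n. G \<omega> * grid K s n f (X (\<tau> \<omega>) \<omega>)) \<longlonglongrightarrow> G \<omega> * surv K s f (X (\<tau> \<omega>) \<omega>)"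
      using fin by (intro AE_I2 tendsto_mult_ennreal tendsto_const grid_LIMSEQ[OF s K f]) auto
    show "(\<lambda>\<omega>. G \<omega> * grid K s n f (X (\<tau> \<omega>) \<omega>)) \<in> borel_measurable (P x)" for n
      using G(1) measurable_compose[OF Xm grid_measurable[OF s f(1)]] by (rule borel_measurable_times_ennreal)
    show "(\<lambda>\<omega>. G \<omega> * surv K s f (X (\<tau> \<omega>) \<omega>)) \<in> borel_measurable (P x)"
      using G(1) measurable_compose[OF Xm surv_measurable[OF s K f]] by (rule borel_measurable_times_ennreal)
    show "AE \<omega> in P x. G \<omega> * grid K s n f (X (\<tau> \<omega>) \<omega>) \<le> ennreal c" for n
      by (intro AE_I2 Gc grid_le s f)
  qed (auto simp: ennreal_mult_less_top)
  show ?thesis using LIMSEQ_unique[OF L R[folded grid]] .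
qed

lemma killed_joint_measurable:
  assumes \<tau>: "\<tau> \<in> borel_measurable (P x)" "\<And>\<omega>. 0 \<le> \<tau> \<omega>"
    and K: "closed K" and f: "continuous_on UNIV f"
  shows "(\<lambda>(s, \<omega>). killed K f (\<tau> \<omega>) (max 0 s) \<omega>) \<in> borel_measurable (borel \<Otimes>\<^sub>M P x)"
proof (rule caratheodory_measurable_ennreal[where f = "\<lambda>s \<omega>. killed K f (\<tau> \<omega>) s \<omega>"])
  show "(\<lambda>\<omega>. killed K f (\<tau> \<omega>) s \<omega>) \<in> borel_measurable (P x)" if "0 \<le> s" for s
    by (rule killed_measurable[OF that \<tau> K borel_measurable_continuous_onI[OF f]])
qed (unfold killed_def, rule stay_left_continuous[OF path_after_continuous K f], use \<tau>(2) in auto)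

lemma surv_joint_measurable:
  assumes K: "closed K" "K \<noteq> {}" and f: "continuous_on UNIV f" and fc: "\<And>z. f z \<le> c"
  shows "(\<lambda>(s, z). surv K (max 0 s) f z) \<in> borel_measurable (borel \<Otimes>\<^sub>M borel)"
proof (rule caratheodory_measurable_ennreal)
  have fm: "f \<in> borel_measurable borel" by (rule borel_measurable_continuous_onI[OF f])
  show "surv K s f \<in> borel_measurable borel" if "0 \<le> s" for s
    by (rule surv_measurable[OF that K fm fc])
  fix s :: real and z :: 'a and r
  assume s: "0 < s" and r: "\<And>n. 0 \<le> r n" "\<And>n. r n < s" "r \<longlonglongrightarrow> s"
  have m: "killed K f 0 t \<in> borel_measurable (P z)" if "0 \<le> t" for t
    using killed_measurable[OF that _ _ K(1) fm, of "\<lambda>_. 0"] by simp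
  show "(\<lambda>n. surv K (r n) f z) \<longlonglongrightarrow> surv K s f z"
    unfolding surv_def
  proof (rule nn_integral_dominated_convergence[where w = "\<lambda>_. ennreal c"])
    show "AE \<omega> in P z. (\<lambda>n. killed K f 0 (r n) \<omega>) \<longlonglongrightarrow> killed K f 0 s \<omega>"
      unfolding killed_def
      by (intro AE_I2 stay_left_continuous[OF path_after_continuous K(1) f s r]) auto
  qed (use s r m killed_le fc in \<open>auto simp: ennreal_mult_less_top\<close>)
qed

lemma indicator_max: "indicator {0<..} s * g (max 0 s) = indicator {0<..} (s::real) * (g s :: ennreal)"
  by (auto simp: indicator_def max_def)

lemma surv_indicator_measurable:
  assumes K: "closed K" "K \<noteq> {}" and f: "continuous_on UNIV f" and fc: "\<And>z. f z \<le> c"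
  shows "(\<lambda>(s, z). indicator {0<..} s * surv K s f z)
    \<in> borel_measurable (borel \<Otimes>\<^sub>M borel)"
proof -
  note [measurable] = surv_joint_measurable[OF assms]
  have "(\<lambda>(s, z). indicator {0<..} s * surv K (max 0 s) f z)
    \<in> borel_measurable (borel \<Otimes>\<^sub>M borel)" by measurable
  then show ?thesis by (simp add: indicator_max[of _ "\<lambda>s. surv K s _ _"])
qed

lemma surv_outside: "0 \<le> s \<Longrightarrow> z \<notin> K \<Longrightarrow> surv K s f z = 0"
  unfolding surv_def using X_start[of z]
  by (subst nn_integral_cong_AE[where v = "\<lambda>_. 0"]) (auto simp: killed_0 stays_def)

end

section \<open>Exit times and the strong Markov property\<close>

lemma C0_I:
  assumes "continuous_on UNIV f" "compact K" "\<And>z. z \<notin> K \<Longrightarrow> f z = 0"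
  shows "f \<in> C0"
  using assms by (auto simp: C0_def intro!: exI[of _ K])

lemma C0_continuous: "f \<in> C0 \<Longrightarrow> continuous_on UNIV f"
  by (simp add: C0_def)

lemma C0_bounded:
  assumes "f \<in> C0"
  obtains c where "0 \<le> c" "\<And>z. \<bar>f z\<bar> \<le> c"
proof -
  obtain K where K: "compact K" "\<And>z. z \<notin> K \<Longrightarrow> \<bar>f z\<bar> < 1"
    using assms unfolding C0_def by (auto dest!: spec[of _ 1])
  have "compact (f ` K)"
    using K(1) C0_continuous[OF assms] by (intro compact_continuous_image) (auto intro: continuous_on_subset)
  then obtain B where B: "\<And>z. z \<in> K \<Longrightarrow> \<bar>f z\<bar> \<le> B"
    by (metis bounded_iff compact_imp_bounded image_eqI real_norm_def)
  have "\<bar>f z\<bar> \<le> max 1 B" for z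
    using K(2)[of z] B[of z] by (cases "z \<in> K") auto
  then show thesis by (intro that[of "max 1 B"]) auto
qed

lemma C0_mult:
  assumes \<phi>: "continuous_on UNIV \<phi>" "\<And>z. 0 \<le> \<phi> z" "\<And>z. \<phi> z \<le> 1" and f: "f \<in> C0"
  shows "(\<lambda>z. \<phi> z * f z) \<in> C0"
proof -
  have "\<bar>\<phi> z * f z\<bar> \<le> \<bar>f z\<bar>" for z
    using \<phi>(2,3)[of z] by (simp add: abs_mult mult_left_le_one_le)
  then have "\<exists>K. compact K \<and> (\<forall>z. z \<notin> K \<longrightarrow> \<bar>\<phi> z * f z\<bar> < \<epsilon>)" if "\<epsilon> > 0" for \<epsilon>
    using f that unfolding C0_def by (smt (verit) mem_Collect_eq)
  moreover have "continuous_on UNIV (\<lambda>z. \<phi> z * f z)"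
    using \<phi>(1) C0_continuous[OF f] by (rule continuous_on_mult)
  ultimately show ?thesis by (simp add: C0_def)
qed

context feller_diffusion
begin

lemma step_C0:
  assumes h: "0 \<le> h" and f: "f \<in> C0" "\<And>z. 0 \<le> f z"
  obtains g where "g \<in> C0" "\<And>z. 0 \<le> g z" "step h (\<lambda>z. ennreal (f z)) = (\<lambda>z. ennreal (g z))"
proof (rule that[of "semigroup_op P X h f"])
  show "semigroup_op P X h f \<in> C0" using feller f h by (simp add: feller_def)
  show "0 \<le> semigroup_op P X h f z" for z
    unfolding semigroup_op_def using f by (intro integral_nonneg_AE) auto
  obtain c where c: "\<And>z. \<bar>f z\<bar> \<le> c" using C0_bounded[OF f(1)] by blast
  have [measurable]: "f \<in> borel_measurable borel"
    using C0_continuous[OF f(1)] by (rule borel_measurable_continuous_onI)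
  show "step h (\<lambda>z. ennreal (f z)) = (\<lambda>z. ennreal (semigroup_op P X h f z))"
  proof
    fix z
    interpret prob_space "P z" by (rule prob_space_P)
    have [measurable]: "X h \<in> borel_measurable (P z)" using X_measurable h .
    have "integrable (P z) (\<lambda>\<omega>. f (X h \<omega>))"
      by (rule integrable_const_bound[where B = c]) (use c in auto)
    then show "step h (\<lambda>z. ennreal (f z)) z = ennreal (semigroup_op P X h f z)"
      unfolding step_def semigroup_op_def using f(2) by (intro nn_integral_eq_integral) auto
  qed
qed

lemma chain_C0:
  assumes h: "0 \<le> h" and f: "f \<in> C0" "\<And>z. 0 \<le> f z"
    and \<phi>: "continuous_on UNIV \<phi>" "\<And>z. 0 \<le> \<phi> z" "\<And>z. \<phi> z \<le> 1"
  shows "\<exists>g\<in>C0. (\<forall>z. 0 \<le> g z) \<and>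
    chain (\<lambda>z. ennreal (\<phi> z)) h N (\<lambda>z. ennreal (f z)) = (\<lambda>z. ennreal (g z))"
proof (induction N)
  case 0
  show ?case using C0_mult[OF \<phi> f(1)] f(2) \<phi>(2)
    by (intro bexI[of _ "\<lambda>z. \<phi> z * f z"]) (auto simp: ennreal_mult')
next
  case (Suc N)
  then obtain g where g: "g \<in> C0" "\<And>z. 0 \<le> g z"
    "chain (\<lambda>z. ennreal (\<phi> z)) h N (\<lambda>z. ennreal (f z)) = (\<lambda>z. ennreal (g z))" by blast
  obtain k where k: "k \<in> C0" "\<And>z. 0 \<le> k z" "step h (\<lambda>z. ennreal (g z)) = (\<lambda>z. ennreal (k z))"
    using step_C0[OF h g(1,2)] by blast
  show ?case using C0_mult[OF \<phi> k(1)] k(2) \<phi>(2)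
    by (intro bexI[of _ "\<lambda>z. \<phi> z * k z"]) (auto simp: ennreal_mult' g(3) k(3))
qed

text \<open>Closed sets exhausting the open set \<open>U\<close>. Quantifying over the points of the
  complement, instead of using \<open>infdist\<close>, gives the whole space when \<open>U\<close>
  is everything, whereas \<open>infdist\<close> to the empty set is 0 by convention.\<close>

definition core :: "'a set \<Rightarrow> nat \<Rightarrow> 'a set" where
  "core U m = {z. \<forall>y\<in>-U. 1 / (real m + 1) \<le> dist z y}"

lemma closed_core: "closed (core U m)"
proof -
  have "core U m = (\<Inter>y\<in>-U. {z. 1 / (real m + 1) \<le> dist z y})" by (auto simp: core_def)
  then show ?thesis by (auto intro!: closed_INT closed_Collect_le continuous_intros)
qed

lemma core_subset: "core U m \<subseteq> U"
proof
  fix z assume z: "z \<in> core U m"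
  show "z \<in> U"
  proof (rule ccontr)
    assume "z \<notin> U"
    then have "1 / (real m + 1) \<le> dist z z" using z unfolding core_def by blast
    moreover have "0 < 1 / (real m + 1)" by simp
    ultimately show False by simp
  qed
qed

lemma compact_subset_core:
  assumes "compact C" "open U" "C \<subseteq> U"
  shows "\<exists>m. C \<subseteq> core U m"
proof -
  have "\<exists>d>0. \<forall>x\<in>C. \<forall>y\<in>-U. d \<le> dist x y"
  proof (cases "C = {} \<or> -U = {}")
    case True
    then show ?thesis by (intro exI[of _ 1]) auto
  next
    case False
    have "continuous_on C (\<lambda>z. infdist z (-U))" by (intro continuous_intros)
    then obtain z where z: "z \<in> C" "\<forall>x\<in>C. infdist z (-U) \<le> infdist x (-U)"
      using continuous_attains_inf[OF assms(1)] False by blast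
    have "0 < infdist z (-U)"
      using assms z(1) False by (intro infdist_pos_not_in_closed) auto
    moreover have "infdist z (-U) \<le> dist y v" if "y \<in> C" "v \<in> -U" for y v
      using z(2) that infdist_le[of v "-U" y] by fastforce
    ultimately show ?thesis by blast
  qed
  then obtain d where d: "d > 0" "\<forall>x\<in>C. \<forall>y\<in>-U. d \<le> dist x y" by blast
  obtain m where "inverse (real (Suc m)) < d" using reals_Archimedean d(1) by blast
  then have m: "1 / (real m + 1) \<le> d" by (simp add: inverse_eq_divide add.commute)
  have "C \<subseteq> core U m"
    unfolding core_def using d(2) m by (auto intro: order_trans)
  then show ?thesis by blast
qed

text \<open>A path segment is compact, so if it lies in \<open>U\<close> it lies in one of the
  closed sets \<open>core U m\<close>. Survival in an open set thereby becomes a countable union of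
  survivals in closed sets.\<close>

lemma path_core:
  fixes \<gamma> :: "real \<Rightarrow> 'a"
  assumes "continuous_on {a..b} \<gamma>" "open U"
  shows "(\<forall>u\<in>{a..b}. \<gamma> u \<in> U) \<longleftrightarrow> (\<exists>m. \<forall>u\<in>{a..b}. \<gamma> u \<in> core U m)"
proof
  assume "\<forall>u\<in>{a..b}. \<gamma> u \<in> U"
  then have "\<gamma> ` {a..b} \<subseteq> U" by auto
  moreover have "compact (\<gamma> ` {a..b})" using assms(1) by (intro compact_continuous_image) auto
  ultimately show "\<exists>m. \<forall>u\<in>{a..b}. \<gamma> u \<in> core U m"
    using compact_subset_core[OF _ assms(2)] by (meson image_subset_iff)
qed (use core_subset in blast)

lemma stays_open_filtration:
  assumes s: "0 \<le> s" and U: "open U"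
  shows "Measurable.pred (\<F> x s) (stays U s)"
proof -
  have eq: "stays U s \<omega> \<longleftrightarrow> (\<exists>m. stays (core U m) s \<omega>)" if "\<omega> \<in> space (\<F> x s)" for \<omega>
    unfolding stays_def using that X_continuous[of \<omega> x]
    by (intro path_core U) (auto intro: continuous_on_subset)
  have m: "Measurable.pred (\<F> x s) (\<lambda>\<omega>. \<exists>m. stays (core U m) s \<omega>)"
    using stays_filtration[OF s closed_core] by measurable
  show ?thesis by (rule measurable_cong[THEN iffD2, OF eq m])
qed

section \<open>Exit times from open sets\<close>

lemma exit_time_ge_iff:
  "y \<le> exit_time X U \<omega> \<longleftrightarrow> (\<forall>t>0. X t \<omega> \<notin> U \<longrightarrow> y \<le> ennreal t)"
  unfolding exit_time_def by (auto simp: le_INF_iff)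

text \<open>The exit time ignores time 0 and the starting point is arbitrary here. The event that it
  is at least \<open>y\<close> is therefore expressed by survival in \<open>U\<close> on all
  intervals [a,b] with rational 0 < a \<le> b < y, each of these events being a countable union of
  survivals in closed sets.\<close>

lemma exit_time_measurable:
  assumes U: "open U"
  shows "exit_time X U \<in> borel_measurable (P x)"
proof (rule borel_measurableI_ge)
  fix y :: ennreal
  let ?Q = "\<lambda>a b \<omega>. 0 < a \<and> a \<le> b \<and> ennreal (of_rat b) < y \<longrightarrow>
      (\<exists>m. \<forall>u\<in>{0..of_rat b - of_rat a}. X (of_rat a + u) \<omega> \<in> core U m)"
  have eq: "y \<le> exit_time X U \<omega> \<longleftrightarrow> (\<forall>a b :: rat. ?Q a b \<omega>)" if \<omega>: "\<omega> \<in> space (P x)" for \<omega>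
  proof -
    have core: "(\<exists>m. \<forall>u\<in>{0..of_rat b - of_rat a}. X (of_rat a + u) \<omega> \<in> core U m) \<longleftrightarrow>
      (\<forall>u\<in>{0..of_rat b - of_rat a}. X (of_rat a + u) \<omega> \<in> U)" if "0 < a" for a b :: rat
      by (rule path_core[symmetric, OF _ U])
         (rule continuous_on_subset[OF path_after_continuous[OF \<omega>]], use that in auto)
    show ?thesis
    proof
      assume *: "y \<le> exit_time X U \<omega>"
      show "\<forall>a b :: rat. ?Q a b \<omega>"
      proof (intro allI impI)
        fix a b :: rat assume ab: "0 < a \<and> a \<le> b \<and> ennreal (of_rat b) < y"
        have "X (of_rat a + u) \<omega> \<in> U" if u: "u \<in> {0..of_rat b - of_rat a}" for u
        proof (rule ccontr)
          assume "X (of_rat a + u) \<omega> \<notin> U"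
          moreover have "0 < of_rat a + u" using ab u by (simp add: add_pos_nonneg)
          ultimately have "y \<le> ennreal (of_rat a + u)" using * by (simp add: exit_time_ge_iff)
          also have "\<dots> \<le> ennreal (of_rat b)" using u by (intro ennreal_leI) auto
          finally show False using ab by auto
        qed
        then show "\<exists>m. \<forall>u\<in>{0..of_rat b - of_rat a}. X (of_rat a + u) \<omega> \<in> core U m"
          using core ab by blast
      qed
    next
      assume *: "\<forall>a b :: rat. ?Q a b \<omega>"
      show "y \<le> exit_time X U \<omega>"
        unfolding exit_time_ge_iff
      proof (intro allI impI, rule ccontr)
        fix t assume t: "0 < t" "X t \<omega> \<notin> U" "\<not> y \<le> ennreal t"
        obtain a :: rat where a: "0 < real_of_rat a" "real_of_rat a < t" using of_rat_dense[OF t(1)] by blast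
        have "\<exists>r>t. ennreal r < y"
        proof (cases y)
          case (real r)
          then have "t < r" using t by (simp add: not_le ennreal_less_iff)
          then show ?thesis using real t by (intro exI[of _ "(t + r) / 2"]) (auto simp: ennreal_less_iff)
        qed (auto intro!: exI[of _ "t + 1"])
        then obtain r where r: "t < r" "ennreal r < y" by blast
        obtain b :: rat where b: "t < real_of_rat b" "real_of_rat b < r" using of_rat_dense[OF r(1)] by blast
        have "ennreal (of_rat b) < y" using b r by (meson ennreal_leI less_imp_le order.strict_trans1)
        moreover have "0 < a" "a \<le> b"
          using a b by (auto simp: zero_less_of_rat_iff intro: less_imp_le) (metis less_trans of_rat_less_eq less_imp_le)
        ultimately have "\<forall>u\<in>{0..of_rat b - of_rat a}. X (of_rat a + u) \<omega> \<in> U"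
          using * core by blast
        moreover have "t - of_rat a \<in> {0..real_of_rat b - of_rat a}" using a b by auto
        ultimately have "X (of_rat a + (t - of_rat a)) \<omega> \<in> U" by blast
        then show False using t by simp
      qed
    qed
  qed
  have "Measurable.pred (P x) (\<lambda>\<omega>. \<forall>a b :: rat. ?Q a b \<omega>)"
  proof (intro pred_intros_countable pred_intros_imp' pred_intros_conj1')
    fix a b :: rat and m assume "0 < a \<and> a \<le> b \<and> ennreal (of_rat b) < y"
    then show "Measurable.pred (P x) (\<lambda>\<omega>. \<forall>u\<in>{0..of_rat b - of_rat a}. X (of_rat a + u) \<omega> \<in> core U m)"
      by (intro stays_after_measurable closed_core) (auto simp: of_rat_less_eq)
  qed
  then have sets: "{\<omega> \<in> space (P x). \<forall>a b :: rat. ?Q a b \<omega>} \<in> sets (P x)" by (rule predE)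
  have ge: "{\<omega> \<in> space (P x). y \<le> exit_time X U \<omega>} = {\<omega> \<in> space (P x). \<forall>a b :: rat. ?Q a b \<omega>}"
    using eq by blast
  show "{\<omega> \<in> space (P x). y \<le> exit_time X U \<omega>} \<in> sets (P x)" unfolding ge by (rule sets)
qed

abbreviation etime :: "'a set \<Rightarrow> 'w \<Rightarrow> real" where
  "etime U \<omega> \<equiv> enn2real (exit_time X U \<omega>)"

text \<open>The inequality is strict because \<open>U\<close> is open: a path in \<open>U\<close> up
  to time \<open>s\<close> remains there a little longer. The starting point has to be in
  \<open>U\<close> since the exit time does not see time 0.\<close>

lemma stays_iff_exit:
  assumes \<omega>: "\<omega> \<in> space (P x)" "X 0 \<omega> \<in> U" and U: "open U" and s: "0 \<le> s"
  shows "stays U s \<omega> \<longleftrightarrow> ennreal s < exit_time X U \<omega>"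
proof
  assume st: "stays U s \<omega>"
  then have "X s \<omega> \<in> U" using s by (auto simp: stays_def)
  then obtain e where e: "e > 0" "ball (X s \<omega>) e \<subseteq> U" using U openE by blast
  obtain d where d: "d > 0" "\<And>v. 0 \<le> v \<Longrightarrow> dist v s < d \<Longrightarrow> dist (X v \<omega>) (X s \<omega>) < e"
    using X_continuous[OF \<omega>(1)] s e(1) unfolding continuous_on_iff by (metis atLeast_iff)
  have "ennreal (s + d) \<le> exit_time X U \<omega>"
    unfolding exit_time_ge_iff
  proof (intro allI impI ennreal_leI)
    fix t assume t: "0 < t" "X t \<omega> \<notin> U"
    show "s + d \<le> t"
    proof (rule ccontr)
      assume n: "\<not> s + d \<le> t"
      have "s < t"
      proof (rule ccontr)
        assume "\<not> s < t"
        then have "t \<in> {0..s}" using t by simp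
        then show False using st t unfolding stays_def by blast
      qed
      then have "dist (X t \<omega>) (X s \<omega>) < e" using n t d(2)[of t] by (simp add: dist_real_def)
      then have "X t \<omega> \<in> U" using e(2) by (auto simp: dist_commute)
      then show False using t by simp
    qed
  qed
  moreover have "ennreal s < ennreal (s + d)" using d(1) s by (simp add: ennreal_less_iff)
  ultimately show "ennreal s < exit_time X U \<omega>" by simp
next
  assume less: "ennreal s < exit_time X U \<omega>"
  have "X u \<omega> \<in> U" if u: "0 \<le> u" "u \<le> s" for u
  proof (cases "u = 0")
    case False
    show ?thesis
    proof (rule ccontr)
      assume "X u \<omega> \<notin> U"
      then have "exit_time X U \<omega> \<le> ennreal u"
        using u False exit_time_ge_iff[of "exit_time X U \<omega>" U \<omega>] by simp
      also have "\<dots> \<le> ennreal s" using u by (intro ennreal_leI)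
      finally show False using less by simp
    qed
  qed (use \<omega> in simp)
  then show "stays U s \<omega>" by (auto simp: stays_def)
qed

text \<open>Were the path still in \<open>U\<close> at its exit time, \<open>stays_iff_exit\<close>
  would make the exit time larger than itself. The exit position is a limit of earlier positions in
  \<open>U\<close>.\<close>

lemma exit_time_finiteD:
  assumes \<omega>: "\<omega> \<in> space (P x)" "X 0 \<omega> \<in> U" and U: "open U" and fin: "exit_time X U \<omega> < \<top>"
  shows "0 < etime U \<omega>" "X (etime U \<omega>) \<omega> \<notin> U" "\<And>u. 0 \<le> u \<Longrightarrow> u < etime U \<omega> \<Longrightarrow> X u \<omega> \<in> U"
    "X (etime U \<omega>) \<omega> \<in> closure U"
proof -
  have eq: "exit_time X U \<omega> = ennreal (etime U \<omega>)" using fin by simp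
  have "stays U 0 \<omega>" using \<omega> by (simp add: stays_def)
  then have "ennreal 0 < ennreal (etime U \<omega>)" using stays_iff_exit[OF \<omega> U, of 0] eq by simp
  then show pos: "0 < etime U \<omega>" by (simp add: ennreal_less_iff)
  show bef: "X u \<omega> \<in> U" if "0 \<le> u" "u < etime U \<omega>" for u
  proof -
    have "ennreal u < exit_time X U \<omega>" using that eq by (metis ennreal_less_iff)
    then show ?thesis using stays_iff_exit[OF \<omega> U that(1)] that by (auto simp: stays_def)
  qed
  show "X (etime U \<omega>) \<omega> \<notin> U"
  proof
    assume "X (etime U \<omega>) \<omega> \<in> U"
    then have "stays U (etime U \<omega>) \<omega>"
      using bef by (auto simp: stays_def) (metis order_le_less)
    then show False using stays_iff_exit[OF \<omega> U, of "etime U \<omega>"] eq by simp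
  qed
  have "(\<lambda>n. max 0 (etime U \<omega> - 1 / real (Suc n))) \<longlonglongrightarrow> max 0 (etime U \<omega> - 0)"
    by (intro tendsto_intros LIMSEQ_Suc[OF lim_1_over_n])
  then have "(\<lambda>n. max 0 (etime U \<omega> - 1 / real (Suc n))) \<longlonglongrightarrow> etime U \<omega>" using pos by simp
  then have "(\<lambda>n. X (max 0 (etime U \<omega> - 1 / real (Suc n))) \<omega>) \<longlonglongrightarrow> X (etime U \<omega>) \<omega>"
    using continuous_on_tendsto_compose[OF X_continuous[OF \<omega>(1)],
        of "\<lambda>n. max 0 (etime U \<omega> - 1 / real (Suc n))" "etime U \<omega>" sequentially] pos by auto
  moreover have "X (max 0 (etime U \<omega> - 1 / real (Suc n))) \<omega> \<in> U" for n
    using pos by (intro bef) auto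
  ultimately show "X (etime U \<omega>) \<omega> \<in> closure U"
    unfolding closure_sequential
    by (intro exI[of _ "\<lambda>n. X (max 0 (etime U \<omega> - 1 / real (Suc n))) \<omega>"]) auto
qed

text \<open>Zero on paths that never leave \<open>U\<close>, also for \<open>l = 0\<close>. There
  \<open>etime U\<close> has the default value 0, and this factor discards the meaningless exit
  position \<open>X 0\<close>.\<close>

definition discount :: "'a set \<Rightarrow> real \<Rightarrow> 'w \<Rightarrow> ennreal" where
  "discount U l \<omega> = (if exit_time X U \<omega> < \<top> then ennreal (exp (- l * etime U \<omega>)) else 0)"

lemma discount_measurable: "open U \<Longrightarrow> discount U l \<in> borel_measurable (P x)"
  unfolding discount_def[abs_def] using exit_time_measurable[of U x] by measurable

lemma discount_le_1: "0 \<le> l \<Longrightarrow> discount U l \<omega> \<le> 1"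
  by (simp add: discount_def ennreal_le_1)

lemma etime_measurable: "open U \<Longrightarrow> etime U \<in> borel_measurable (P x)"
  using exit_time_measurable[of U x] by measurable

lemma X_etime_measurable: "open U \<Longrightarrow> (\<lambda>\<omega>. X (etime U \<omega>) \<omega>) \<in> borel_measurable (P x)"
  by (rule X_at_measurable[OF etime_measurable]) auto

text \<open>The exit time is approximated from above by multiples of \<open>1 / (n + 1)\<close>, for which the simple
  Markov property suffices. Continuity of paths and of \<open>chain\<close> on \<open>C0\<close> allows passing to the limit.\<close>

lemma strong_markov_chain:
  fixes f \<phi> :: "'a \<Rightarrow> real"
  assumes U: "open U" "x \<in> U" and l: "0 \<le> l" and h: "0 \<le> h"
    and f: "f \<in> C0" "\<And>z. 0 \<le> f z"
    and \<phi>: "continuous_on UNIV \<phi>" "\<And>z. 0 \<le> \<phi> z" "\<And>z. \<phi> z \<le> 1"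
  shows "(\<integral>\<^sup>+\<omega>. discount U l \<omega> *
      ((\<Prod>k\<le>N. ennreal (\<phi> (X (etime U \<omega> + real k * h) \<omega>))) * ennreal (f (X (etime U \<omega> + real N * h) \<omega>))) \<partial>P x)
    = (\<integral>\<^sup>+\<omega>. discount U l \<omega> * chain (\<lambda>z. ennreal (\<phi> z)) h N (\<lambda>z. ennreal (f z)) (X (etime U \<omega>) \<omega>) \<partial>P x)"
    (is "?L = ?R")
proof -
  note [measurable] = exit_time_measurable[OF U(1), of x] discount_measurable[OF U(1), of l x]
  have fm [measurable]: "f \<in> borel_measurable borel"
    using C0_continuous[OF f(1)] by (rule borel_measurable_continuous_onI)
  have pm [measurable]: "\<phi> \<in> borel_measurable borel" using \<phi>(1) by (rule borel_measurable_continuous_onI)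
  obtain c where c: "0 \<le> c" "\<And>z. \<bar>f z\<bar> \<le> c" using C0_bounded[OF f(1)] by blast
  obtain g where g: "g \<in> C0" "\<And>z. 0 \<le> g z"
    and g_eq: "chain (\<lambda>z. ennreal (\<phi> z)) h N (\<lambda>z. ennreal (f z)) = (\<lambda>z. ennreal (g z))"
    using chain_C0[OF h f \<phi>] by blast
  have gm [measurable]: "g \<in> borel_measurable borel"
    using C0_continuous[OF g(1)] by (rule borel_measurable_continuous_onI)
  obtain c' where c': "0 \<le> c'" "\<And>z. \<bar>g z\<bar> \<le> c'" using C0_bounded[OF g(1)] by blast
  define \<Psi> where "\<Psi> t \<omega> = (\<Prod>k\<le>N. \<phi> (X (t + real k * h) \<omega>)) * f (X (t + real N * h) \<omega>)" for t \<omega>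
  have \<Psi>_eq: "ennreal (\<Psi> t \<omega>) = (\<Prod>k\<le>N. ennreal (\<phi> (X (t + real k * h) \<omega>))) * ennreal (f (X (t + real N * h) \<omega>))" for t \<omega>
    unfolding \<Psi>_def using \<phi>(2) f(2) by (simp add: ennreal_mult' prod_ennreal prod_nonneg)
  have \<Psi>0: "0 \<le> \<Psi> t \<omega>" for t \<omega> unfolding \<Psi>_def using \<phi>(2) f(2) by (simp add: prod_nonneg)
  have \<Psi>c: "\<Psi> t \<omega> \<le> c" for t \<omega>
  proof -
    have "\<Psi> t \<omega> \<le> 1 * f (X (t + real N * h) \<omega>)"
      unfolding \<Psi>_def using \<phi>(2,3) f(2) by (intro mult_right_mono prod_le_1) auto
    then show ?thesis using c(2)[of "X (t + real N * h) \<omega>"] by auto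
  qed
  have \<Psi>_at: "(\<lambda>\<omega>. \<Psi> (\<tau> \<omega>) \<omega>) \<in> borel_measurable (P x)"
    if [measurable]: "\<tau> \<in> borel_measurable (P x)" and "\<And>\<omega>. 0 \<le> \<tau> \<omega>" for \<tau>
  proof -
    have [measurable]: "(\<lambda>\<omega>. X (\<tau> \<omega> + real k * h) \<omega>) \<in> borel_measurable (P x)" for k
      by (rule X_at_measurable) (use that h in auto)
    show ?thesis unfolding \<Psi>_def by measurable
  qed
  define t where "t n k = (real k + 1) / (real n + 1)" for n k :: nat
  have t0: "0 \<le> t n k" for n k by (simp add: t_def)
  \<comment> \<open>For paths starting in \<open>U\<close> this is, by
    \<open>stays_iff_exit\<close>, the event that the exit time lies in (k / (n + 1), (k + 1) / (n +
    1)]. It belongs to the past of the right end point \<open>t n k\<close>, which is why the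
    approximation has to come from above.\<close>
  define A where "A n k = {\<omega> \<in> space (P x). stays U (real k / (real n + 1)) \<omega> \<and> \<not> stays U (t n k) \<omega>}" for n k
  have A_filt: "A n k \<in> sets (\<F> x (t n k))" for n k
  proof -
    have "Measurable.pred (\<F> x (real k / (real n + 1))) (stays U (real k / (real n + 1)))"
      by (rule stays_open_filtration[OF _ U(1)]) simp
    then have [measurable]: "Measurable.pred (\<F> x (t n k)) (stays U (real k / (real n + 1)))"
      by (rule filtration_mono[rotated]) (simp add: t_def divide_right_mono)
    have [measurable]: "Measurable.pred (\<F> x (t n k)) (stays U (t n k))"
      by (rule stays_open_filtration[OF t0 U(1)])
    have "{\<omega> \<in> space (\<F> x (t n k)). stays U (real k / (real n + 1)) \<omega> \<and> \<not> stays U (t n k) \<omega>} \<in> sets (\<F> x (t n k))"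
      by measurable
    then show ?thesis by (simp add: A_def)
  qed
  have A_meas [measurable]: "A n k \<in> sets (P x)" for n k
    using A_filt[of n k] subalgebra_filtration[of x "t n k"] by (auto simp: subalgebra_def)
  define w where "w n k \<omega> = (indicator (A n k) \<omega> * ennreal (exp (- l * t n k)) :: ennreal)" for n k \<omega>
  have [measurable]: "w n k \<in> borel_measurable (P x)" for n k unfolding w_def by measurable
  define r where "r n \<omega> = real_of_int \<lceil>(real n + 1) * etime U \<omega>\<rceil> / (real n + 1)" for n \<omega>
  \<comment> \<open>At most one \<open>k\<close> contributes, and \<open>r n\<close> is the exit
    time rounded up to the grid.\<close>
  have sum_eq: "(\<Sum>k. w n k \<omega> * F (t n k)) =
      (if exit_time X U \<omega> < \<top> then ennreal (exp (- l * r n \<omega>)) * F (r n \<omega>) else 0)"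
    if \<omega>: "\<omega> \<in> space (P x)" "X 0 \<omega> \<in> U" for n \<omega> and F :: "real \<Rightarrow> ennreal"
  proof -
    have A_iff: "\<omega> \<in> A n k \<longleftrightarrow> ennreal (real k / (real n + 1)) < exit_time X U \<omega> \<and> exit_time X U \<omega> \<le> ennreal (t n k)" for k
      unfolding A_def using \<omega> stays_iff_exit[OF \<omega> U(1), of "real k / (real n + 1)"]
        stays_iff_exit[OF \<omega> U(1), of "t n k"] t0 by (auto simp: not_less)
    show ?thesis
    proof (cases "exit_time X U \<omega> < \<top>")
      case False
      then have "exit_time X U \<omega> = \<top>" by (metis top.not_eq_extremum)
      then have "\<omega> \<notin> A n k" for k unfolding A_iff by (simp add: top_unique)
      then show ?thesis using False by (simp add: w_def)
    next
      case True
      then have T: "exit_time X U \<omega> = ennreal (etime U \<omega>)" by simp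
      have Tpos: "0 < etime U \<omega>" using exit_time_finiteD(1)[OF \<omega> U(1) True] .
      have exit_less: "ennreal a < exit_time X U \<omega> \<longleftrightarrow> a < etime U \<omega>" if "0 \<le> a" for a
        by (subst T) (rule ennreal_less_iff[OF that])
      have exit_le: "exit_time X U \<omega> \<le> ennreal a \<longleftrightarrow> etime U \<omega> \<le> a" if "0 \<le> a" for a
        by (subst T) (rule ennreal_le_iff[OF that])
      define k0 where "k0 = nat (\<lceil>(real n + 1) * etime U \<omega>\<rceil> - 1)"
      have "0 < (real n + 1) * etime U \<omega>" using Tpos by simp
      then have k0: "real k0 = real_of_int \<lceil>(real n + 1) * etime U \<omega>\<rceil> - 1"
        unfolding k0_def by (simp add: of_nat_nat)
      have A_iff': "\<omega> \<in> A n k \<longleftrightarrow> k = k0" for k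
      proof -
        have "\<omega> \<in> A n k \<longleftrightarrow> real k / (real n + 1) < etime U \<omega> \<and> etime U \<omega> \<le> t n k"
          unfolding A_iff using exit_less exit_le t0 by simp
        also have "\<dots> \<longleftrightarrow> real k < (real n + 1) * etime U \<omega> \<and> (real n + 1) * etime U \<omega> \<le> real k + 1"
          unfolding t_def by (simp add: divide_less_eq le_divide_eq mult.commute)
        also have "\<dots> \<longleftrightarrow> \<lceil>(real n + 1) * etime U \<omega>\<rceil> = int k + 1"
          unfolding ceiling_eq_iff by auto
        also have "\<dots> \<longleftrightarrow> k = k0" using k0 by linarith
        finally show ?thesis .
      qed
      have tk: "t n k0 = r n \<omega>" unfolding t_def r_def k0 by simp
      have "(\<Sum>k. w n k \<omega> * F (t n k)) = (\<Sum>k. if k = k0 then ennreal (exp (- l * t n k)) * F (t n k) else 0)"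
        by (intro suminf_cong) (simp add: w_def A_iff')
      also have "\<dots> = ennreal (exp (- l * t n k0)) * F (t n k0)"
        using sums_unique[OF sums_single[of k0 "\<lambda>k. ennreal (exp (- l * t n k)) * F (t n k)"]] by simp
      finally show ?thesis using True tk by simp
    qed
  qed
  have Xt [measurable]: "X (t n k) \<in> borel_measurable (P x)" for n k using X_measurable[OF t0] .
  have \<Psi>t [measurable]: "\<Psi> (t n k) \<in> borel_measurable (P x)" for n k
    using \<Psi>_at[of "\<lambda>_. t n k"] t0 by simp
  \<comment> \<open>The simple Markov property at the fixed time \<open>t n k\<close>, applied on
    each event \<open>A n k\<close> separately and summed.\<close>
  have key: "(\<integral>\<^sup>+\<omega>. (\<Sum>k. w n k \<omega> * ennreal (\<Psi> (t n k) \<omega>)) \<partial>P x)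
           = (\<integral>\<^sup>+\<omega>. (\<Sum>k. w n k \<omega> * ennreal (g (X (t n k) \<omega>))) \<partial>P x)" for n
  proof -
    have wf: "w n k \<in> borel_measurable (\<F> x (t n k))" for k
      unfolding w_def using A_filt by measurable
    have "(\<integral>\<^sup>+\<omega>. w n k \<omega> * ennreal (\<Psi> (t n k) \<omega>) \<partial>P x) = (\<integral>\<^sup>+\<omega>. w n k \<omega> * ennreal (g (X (t n k) \<omega>)) \<partial>P x)" for k
      unfolding \<Psi>_eq
      using markov_chain[OF t0 h wf[of k], of "\<lambda>z. ennreal (\<phi> z)" "\<lambda>z. ennreal (f z)" N] by (simp add: g_eq)
    then show ?thesis by (subst (1 2) nn_integral_suminf) (auto simp: w_def)
  qed
  have rlim: "(\<lambda>n. r n \<omega>) \<longlonglongrightarrow> etime U \<omega>" and r0: "0 \<le> r n \<omega>" for \<omega> n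
  proof -
    have b: "etime U \<omega> \<le> r n \<omega> \<and> r n \<omega> \<le> etime U \<omega> + 1 / (real n + 1)" for n
    proof -
      have "(real n + 1) * etime U \<omega> / (real n + 1) \<le> r n \<omega>"
        unfolding r_def by (intro divide_right_mono) auto
      moreover have "r n \<omega> \<le> ((real n + 1) * etime U \<omega> + 1) / (real n + 1)"
        unfolding r_def by (rule divide_right_mono) linarith+
      ultimately show ?thesis by (simp add: add_divide_distrib)
    qed
    have i: "(\<lambda>n. 1 / (real n + 1)) \<longlonglongrightarrow> 0"
      using LIMSEQ_inverse_real_of_nat by (simp add: inverse_eq_divide add.commute)
    have "(\<lambda>n. etime U \<omega> + 1 / (real n + 1)) \<longlonglongrightarrow> etime U \<omega> + 0"
      by (intro tendsto_add tendsto_const i)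
    then have l: "(\<lambda>n. etime U \<omega> + 1 / (real n + 1)) \<longlonglongrightarrow> etime U \<omega>" by (simp only: add_0_right)
    show "(\<lambda>n. r n \<omega>) \<longlonglongrightarrow> etime U \<omega>"
      by (rule tendsto_sandwich[OF always_eventually always_eventually tendsto_const l])
         (use b in blast)+
    show "0 \<le> r n \<omega>" using b[of n] enn2real_nonneg order_trans by blast
  qed
  have explim: "(\<lambda>n. exp (- l * r n \<omega>)) \<longlonglongrightarrow> exp (- l * etime U \<omega>)" for \<omega>
    by (intro tendsto_intros rlim)
  have Xlim: "(\<lambda>n. X (r n \<omega> + b) \<omega>) \<longlonglongrightarrow> X (etime U \<omega> + b) \<omega>" if "\<omega> \<in> space (P x)" "0 \<le> b" for \<omega> b
  proof -
    have l: "(\<lambda>n. r n \<omega> + b) \<longlonglongrightarrow> etime U \<omega> + b" by (intro tendsto_add tendsto_const rlim)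
    show ?thesis
      by (rule continuous_on_tendsto_compose[OF X_continuous[OF that(1)] l])
         (use that(2) r0[of _ \<omega>] in \<open>simp_all add: add_nonneg_nonneg\<close>)
  qed
  have AE_space: "AE \<omega> in P x. \<omega> \<in> space (P x) \<and> X 0 \<omega> \<in> U"
    using X_start[of x] U(2) by (auto elim: AE_mp)
  have e1: "exp (- l * r n \<omega>) \<le> 1" for n \<omega> using l r0[of n \<omega>] by simp
  have [measurable]: "(\<lambda>\<omega>. \<Psi> (etime U \<omega>) \<omega>) \<in> borel_measurable (P x)"
    by (rule \<Psi>_at) auto
  note [measurable] = X_etime_measurable[OF U(1), of x]
  \<comment> \<open>Both sides of \<open>key\<close> have this form, with \<open>G\<close> either
    the product along the path or the function \<open>g\<close> of the current position; only
    boundedness and continuity along the path enter.\<close>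
  have lim: "(\<lambda>n. \<integral>\<^sup>+\<omega>. (\<Sum>k. w n k \<omega> * ennreal (G (t n k) \<omega>)) \<partial>P x) \<longlonglongrightarrow>
      (\<integral>\<^sup>+\<omega>. discount U l \<omega> * ennreal (G (etime U \<omega>) \<omega>) \<partial>P x)"
    if [measurable]: "\<And>n k. G (t n k) \<in> borel_measurable (P x)" "(\<lambda>\<omega>. G (etime U \<omega>) \<omega>) \<in> borel_measurable (P x)"
      and G0: "\<And>t \<omega>. 0 \<le> G t \<omega>" and Gd: "\<And>t \<omega>. G t \<omega> \<le> d"
      and Glim: "\<And>\<omega>. \<omega> \<in> space (P x) \<Longrightarrow> (\<lambda>n. G (r n \<omega>) \<omega>) \<longlonglongrightarrow> G (etime U \<omega>) \<omega>"
    for G :: "real \<Rightarrow> 'w \<Rightarrow> real" and d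
  proof (rule nn_integral_dominated_convergence[where w = "\<lambda>_. ennreal d"])
    show "AE \<omega> in P x. (\<Sum>k. w n k \<omega> * ennreal (G (t n k) \<omega>)) \<le> ennreal d" for n
      using AE_space
    proof eventually_elim
      case (elim \<omega>)
      have "ennreal (exp (- l * r n \<omega>)) * ennreal (G (r n \<omega>) \<omega>) \<le> 1 * ennreal d"
        using e1[of n \<omega>] Gd by (intro mult_mono ennreal_leI) (auto simp: ennreal_le_1 intro: ennreal_leI)
      then show ?case using elim by (subst sum_eq[of \<omega> n "\<lambda>t. ennreal (G t \<omega>)"]) auto
    qed
    show "AE \<omega> in P x. (\<lambda>n. \<Sum>k. w n k \<omega> * ennreal (G (t n k) \<omega>)) \<longlonglongrightarrow>
      discount U l \<omega> * ennreal (G (etime U \<omega>) \<omega>)"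
      using AE_space
    proof eventually_elim
      case (elim \<omega>)
      have "(\<lambda>n. ennreal (exp (- l * r n \<omega>)) * ennreal (G (r n \<omega>) \<omega>)) \<longlonglongrightarrow>
          ennreal (exp (- l * etime U \<omega>)) * ennreal (G (etime U \<omega>) \<omega>)"
        using explim[of \<omega>] Glim[of \<omega>] elim by (intro tendsto_mult_ennreal tendsto_ennrealI) auto
      moreover have "(\<Sum>k. w n k \<omega> * ennreal (G (t n k) \<omega>)) =
        (if exit_time X U \<omega> < \<top> then ennreal (exp (- l * r n \<omega>)) * ennreal (G (r n \<omega>) \<omega>) else 0)" for n
        using elim by (intro sum_eq[of \<omega> n "\<lambda>t. ennreal (G t \<omega>)"]) auto
      ultimately show ?case by (simp add: discount_def)
    qed
  qed (auto simp: ennreal_mult_less_top)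
  have L: "(\<lambda>n. \<integral>\<^sup>+\<omega>. (\<Sum>k. w n k \<omega> * ennreal (\<Psi> (t n k) \<omega>)) \<partial>P x) \<longlonglongrightarrow> ?L"
    unfolding \<Psi>_eq[symmetric]
  proof (rule lim)
    show "(\<lambda>n. \<Psi> (r n \<omega>) \<omega>) \<longlonglongrightarrow> \<Psi> (etime U \<omega>) \<omega>" if "\<omega> \<in> space (P x)" for \<omega>
    proof -
      have X: "(\<lambda>n. X (r n \<omega> + real k * h) \<omega>) \<longlonglongrightarrow> X (etime U \<omega> + real k * h) \<omega>" for k
        by (rule Xlim[OF that]) (use h in simp)
      have fX: "(\<lambda>n. f (X (r n \<omega> + real N * h) \<omega>)) \<longlonglongrightarrow> f (X (etime U \<omega> + real N * h) \<omega>)"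
        using continuous_on_tendsto_compose[OF C0_continuous[OF f(1)] X] by simp
      have pX: "(\<lambda>n. \<phi> (X (r n \<omega> + real k * h) \<omega>)) \<longlonglongrightarrow> \<phi> (X (etime U \<omega> + real k * h) \<omega>)" for k
        using continuous_on_tendsto_compose[OF \<phi>(1) X] by simp
      show ?thesis unfolding \<Psi>_def by (intro tendsto_mult tendsto_prod pX fX)
    qed
  qed (use \<Psi>0 \<Psi>c in auto)
  have R: "(\<lambda>n. \<integral>\<^sup>+\<omega>. (\<Sum>k. w n k \<omega> * ennreal (g (X (t n k) \<omega>))) \<partial>P x) \<longlonglongrightarrow> ?R"
    unfolding g_eq
  proof (rule lim)
    show "(\<lambda>n. g (X (r n \<omega>) \<omega>)) \<longlonglongrightarrow> g (X (etime U \<omega>) \<omega>)" if "\<omega> \<in> space (P x)" for \<omega>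
      using continuous_on_tendsto_compose[OF C0_continuous[OF g(1)]] Xlim[OF that, of 0] by simp
    show "g (X t \<omega>) \<le> c'" for t \<omega> using c'(2)[of "X t \<omega>"] by simp
  qed (use g in auto)
  show ?thesis using LIMSEQ_unique[OF L R[folded key]] .
qed

end

section \<open>Approximating the constant 1 on a locally compact space\<close>

lemma locally_compact_small_cball:
  fixes z :: "'a::metric_space"
  assumes "locally_compact_space (euclidean :: 'a topology)"
  shows "\<exists>\<eta>>0. compact (cball z \<eta>)"
proof -
  obtain U K where UK: "open U" "compact K" "z \<in> U" "U \<subseteq> K"
    using assms unfolding locally_compact_space_def by (simp add: Bex_def) blast
  obtain e where e: "e > 0" "ball z e \<subseteq> U" using UK openE by blast
  have "cball z (e/2) \<subseteq> K" using e UK(4) by (force simp: subset_iff)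
  then have "compact (cball z (e/2))"
    using compact_Int_closed[OF UK(2), of "cball z (e/2)"] by (simp add: Int_absorb1)
  then show ?thesis using e(1) by (intro exI[of _ "e/2"]) auto
qed

definition tent :: "'a::metric_space \<Rightarrow> real \<Rightarrow> 'a \<Rightarrow> real" where
  "tent b \<eta> z = max 0 (\<eta> - dist z b)"

lemma tent_C0:
  assumes "compact (cball b \<eta>)"
  shows "tent b \<eta> \<in> C0"
proof (rule C0_I[OF _ assms])
  show "continuous_on UNIV (tent b \<eta>)" unfolding tent_def by (intro continuous_intros)
qed (auto simp: tent_def dist_commute)

lemma tent_nonneg [simp]: "0 \<le> tent b \<eta> z" by (simp add: tent_def)

text \<open>The Feller property concerns functions vanishing at infinity, but exit times need the
  constant 1. By the Lindeloef property countably many balls, with compact closed balls of the same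
  radii, cover the space; partial sums of their tent functions, multiplied by \<open>n\<close> and
  cut off at 1, converge to 1.\<close>

lemma C0_unit_approximation:
  assumes lc: "locally_compact_space (euclidean :: 'a::{metric_space,second_countable_topology} topology)"
  obtains g :: "nat \<Rightarrow> 'a::{metric_space,second_countable_topology} \<Rightarrow> real"
  where "\<And>i. g i \<in> C0" "\<And>i z. 0 \<le> g i z" "\<And>i z. g i z \<le> 1" "\<And>z. (\<lambda>i. g i z) \<longlonglongrightarrow> 1"
proof -
  obtain \<eta> where \<eta>: "\<And>z::'a. \<eta> z > 0" "\<And>z. compact (cball z (\<eta> z))"
    using locally_compact_small_cball[OF lc] by metis
  obtain B where B: "countable B" "B \<subseteq> range (\<lambda>z. ball z (\<eta> z))" "\<Union>B = \<Union>(range (\<lambda>z. ball z (\<eta> z)))"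
    using Lindelof[of "range (\<lambda>z. ball z (\<eta> z))"] by (metis (no_types, lifting) imageE open_ball)
  have cover: "\<Union>B = UNIV" using B(3) \<eta>(1) by auto
  then have "B \<noteq> {}" by auto
  have "\<exists>z. from_nat_into B n = ball z (\<eta> z)" for n
    using B(2) from_nat_into[OF \<open>B \<noteq> {}\<close>, of n] by blast
  then obtain c :: "nat \<Rightarrow> 'a" where c: "\<And>n. from_nat_into B n = ball (c n) (\<eta> (c n))" by metis
  define g where "g n z = min 1 (real n * (\<Sum>i\<le>n. tent (c i) (\<eta> (c i)) z))" for n z
  show thesis
  proof (rule that[of g])
    show "g n \<in> C0" for n
    proof (rule C0_I[where K = "\<Union>i\<le>n. cball (c i) (\<eta> (c i))"])
      show "continuous_on UNIV (g n)" unfolding g_def tent_def by (intro continuous_intros)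
      show "compact (\<Union>i\<le>n. cball (c i) (\<eta> (c i)))" using \<eta>(2) by (intro compact_UN) auto
      show "g n z = 0" if "z \<notin> (\<Union>i\<le>n. cball (c i) (\<eta> (c i)))" for z
      proof -
        have "(\<Sum>i\<le>n. tent (c i) (\<eta> (c i)) z) = 0"
          using that by (intro sum.neutral) (force simp: tent_def dist_commute)
        then show ?thesis by (simp add: g_def)
      qed
    qed
    show "0 \<le> g n z" for n z by (simp add: g_def sum_nonneg)
    show "g n z \<le> 1" for n z by (simp add: g_def)
    show "(\<lambda>n. g n z) \<longlonglongrightarrow> 1" for z
    proof -
      obtain S where "S \<in> B" "z \<in> S" using cover by blast
      then obtain i where i: "z \<in> ball (c i) (\<eta> (c i))"
        using c from_nat_into_surj[OF B(1)] by metis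
      define a where "a = tent (c i) (\<eta> (c i)) z"
      have a: "a > 0" using i by (simp add: a_def tent_def dist_commute)
      obtain N :: nat where N: "real N > 1 / a" using reals_Archimedean2 by blast
      have "g n z = 1" if n: "n \<ge> max N i" for n
      proof -
        have "1 \<le> real N * a" using N a by (simp add: divide_less_eq)
        also have "\<dots> \<le> real n * (\<Sum>j\<le>n. tent (c j) (\<eta> (c j)) z)"
          using n a unfolding a_def by (intro mult_mono member_le_sum) auto
        finally show ?thesis by (simp add: g_def)
      qed
      then have "\<forall>\<^sub>F n in sequentially. g n z = 1" using eventually_sequentially by blast
      then show ?thesis by (rule tendsto_eventually)
    qed
  qed
qed

text \<open>Elements of \<open>C0\<close> serve as sources of Green potentials, the constant 1
  produces exit times.\<close>

definition test_fun :: "('a::metric_space \<Rightarrow> real) \<Rightarrow> bool" where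
  "test_fun f \<longleftrightarrow> (f \<in> C0 \<and> (\<forall>z. 0 \<le> f z)) \<or> f = (\<lambda>_. 1)"

lemma test_fun_continuous: "test_fun f \<Longrightarrow> continuous_on UNIV f"
  by (auto simp: test_fun_def C0_continuous)

lemma test_fun_nonneg: "test_fun f \<Longrightarrow> 0 \<le> f z"
  by (auto simp: test_fun_def)

lemma test_fun_bounded:
  assumes "test_fun f"
  obtains c where "0 \<le> c" "\<And>z. f z \<le> c"
proof (cases "f \<in> C0")
  case True
  then show ?thesis using C0_bounded[OF True] that by (metis abs_le_D1)
next
  case False
  then show ?thesis using assms that[of 1] by (auto simp: test_fun_def)
qed

lemma test_fun_measurable: "test_fun f \<Longrightarrow> f \<in> borel_measurable borel"
  by (rule borel_measurable_continuous_onI[OF test_fun_continuous])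

locale lc_diffusion = feller_diffusion P X
  for P :: "'a::{metric_space, second_countable_topology} \<Rightarrow> 'w measure" and X :: "real \<Rightarrow> 'w \<Rightarrow> 'a" +
  assumes locally_compact: "locally_compact_space (euclidean :: 'a topology)"
begin

text \<open>For \<open>f\<close> in \<open>C0\<close> this is the grid limit of
  \<open>strong_markov_chain\<close>. The constant 1 is reached by a further dominated limit along
  \<open>C0_unit_approximation\<close>, everything being bounded by 1.\<close>

lemma strong_markov_killed:
  assumes U: "open U" "x \<in> U" and l: "0 \<le> l" and s: "0 \<le> s"
    and K: "closed K" "K \<noteq> {}" and f: "test_fun f"
  shows "(\<integral>\<^sup>+\<omega>. discount U l \<omega> * killed K f (etime U \<omega>) s \<omega> \<partial>P x)
    = (\<integral>\<^sup>+\<omega>. discount U l \<omega> * surv K s f (X (etime U \<omega>) \<omega>) \<partial>P x)"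
proof -
  have C0: "(\<integral>\<^sup>+\<omega>. discount U l \<omega> * killed K f (etime U \<omega>) s \<omega> \<partial>P x)
    = (\<integral>\<^sup>+\<omega>. discount U l \<omega> * surv K s f (X (etime U \<omega>) \<omega>) \<partial>P x)" if f: "f \<in> C0" "\<And>z. 0 \<le> f z" for f
  proof -
    have fm: "f \<in> borel_measurable borel"
      using C0_continuous[OF f(1)] by (rule borel_measurable_continuous_onI)
    obtain c where "\<And>z. \<bar>f z\<bar> \<le> c" using C0_bounded[OF f(1)] by blast
    then have fc: "f z \<le> c" for z using abs_le_D1 by blast
    have h: "0 \<le> s / real (Suc n)" for n using s by simp
    have cancel: "real (Suc n) * (s / real (Suc n)) = s" for n by simp
    show ?thesis
    proof (rule killed_identity_limit[OF s K fm fc etime_measurable[OF U(1)] enn2real_nonneg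
          discount_measurable[OF U(1)] discount_le_1[OF l]])
      show "(\<integral>\<^sup>+\<omega>. discount U l \<omega> * grid_path K s n f (etime U \<omega>) \<omega> \<partial>P x)
          = (\<integral>\<^sup>+\<omega>. discount U l \<omega> * grid K s n f (X (etime U \<omega>) \<omega>) \<partial>P x)" for n
        using strong_markov_chain[OF U l h[of n] f continuous_bump bump_nonneg bump_le_1, of K n "Suc n"]
        unfolding grid_path_def cancel .
    qed
  qed
  show ?thesis
  proof (cases "f \<in> C0")
    case True
    then show ?thesis using C0 test_fun_nonneg[OF f] by blast
  next
    case False
    then have f1: "f = (\<lambda>_. 1)" using f by (auto simp: test_fun_def)
    obtain g :: "nat \<Rightarrow> 'a \<Rightarrow> real" where g: "\<And>i. g i \<in> C0" "\<And>i z. 0 \<le> g i z" "\<And>i z. g i z \<le> 1" "\<And>z. (\<lambda>i. g i z) \<longlonglongrightarrow> 1"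
      using C0_unit_approximation[OF locally_compact] by blast
    have gm: "g i \<in> borel_measurable borel" for i
      using C0_continuous[OF g(1)] by (rule borel_measurable_continuous_onI)
    have D1: "discount U l \<omega> * e \<le> 1" if "e \<le> 1" for \<omega> and e :: ennreal
      using mult_mono[OF discount_le_1[OF l] that, of U \<omega>] by simp
    have Dfin: "discount U l \<omega> \<noteq> \<top>" for \<omega> by (simp add: discount_def)
    have killed_1: "killed K h t s \<omega> \<le> 1" if "\<And>z. h z \<le> 1" for h t \<omega>
      using killed_le[of h 1, OF that] by simp
    have surv_1: "surv K s h z \<le> 1" if "\<And>z. h z \<le> 1" for h z using surv_le[of h 1, OF that] by simp
    have surv_fin: "surv K s (\<lambda>_. 1) z \<noteq> \<top>" for z
      using surv_1[of "\<lambda>_. 1" z] by (auto simp: top_unique)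
    have km: "(\<lambda>\<omega>. killed K h (\<tau> \<omega>) s \<omega>) \<in> borel_measurable (P z)"
      if "\<tau> \<in> borel_measurable (P z)" "\<And>\<omega>. 0 \<le> \<tau> \<omega>" "h \<in> borel_measurable borel" for h \<tau> z
      using killed_measurable[OF s that(1,2) K(1) that(3)] .
    have if_lim: "(\<lambda>i. if B then ennreal (g i z) else 0) \<longlonglongrightarrow> (if B then ennreal 1 else 0)" for B z
      by (cases B) (simp_all only: if_True if_False tendsto_const tendsto_ennrealI[OF g(4)])
    have klim: "(\<lambda>i. killed K (g i) t s \<omega>) \<longlonglongrightarrow> killed K (\<lambda>_. 1) t s \<omega>" for t \<omega>
      unfolding killed_def by (rule if_lim)
    have slim: "(\<lambda>i. surv K s (g i) z) \<longlonglongrightarrow> surv K s (\<lambda>_. 1) z" for z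
      unfolding surv_def
      by (rule nn_integral_dominated_convergence[where w = "\<lambda>_. 1"])
         (use klim km[of "\<lambda>_. 0"] gm g(3) killed_1 in auto)
    have sm: "surv K s h \<in> borel_measurable borel" if "h \<in> borel_measurable borel" "\<And>z. h z \<le> 1" for h
      using surv_measurable[OF s K that] .
    have L: "(\<lambda>i. \<integral>\<^sup>+\<omega>. discount U l \<omega> * killed K (g i) (etime U \<omega>) s \<omega> \<partial>P x) \<longlonglongrightarrow>
       (\<integral>\<^sup>+\<omega>. discount U l \<omega> * killed K (\<lambda>_. 1) (etime U \<omega>) s \<omega> \<partial>P x)"
      using etime_measurable[OF U(1)] g(3) gm
      by (intro nn_integral_dominated_convergence[where w = "\<lambda>_. 1"] AE_I2 tendsto_mult_ennreal tendsto_const klim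
          D1 killed_1 borel_measurable_times_ennreal discount_measurable U km)
         (auto simp: Dfin killed_def)
    have R: "(\<lambda>i. \<integral>\<^sup>+\<omega>. discount U l \<omega> * surv K s (g i) (X (etime U \<omega>) \<omega>) \<partial>P x) \<longlonglongrightarrow>
       (\<integral>\<^sup>+\<omega>. discount U l \<omega> * surv K s (\<lambda>_. 1) (X (etime U \<omega>) \<omega>) \<partial>P x)"
      using g(3) gm surv_fin
      by (intro nn_integral_dominated_convergence[where w = "\<lambda>_. 1"] AE_I2 tendsto_mult_ennreal tendsto_const slim
          D1 surv_1 borel_measurable_times_ennreal discount_measurable U measurable_compose[OF X_etime_measurable sm])
         (auto simp: Dfin)
    show ?thesis using LIMSEQ_unique[OF L R[folded C0[OF g(1,2)]]] by (simp only: f1)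
  qed
qed

end

section \<open>Resolvents of the killed process\<close>

lemma nn_integral_shift:
  fixes g :: "real \<Rightarrow> ennreal"
  assumes [measurable]: "g \<in> borel_measurable borel"
  shows "(\<integral>\<^sup>+s. g s \<partial>lborel) = (\<integral>\<^sup>+s. g (t + s) \<partial>lborel)"
  using nn_integral_real_affine[of g 1 t] by simp

lemma nn_integral_exp_tail:
  assumes l: "0 < l"
  shows "(\<integral>\<^sup>+s. indicator {t<..} s * ennreal (exp (- l * s)) \<partial>lborel) = ennreal (exp (- l * t) / l)"
proof -
  have "(\<integral>\<^sup>+s. ennreal (exp (- l * s)) * indicator {t..} s \<partial>lborel) = ennreal (0 - (- exp (- l * t) / l))"
  proof (rule nn_integral_FTC_atLeast)
    show "((\<lambda>s. - exp (- l * s) / l) \<longlongrightarrow> 0) at_top"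
      using l by real_asymp
    show "((\<lambda>s. - exp (- l * s) / l) has_real_derivative exp (- l * s)) (at s)" for s
      using l by (auto intro!: derivative_eq_intros)
  qed auto
  moreover have "(\<integral>\<^sup>+s. ennreal (exp (- l * s)) * indicator {t..} s \<partial>lborel)
      = (\<integral>\<^sup>+s. indicator {t<..} s * ennreal (exp (- l * s)) \<partial>lborel)"
    by (rule nn_integral_cong_AE)
       (use AE_lborel_singleton[of t] in \<open>eventually_elim, auto simp: indicator_def\<close>)
  ultimately show ?thesis by simp
qed

context lc_diffusion
begin

lemma surv_le_1: "(\<And>z. f z \<le> 1) \<Longrightarrow> surv K s f z \<le> 1"
  using surv_le[of f 1] by simp

lemma surv_mono_set: "K \<subseteq> K' \<Longrightarrow> surv K s f z \<le> surv K' s f z"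
  unfolding surv_def by (intro nn_integral_mono) (auto simp: killed_def)

lemma surv_antimono_time:
  "s \<le> t \<Longrightarrow> surv K t (\<lambda>_. 1) z \<le> surv K s (\<lambda>_. 1) z"
  unfolding surv_def by (intro nn_integral_mono) (auto simp: killed_def)

text \<open>The Laplace transform in time of the killed semigroup. At \<open>l = 0\<close> it is the
  Green potential of \<open>f\<close> in \<open>K\<close>, and for \<open>f = 1\<close> the mean
  survival time.\<close>

definition resolv :: "'a set \<Rightarrow> real \<Rightarrow> ('a \<Rightarrow> real) \<Rightarrow> 'a \<Rightarrow> ennreal" where
  "resolv K l f z = (\<integral>\<^sup>+s. indicator {0<..} s * (ennreal (exp (- l * s)) * surv K s f z) \<partial>lborel)"

lemma resolv_mono_set: "K \<subseteq> K' \<Longrightarrow> resolv K l f z \<le> resolv K' l f z"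
  unfolding resolv_def by (intro nn_integral_mono mult_left_mono surv_mono_set) auto

lemma resolv_joint_measurable:
  assumes "closed K" "K \<noteq> {}" "continuous_on UNIV f" "\<And>z. f z \<le> c"
  shows "(\<lambda>(z, s). indicator {0<..} s * (ennreal (exp (- l * s)) * surv K s f z))
    \<in> borel_measurable (borel \<Otimes>\<^sub>M borel)"
proof -
  note [measurable] = measurable_pair_swap[OF surv_indicator_measurable[OF assms]]
  have "(\<lambda>w. ennreal (exp (- l * snd w)) * (case w of (z, s) \<Rightarrow> indicator {0<..} s * surv K s f z))
    \<in> borel_measurable (borel \<Otimes>\<^sub>M borel)"
    using measurable_pair_swap[OF surv_indicator_measurable[OF assms]]
    by (intro borel_measurable_times_ennreal) (auto simp: case_prod_beta')
  then show ?thesis by (simp add: case_prod_beta' mult.left_commute)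
qed

lemma resolv_measurable:
  assumes "closed K" "K \<noteq> {}" "continuous_on UNIV f" "\<And>z. f z \<le> c"
  shows "resolv K l f \<in> borel_measurable borel"
proof -
  have "(\<lambda>(z, s). indicator {0<..} s * (ennreal (exp (- l * s)) * surv K s f z))
    \<in> borel_measurable (borel \<Otimes>\<^sub>M lborel)"
    using resolv_joint_measurable[OF assms]
    by (simp cong: measurable_cong_sets sets_pair_measure_cong)
  from lborel.borel_measurable_nn_integral[OF this] show ?thesis
    by (simp add: resolv_def[abs_def])
qed

lemma resolv_outside: "z \<notin> K \<Longrightarrow> resolv K l f z = 0"
proof -
  assume "z \<notin> K"
  then have "(\<lambda>s. indicator {0<..} s * (ennreal (exp (- l * s)) * surv K s f z)) = (\<lambda>_. 0)"
    using surv_outside[of _ z K] by (auto simp: indicator_def fun_eq_iff)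
  then show ?thesis unfolding resolv_def by simp
qed

section \<open>Laplace transforms of path functionals and Dynkin's formula\<close>

lemma time_fubini:
  assumes m: "(\<lambda>(s, \<omega>). \<Phi> s \<omega>) \<in> borel_measurable (borel \<Otimes>\<^sub>M P x)"
  shows "(\<integral>\<^sup>+s. indicator {0<..} s * (ennreal (exp (- l * s)) * (\<integral>\<^sup>+\<omega>. \<Phi> s \<omega> \<partial>P x)) \<partial>lborel)
     = (\<integral>\<^sup>+\<omega>. (\<integral>\<^sup>+s. indicator {0<..} s * (ennreal (exp (- l * s)) * \<Phi> s \<omega>) \<partial>lborel) \<partial>P x)"
proof -
  interpret prob_space "P x" by (rule prob_space_P)
  interpret pair_sigma_finite lborel "P x" ..
  have m' [measurable]: "(\<lambda>(s, \<omega>). \<Phi> s \<omega>) \<in> borel_measurable (lborel \<Otimes>\<^sub>M P x)"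
    using m by (simp cong: measurable_cong_sets sets_pair_measure_cong)
  have sec: "(\<lambda>\<omega>. \<Phi> s \<omega>) \<in> borel_measurable (P x)" for s
    using measurable_compose[OF measurable_Pair[OF measurable_const measurable_ident] m] by simp
  have joint: "(\<lambda>(s, \<omega>). indicator {0<..} s * (ennreal (exp (- l * s)) * \<Phi> s \<omega>))
    \<in> borel_measurable (lborel \<Otimes>\<^sub>M P x)" by measurable
  have "(\<integral>\<^sup>+s. indicator {0<..} s * (ennreal (exp (- l * s)) * (\<integral>\<^sup>+\<omega>. \<Phi> s \<omega> \<partial>P x)) \<partial>lborel)
     = (\<integral>\<^sup>+s. (\<integral>\<^sup>+\<omega>. indicator {0<..} s * (ennreal (exp (- l * s)) * \<Phi> s \<omega>) \<partial>P x) \<partial>lborel)"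
    using sec by (simp add: nn_integral_cmult)
  also have "\<dots> = (\<integral>\<^sup>+\<omega>. (\<integral>\<^sup>+s. indicator {0<..} s * (ennreal (exp (- l * s)) * \<Phi> s \<omega>) \<partial>lborel) \<partial>P x)"
    using Fubini'[OF joint] by simp
  finally show ?thesis .
qed

lemma time_section:
  assumes "(\<lambda>(s, \<omega>). \<Phi> s \<omega>) \<in> borel_measurable (borel \<Otimes>\<^sub>M P x)" "\<omega> \<in> space (P x)"
  shows "(\<lambda>s. \<Phi> s \<omega>) \<in> borel_measurable borel"
  using measurable_compose[OF measurable_Pair[OF measurable_ident measurable_const[OF assms(2)]] assms(1)]
  by simp

text \<open>The contribution of the time strictly before the exit from \<open>U\<close> to Dynkin's
  formula. The \<open>max 0 s\<close> only concerns negative times, which \<open>laplace\<close>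
  discards.\<close>

definition before_exit :: "'a set \<Rightarrow> ('a \<Rightarrow> real) \<Rightarrow> real \<Rightarrow> 'w \<Rightarrow> ennreal" where
  "before_exit U f s \<omega> = (if ennreal s < exit_time X U \<omega> then ennreal (f (X (max 0 s) \<omega>)) else 0)"

lemma before_exit_joint_measurable:
  assumes U: "open U" and f: "continuous_on UNIV f"
  shows "(\<lambda>(s, \<omega>). before_exit U f s \<omega>) \<in> borel_measurable (borel \<Otimes>\<^sub>M P x)"
proof -
  note [measurable] = exit_time_measurable[OF U, of x] X_joint_measurable[of x]
  have [measurable]: "f \<in> borel_measurable borel" using f by (rule borel_measurable_continuous_onI)
  show ?thesis unfolding before_exit_def by measurable
qed

abbreviation laplace :: "real \<Rightarrow> (real \<Rightarrow> ennreal) \<Rightarrow> ennreal" where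
  "laplace l g \<equiv> (\<integral>\<^sup>+s. indicator {0<..} s * (ennreal (exp (- l * s)) * g s) \<partial>lborel)"

lemma laplace_cong: "(\<And>s. 0 < s \<Longrightarrow> g s = g' s) \<Longrightarrow> laplace l g = laplace l g'"
  by (intro nn_integral_cong) (auto simp: indicator_def)

lemma time_integral_measurable:
  assumes m: "(\<lambda>(s, \<omega>). \<Phi> s \<omega>) \<in> borel_measurable (borel \<Otimes>\<^sub>M P x)"
  shows "(\<lambda>\<omega>. laplace l (\<lambda>s. \<Phi> s \<omega>)) \<in> borel_measurable (P x)"
proof (rule lborel.borel_measurable_nn_integral)
  have "(\<lambda>w. indicator {0<..} (snd w) * (ennreal (exp (- l * snd w)) * (case w of (\<omega>, s) \<Rightarrow> \<Phi> s \<omega>)))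
    \<in> borel_measurable (P x \<Otimes>\<^sub>M borel)"
    using measurable_pair_swap[OF m] by (intro borel_measurable_times_ennreal) (auto simp: case_prod_beta')
  then show "(\<lambda>(\<omega>, s). indicator {0<..} s * (ennreal (exp (- l * s)) * \<Phi> s \<omega>)) \<in> borel_measurable (P x \<Otimes>\<^sub>M lborel)"
    by (simp add: case_prod_beta' cong: measurable_cong_sets sets_pair_measure_cong)
qed

lemma resolv_open_eq:
  assumes U: "open U" "x \<in> U" and f: "continuous_on UNIV f"
  shows "resolv U l f x = (\<integral>\<^sup>+\<omega>. laplace l (\<lambda>s. before_exit U f s \<omega>) \<partial>P x)"
proof -
  have "surv U s f x = (\<integral>\<^sup>+\<omega>. before_exit U f s \<omega> \<partial>P x)" if "0 < s" for s
    unfolding surv_def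
  proof (rule nn_integral_cong_AE)
    show "AE \<omega> in P x. killed U f 0 s \<omega> = before_exit U f s \<omega>"
      using X_start[of x] AE_space[of "P x"]
    proof eventually_elim
      case (elim \<omega>)
      then show ?case using stays_iff_exit[of \<omega> x U s] U that
        by (simp add: killed_0 before_exit_def max_def)
    qed
  qed
  then have "resolv U l f x = laplace l (\<lambda>s. \<integral>\<^sup>+\<omega>. before_exit U f s \<omega> \<partial>P x)"
    unfolding resolv_def by (rule laplace_cong)
  also note time_fubini[OF before_exit_joint_measurable[OF U(1) f]]
  finally show ?thesis .
qed

lemma resolv_closed_eq:
  assumes K: "closed K" and f: "continuous_on UNIV f"
  shows "resolv K l f x = (\<integral>\<^sup>+\<omega>. laplace l (\<lambda>s. killed K f 0 (max 0 s) \<omega>) \<partial>P x)"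
proof -
  have "resolv K l f x = laplace l (\<lambda>s. \<integral>\<^sup>+\<omega>. killed K f 0 (max 0 s) \<omega> \<partial>P x)"
    unfolding resolv_def surv_def by (intro laplace_cong) (simp add: max_def)
  also note time_fubini[OF killed_joint_measurable[of "\<lambda>_. 0", OF _ _ K f]]
  finally show ?thesis by simp
qed

text \<open>This is \<open>strong_markov_killed\<close> integrated over time, after exchanging the
  integrals over times and outcomes on both sides.\<close>

lemma resolv_after_exit:
  assumes U: "open U" "x \<in> U" and l: "0 \<le> l" and K: "closed K" "K \<noteq> {}" and f: "test_fun f"
  shows "(\<integral>\<^sup>+\<omega>. discount U l \<omega> * laplace l (\<lambda>s. killed K f (etime U \<omega>) (max 0 s) \<omega>) \<partial>P x)
    = (\<integral>\<^sup>+\<omega>. discount U l \<omega> * resolv K l f (X (etime U \<omega>) \<omega>) \<partial>P x)" (is "?L = ?R")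
proof -
  obtain c where c: "\<And>z. f z \<le> c" using test_fun_bounded[OF f] by blast
  note fc = test_fun_continuous[OF f]
  note [measurable] = discount_measurable[OF U(1), of l x]
  have Hm [measurable]: "(\<lambda>(s, \<omega>). killed K f (etime U \<omega>) (max 0 s) \<omega>) \<in> borel_measurable (borel \<Otimes>\<^sub>M P x)"
    by (rule killed_joint_measurable[OF etime_measurable[OF U(1)] _ K(1) fc]) simp
  have Qm [measurable]: "(\<lambda>(s, \<omega>). surv K (max 0 s) f (X (etime U \<omega>) \<omega>)) \<in> borel_measurable (borel \<Otimes>\<^sub>M P x)"
  proof -
    have "(\<lambda>w. (fst w, X (etime U (snd w)) (snd w))) \<in> measurable (borel \<Otimes>\<^sub>M P x) (borel \<Otimes>\<^sub>M borel)"
      by (rule measurable_Pair[OF measurable_fst measurable_compose[OF measurable_snd X_etime_measurable[OF U(1)]]])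
    from measurable_compose[OF this surv_joint_measurable[OF K fc c]] show ?thesis
      by (simp add: case_prod_beta')
  qed
  have swap: "(\<integral>\<^sup>+\<omega>. discount U l \<omega> * laplace l (\<lambda>s. \<Phi> s \<omega>) \<partial>P x) = laplace l (\<lambda>s. \<integral>\<^sup>+\<omega>. discount U l \<omega> * \<Phi> s \<omega> \<partial>P x)"
    if [measurable]: "(\<lambda>(s, \<omega>). \<Phi> s \<omega>) \<in> borel_measurable (borel \<Otimes>\<^sub>M P x)" for \<Phi>
  proof -
    have "(\<integral>\<^sup>+\<omega>. discount U l \<omega> * laplace l (\<lambda>s. \<Phi> s \<omega>) \<partial>P x) = (\<integral>\<^sup>+\<omega>. laplace l (\<lambda>s. discount U l \<omega> * \<Phi> s \<omega>) \<partial>P x)"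
    proof (rule nn_integral_cong)
      fix \<omega> assume "\<omega> \<in> space (P x)"
      note [measurable] = time_section[OF that this]
      show "discount U l \<omega> * laplace l (\<lambda>s. \<Phi> s \<omega>) = laplace l (\<lambda>s. discount U l \<omega> * \<Phi> s \<omega>)"
        by (subst nn_integral_cmult[symmetric]) (auto simp: mult_ac)
    qed
    also have "\<dots> = laplace l (\<lambda>s. \<integral>\<^sup>+\<omega>. discount U l \<omega> * \<Phi> s \<omega> \<partial>P x)"
      by (rule time_fubini[symmetric]) (use that in measurable)
    finally show ?thesis .
  qed
  have "?L = laplace l (\<lambda>s. \<integral>\<^sup>+\<omega>. discount U l \<omega> * killed K f (etime U \<omega>) (max 0 s) \<omega> \<partial>P x)"
    by (rule swap[OF Hm])
  also have "\<dots> = laplace l (\<lambda>s. \<integral>\<^sup>+\<omega>. discount U l \<omega> * surv K (max 0 s) f (X (etime U \<omega>) \<omega>) \<partial>P x)"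
    by (intro laplace_cong strong_markov_killed[OF U l _ K f]) simp
  also have "\<dots> = (\<integral>\<^sup>+\<omega>. discount U l \<omega> * laplace l (\<lambda>s. surv K (max 0 s) f (X (etime U \<omega>) \<omega>)) \<partial>P x)"
    by (rule swap[OF Qm, symmetric])
  also have "\<dots> = ?R"
  proof -
    have "laplace l (\<lambda>s. surv K (max 0 s) f z) = resolv K l f z" for z
      unfolding resolv_def by (intro laplace_cong) (simp add: max_def)
    then show ?thesis by (simp only:)
  qed
  finally show ?thesis .
qed

text \<open>Dynkin's formula, proved path by path: the time integral is split at the exit time
  \<tau> from \<open>U\<close>, and substituting \<tau> + s for the time turns the later part into
  the discount factor times the functional after \<tau>. Without \<open>U \<subseteq> K\<close> a
  path may leave \<open>K\<close> while still in \<open>U\<close>, and only an inequality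
  remains.\<close>

lemma
  assumes U: "open U" "x \<in> U" and l: "0 \<le> l" and K: "closed K" "K \<noteq> {}" and f: "test_fun f"
  shows dynkin_le: "resolv K l f x \<le> resolv U l f x + (\<integral>\<^sup>+\<omega>. discount U l \<omega> * resolv K l f (X (etime U \<omega>) \<omega>) \<partial>P x)" (is ?le)
    and dynkin_eq: "U \<subseteq> K \<Longrightarrow> resolv K l f x = resolv U l f x + (\<integral>\<^sup>+\<omega>. discount U l \<omega> * resolv K l f (X (etime U \<omega>) \<omega>) \<partial>P x)" (is "_ \<Longrightarrow> ?eq")
proof -
  note fc = test_fun_continuous[OF f]
  let ?e = "\<lambda>s. ennreal (exp (- l * s))"
  let ?A = "\<lambda>s \<omega>. indicator {0<..} s * (?e s * killed K f 0 (max 0 s) \<omega>)"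
  let ?B = "\<lambda>s \<omega>. indicator {0<..} s * (?e s * before_exit U f s \<omega>)"
  let ?H = "\<lambda>s \<omega>. killed K f (etime U \<omega>) (max 0 s) \<omega>"
  let ?C = "\<lambda>\<omega>. discount U l \<omega> * laplace l (\<lambda>s. ?H s \<omega>)"
  have Hm: "(\<lambda>(s, \<omega>). ?H s \<omega>) \<in> borel_measurable (borel \<Otimes>\<^sub>M P x)"
    by (rule killed_joint_measurable[OF etime_measurable[OF U(1)] _ K(1) fc]) simp
  note Bm = before_exit_joint_measurable[OF U(1) fc, of x]
  have path: "(\<integral>\<^sup>+s. ?A s \<omega> \<partial>lborel) \<le> (\<integral>\<^sup>+s. ?B s \<omega> \<partial>lborel) + ?C \<omega> \<and>
      (U \<subseteq> K \<longrightarrow> (\<integral>\<^sup>+s. ?A s \<omega> \<partial>lborel) = (\<integral>\<^sup>+s. ?B s \<omega> \<partial>lborel) + ?C \<omega>)"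
    if \<omega>: "\<omega> \<in> space (P x)" "X 0 \<omega> \<in> U" for \<omega>
  proof (cases "exit_time X U \<omega> < \<top>")
    case False
    then have top: "exit_time X U \<omega> = \<top>" by (metis top.not_eq_extremum)
    have "X s \<omega> \<in> U" if "0 \<le> s" for s
      using stays_iff_exit[OF \<omega> U(1) that] top that by (auto simp: stays_def ennreal_less_top)
    then have "U \<subseteq> K \<Longrightarrow> stays K (max 0 s) \<omega>" for s by (auto simp: stays_def)
    then have eq: "U \<subseteq> K \<Longrightarrow> ?A s \<omega> = ?B s \<omega>" for s
      by (simp add: top killed_0 before_exit_def)
    have "?A s \<omega> \<le> ?B s \<omega>" for s
      by (simp add: top killed_0 before_exit_def)
    then have "(\<integral>\<^sup>+s. ?A s \<omega> \<partial>lborel) \<le> (\<integral>\<^sup>+s. ?B s \<omega> \<partial>lborel)" by (rule nn_integral_mono)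
    moreover have "U \<subseteq> K \<Longrightarrow> (\<integral>\<^sup>+s. ?A s \<omega> \<partial>lborel) = (\<integral>\<^sup>+s. ?B s \<omega> \<partial>lborel)"
      using eq by (simp only:)
    ultimately show ?thesis using False by (simp add: discount_def)
  next
    case True
    note T = exit_time_finiteD[OF \<omega> U(1) True]
    define \<tau> where "\<tau> = etime U \<omega>"
    have ex: "exit_time X U \<omega> = ennreal \<tau>" using True by (simp add: \<tau>_def)
    have \<tau>: "0 < \<tau>" "\<And>u. 0 \<le> u \<Longrightarrow> u < \<tau> \<Longrightarrow> X u \<omega> \<in> U" using T unfolding \<tau>_def by auto
    \<comment> \<open>The part of the integrand after the exit; shifting time by \<tau> splits off
      the factor exp(- l \<tau>) of \<open>discount\<close>.\<close>
    define Z where "Z s = (if \<tau> < s then ?e s * ?H (s - \<tau>) \<omega> else 0)" for s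
    note [measurable] = time_section[OF Hm \<omega>(1)] time_section[OF Bm \<omega>(1)]
    have "(\<lambda>s. ?H (s - \<tau>) \<omega>) \<in> borel_measurable borel"
      by (rule measurable_compose[OF _ time_section[OF Hm \<omega>(1)]]) measurable
    then have Zm [measurable]: "Z \<in> borel_measurable borel" unfolding Z_def by measurable
    have "(\<integral>\<^sup>+s. Z s \<partial>lborel) = (\<integral>\<^sup>+s. Z (\<tau> + s) \<partial>lborel)" by (rule nn_integral_shift[OF Zm])
    also have "\<dots> = (\<integral>\<^sup>+s. ?e \<tau> * (indicator {0<..} s * (?e s * ?H s \<omega>)) \<partial>lborel)"
    proof (intro nn_integral_cong)
      fix s
      have "?e (\<tau> + s) = ?e \<tau> * ?e s"
        by (simp add: ennreal_mult'[symmetric] exp_add[symmetric] distrib_left)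
      then show "Z (\<tau> + s) = ?e \<tau> * (indicator {0<..} s * (?e s * ?H s \<omega>))"
        unfolding Z_def by (simp add: indicator_def mult.assoc)
    qed
    also have "\<dots> = ?e \<tau> * laplace l (\<lambda>s. ?H s \<omega>)"
      by (rule nn_integral_cmult) measurable
    finally have ZC: "(\<integral>\<^sup>+s. Z s \<partial>lborel) = ?C \<omega>"
      using True unfolding discount_def \<tau>_def[symmetric] by simp
    have BC: "(\<integral>\<^sup>+s. ?B s \<omega> \<partial>lborel) + ?C \<omega> = (\<integral>\<^sup>+s. ?B s \<omega> + Z s \<partial>lborel)"
      unfolding ZC[symmetric] by (rule nn_integral_add[symmetric]) measurable
    \<comment> \<open>The single time \<tau> is excluded, since both terms on the right vanish there
      while the left side need not. It is a null set.\<close>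
    have pw: "?A s \<omega> \<le> ?B s \<omega> + Z s \<and> (U \<subseteq> K \<longrightarrow> ?A s \<omega> = ?B s \<omega> + Z s)" if s: "s \<noteq> \<tau>" for s
    proof -
      consider "s \<le> 0" | "0 < s" "s < \<tau>" | "\<tau> < s" using s by linarith
      then show ?thesis
      proof cases
        case 1
        then show ?thesis using \<tau>(1) by (simp add: Z_def)
      next
        case 2
        have "ennreal s < exit_time X U \<omega>" using 2 by (simp add: ex ennreal_less_iff)
        moreover have "U \<subseteq> K \<Longrightarrow> stays K s \<omega>" using \<tau>(2) 2 by (auto simp: stays_def)
        ultimately show ?thesis using 2 by (auto simp: Z_def killed_0 before_exit_def max_def)
      next
        case 3
        then have n: "\<not> ennreal s < exit_time X U \<omega>" using \<tau> by (simp add: ex ennreal_less_iff not_less)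
        have e: "max 0 s = s" "max 0 (s - \<tau>) = s - \<tau>" using 3 \<tau>(1) by auto
        have imp: "\<forall>u\<in>{0..s - \<tau>}. X (\<tau> + u) \<omega> \<in> K" if "stays K s \<omega>"
          using that \<tau>(1) by (auto simp: stays_def)
        have conv: "stays K s \<omega>" if UK: "U \<subseteq> K" and st: "\<forall>u\<in>{0..s - \<tau>}. X (\<tau> + u) \<omega> \<in> K"
          unfolding stays_def
        proof
          fix u assume u: "u \<in> {0..s}"
          show "X u \<omega> \<in> K"
          proof (cases "u < \<tau>")
            case True
            then show ?thesis using \<tau>(2)[of u] u UK by auto
          next
            case False
            then have "u - \<tau> \<in> {0..s - \<tau>}" using u by auto
            then have "X (\<tau> + (u - \<tau>)) \<omega> \<in> K" using st by blast
            then show ?thesis by simp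
          qed
        qed
        have H: "?H (s - \<tau>) \<omega> = (if \<forall>u\<in>{0..s - \<tau>}. X (\<tau> + u) \<omega> \<in> K then ennreal (f (X s \<omega>)) else 0)"
          unfolding \<tau>_def[symmetric] e(2) killed_def by simp
        have le: "killed K f 0 s \<omega> \<le> ?H (s - \<tau>) \<omega>"
          unfolding H killed_0 using imp by (auto simp del: Ball_def)
        have eq: "killed K f 0 s \<omega> = ?H (s - \<tau>) \<omega>" if "U \<subseteq> K"
          unfolding H killed_0 using imp conv[OF that] by meson
        have Zs: "Z s = ?e s * ?H (s - \<tau>) \<omega>" using 3 by (simp add: Z_def)
        have As: "?A s \<omega> = ?e s * killed K f 0 s \<omega>" using 3 \<tau>(1) by (simp add: e)
        have Bs: "?B s \<omega> = 0" using n by (simp add: before_exit_def)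
        show ?thesis unfolding As Bs Zs add_0
          using mult_left_mono[OF le zero_le] eq by simp
      qed
    qed
    have AE: "AE s in lborel. s \<noteq> \<tau>" by (rule AE_lborel_singleton)
    show ?thesis unfolding BC
    proof (intro conjI impI)
      show "(\<integral>\<^sup>+s. ?A s \<omega> \<partial>lborel) \<le> (\<integral>\<^sup>+s. ?B s \<omega> + Z s \<partial>lborel)"
        by (rule nn_integral_mono_AE) (use AE in \<open>eventually_elim, use pw in blast\<close>)
      show "(\<integral>\<^sup>+s. ?A s \<omega> \<partial>lborel) = (\<integral>\<^sup>+s. ?B s \<omega> + Z s \<partial>lborel)" if "U \<subseteq> K"
        by (rule nn_integral_cong_AE) (use AE in \<open>eventually_elim, use pw that in blast\<close>)
    qed
  qed
  have AEg: "AE \<omega> in P x. \<omega> \<in> space (P x) \<and> X 0 \<omega> \<in> U"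
    using X_start[of x] U(2) by (auto elim: AE_mp)
  have Cm: "?C \<in> borel_measurable (P x)"
    by (rule borel_measurable_times_ennreal[OF discount_measurable[OF U(1)] time_integral_measurable[OF Hm]])
  have rhs: "resolv U l f x + (\<integral>\<^sup>+\<omega>. discount U l \<omega> * resolv K l f (X (etime U \<omega>) \<omega>) \<partial>P x)
    = (\<integral>\<^sup>+\<omega>. (\<integral>\<^sup>+s. ?B s \<omega> \<partial>lborel) + ?C \<omega> \<partial>P x)"
    unfolding resolv_open_eq[OF U fc] resolv_after_exit[OF U l K f, symmetric]
    by (rule nn_integral_add[OF time_integral_measurable[OF Bm] Cm, symmetric])
  show ?le
    unfolding rhs unfolding resolv_closed_eq[OF K(1) fc]
    by (rule nn_integral_mono_AE) (use AEg in \<open>eventually_elim, use path in blast\<close>)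
  show ?eq if "U \<subseteq> K"
    unfolding rhs unfolding resolv_closed_eq[OF K(1) fc]
    by (rule nn_integral_cong_AE) (use AEg in \<open>eventually_elim, use path that in blast\<close>)
qed

end

section \<open>Exit probabilities\<close>

text \<open>The length of the interval from 0 to \<open>e\<close>. With \<open>e\<close> an exit
  time it identifies the mean exit time with the resolvent of 1 at \<open>l = 0\<close>.\<close>

lemma nn_integral_below_ennreal:
  "(\<integral>\<^sup>+s. indicator {0<..} s * (if ennreal s < e then 1 else 0) \<partial>lborel) = e"
proof (cases e)
  case (real v)
  have "(\<integral>\<^sup>+s. indicator {0<..} s * (if ennreal s < e then 1 else 0) \<partial>lborel)
      = (\<integral>\<^sup>+s. indicator {0<..<v} s \<partial>lborel)"
    using real by (intro nn_integral_cong) (auto simp: indicator_def ennreal_less_iff)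
  then show ?thesis using real by simp
next
  case top
  have "of_nat n \<le> (\<integral>\<^sup>+s. indicator {0<..} (s::real) \<partial>lborel)" for n
  proof -
    have "of_nat n = (\<integral>\<^sup>+s. indicator {0<..real n} s \<partial>lborel)"
      by (simp add: ennreal_of_nat_eq_real_of_nat)
    also have "\<dots> \<le> (\<integral>\<^sup>+s. indicator {0<..} (s::real) \<partial>lborel)"
      by (intro nn_integral_mono) (auto simp: indicator_def)
    finally show ?thesis .
  qed
  then have "(\<integral>\<^sup>+s. indicator {0<..} (s::real) \<partial>lborel) = (\<top> :: ennreal)"
    using ennreal_Ex_less_of_nat by (metis linorder_not_less top.not_eq_extremum)
  then show ?thesis using top by (simp add: ennreal_less_top)
qed

lemma ennreal_le_real_obtain:
  assumes "a \<le> ennreal b"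
  obtains v where "a = ennreal v" "0 \<le> v"
  using assms by (cases a) (auto simp: top_unique)

context lc_diffusion
begin

section \<open>Mean exit times as resolvents\<close>

lemma mean_exit_open:
  assumes "open U" "x \<in> U"
  shows "(\<integral>\<^sup>+\<omega>. exit_time X U \<omega> \<partial>P x) = resolv U 0 (\<lambda>_. 1) x"
  using resolv_open_eq[OF assms, of "\<lambda>_. 1" 0]
  by (simp add: nn_integral_below_ennreal before_exit_def cong: if_cong)

lemma mean_exit_time_eq: "0 < r \<Longrightarrow> mean_exit_time P X x r = resolv (ball x r) 0 (\<lambda>_. 1) x"
  using mean_exit_open[of "ball x r" x] by (simp add: mean_exit_time_def)

lemma surv_markov:
  assumes t: "0 \<le> t" and s: "0 \<le> s" and K: "closed K" "K \<noteq> {}" and f: "test_fun f"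
    and G: "G \<in> borel_measurable (\<F> x t)" "\<And>\<omega>. G \<omega> \<le> 1"
  shows "(\<integral>\<^sup>+\<omega>. G \<omega> * killed K f t s \<omega> \<partial>P x) = (\<integral>\<^sup>+\<omega>. G \<omega> * surv K s f (X t \<omega>) \<partial>P x)"
proof -
  obtain c where c: "\<And>z. f z \<le> c" using test_fun_bounded[OF f] by blast
  have fm: "(\<lambda>z. ennreal (f z)) \<in> borel_measurable borel" using test_fun_measurable[OF f] by measurable
  have bm: "(\<lambda>z. ennreal (bump K n z)) \<in> borel_measurable borel" for n by measurable
  have h: "0 \<le> s / real (Suc n)" for n using s by simp
  have cancel: "real (Suc n) * (s / real (Suc n)) = s" for n by simp
  show ?thesis
  proof (rule killed_identity_limit[OF s K test_fun_measurable[OF f] c _ _ filtration_measurable[OF G(1)] G(2), of "\<lambda>_. t"])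
    show "(\<integral>\<^sup>+\<omega>. G \<omega> * grid_path K s n f t \<omega> \<partial>P x) = (\<integral>\<^sup>+\<omega>. G \<omega> * grid K s n f (X t \<omega>) \<partial>P x)" for n
      using markov_chain[OF t h[of n] G(1) bm[of n] fm, of "Suc n"] unfolding grid_path_def cancel .
  qed (use t in auto)
qed

lemma test_fun_1: "test_fun (\<lambda>_. 1)" by (simp add: test_fun_def)

lemma surv_add_le:
  assumes t: "0 \<le> t" and s: "0 \<le> s" and K: "closed K" "K \<noteq> {}"
  shows "surv K (t + s) (\<lambda>_. 1) x \<le> (\<integral>\<^sup>+\<omega>. killed K (\<lambda>_. 1) 0 t \<omega> * surv K s (\<lambda>_. 1) (X t \<omega>) \<partial>P x)"
proof -
  have G: "killed K (\<lambda>_. 1) 0 t \<in> borel_measurable (\<F> x t)"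
    unfolding killed_0[abs_def] using stays_filtration[OF t K(1)] by measurable
  have "surv K (t + s) (\<lambda>_. 1) x \<le> (\<integral>\<^sup>+\<omega>. killed K (\<lambda>_. 1) 0 t \<omega> * killed K (\<lambda>_. 1) t s \<omega> \<partial>P x)"
    unfolding surv_def using t s by (intro nn_integral_mono) (auto simp: killed_def)
  also have "\<dots> = (\<integral>\<^sup>+\<omega>. killed K (\<lambda>_. 1) 0 t \<omega> * surv K s (\<lambda>_. 1) (X t \<omega>) \<partial>P x)"
    by (rule surv_markov[OF t s K test_fun_1 G]) (simp add: killed_def)
  finally show ?thesis .
qed

lemma surv_1_eq:
  assumes "0 \<le> t" "closed K"
  shows "surv K t (\<lambda>_. 1) x = emeasure (P x) {\<omega> \<in> space (P x). stays K t \<omega>}"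
proof -
  have [measurable]: "Measurable.pred (P x) (stays K t)" using stays_measurable assms .
  have "surv K t (\<lambda>_. 1) x = (\<integral>\<^sup>+\<omega>. indicator {\<omega> \<in> space (P x). stays K t \<omega>} \<omega> \<partial>P x)"
    unfolding surv_def by (intro nn_integral_cong) (auto simp: killed_0 indicator_def)
  then show ?thesis by simp
qed

text \<open>Up to time \<open>t\<close> the integrand is at most 1. A path surviving longer is in
  \<open>K\<close> at time \<open>t\<close>, and by the Markov property its expected remaining time
  in \<open>K\<close> is at most \<open>M\<close>.\<close>

lemma resolv_le_split:
  assumes t: "0 \<le> t" and K: "closed K" "K \<noteq> {}"
    and M: "\<And>z. z \<in> K \<Longrightarrow> resolv K 0 (\<lambda>_. 1) z \<le> M"
  shows "resolv K 0 (\<lambda>_. 1) x \<le> ennreal t + surv K t (\<lambda>_. 1) x * M"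
proof -
  have jm: "(\<lambda>(s, z). indicator {0<..} s * surv K s (\<lambda>_. 1) z) \<in> borel_measurable (borel \<Otimes>\<^sub>M borel)"
    using surv_indicator_measurable[OF K, of "\<lambda>_. 1" 1] by auto
  have sm [measurable]: "(\<lambda>s. indicator {0<..} s * surv K s (\<lambda>_. 1) z) \<in> borel_measurable borel" for z
    using measurable_compose[OF measurable_Pair[OF measurable_ident measurable_const] jm, of z] by simp
  let ?k = "killed K (\<lambda>_. 1) 0 t"
  have [measurable]: "?k \<in> borel_measurable (P x)"
    using killed_measurable[of t "\<lambda>_. 0"] t K(1) by simp
  have Xt: "X t \<in> borel_measurable (P x)" using X_measurable[OF t] .
  have tail_meas [measurable]: "(\<lambda>s. indicator {t<..} s * surv K s (\<lambda>_. 1) x) \<in> borel_measurable borel"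
  proof -
    have "(\<lambda>s. indicator {t<..} s * (indicator {0<..} s * surv K s (\<lambda>_. 1) x)) \<in> borel_measurable borel"
      by measurable
    moreover have "indicator {t<..} s * (indicator {0<..} s * surv K s (\<lambda>_. 1) x) =
      indicator {t<..} s * surv K s (\<lambda>_. 1) x" for s
      using t by (auto simp: indicator_def)
    ultimately show ?thesis by simp
  qed
  have "resolv K 0 (\<lambda>_. 1) x \<le> (\<integral>\<^sup>+s. indicator {0<..t} s + indicator {t<..} s * surv K s (\<lambda>_. 1) x \<partial>lborel)"
    unfolding resolv_def
    by (intro nn_integral_mono) (auto simp: indicator_def intro: surv_le_1[of "\<lambda>_. 1", simplified])
  also have "\<dots> = ennreal t + (\<integral>\<^sup>+s. indicator {t<..} s * surv K s (\<lambda>_. 1) x \<partial>lborel)"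
    by (subst nn_integral_add) (use t tail_meas in auto)
  also have "(\<integral>\<^sup>+s. indicator {t<..} s * surv K s (\<lambda>_. 1) x \<partial>lborel)
     = (\<integral>\<^sup>+s. indicator {t<..} (t + s) * surv K (t + s) (\<lambda>_. 1) x \<partial>lborel)"
    by (rule nn_integral_shift) measurable
  also have "\<dots> = (\<integral>\<^sup>+s. indicator {0<..} s * surv K (t + s) (\<lambda>_. 1) x \<partial>lborel)"
    by (intro nn_integral_cong) (auto simp: indicator_def)
  also have "\<dots> \<le> (\<integral>\<^sup>+s. indicator {0<..} s * (ennreal (exp (- 0 * s)) *
      (\<integral>\<^sup>+\<omega>. ?k \<omega> * (indicator {0<..} s * surv K s (\<lambda>_. 1) (X t \<omega>)) \<partial>P x)) \<partial>lborel)"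
    using surv_add_le[OF t _ K, of _ x] by (intro nn_integral_mono) (auto simp: indicator_def)
  also have "\<dots> = (\<integral>\<^sup>+\<omega>. (\<integral>\<^sup>+s. indicator {0<..} s * (ennreal (exp (- 0 * s)) *
      (?k \<omega> * (indicator {0<..} s * surv K s (\<lambda>_. 1) (X t \<omega>)))) \<partial>lborel) \<partial>P x)"
  proof (rule time_fubini)
    have "(\<lambda>w. (fst w, X t (snd w))) \<in> measurable (borel \<Otimes>\<^sub>M P x) (borel \<Otimes>\<^sub>M borel)"
      by (rule measurable_Pair[OF measurable_fst measurable_compose[OF measurable_snd Xt]])
    from measurable_compose[OF this jm]
    have [measurable]: "(\<lambda>w. indicator {0<..} (fst w) * surv K (fst w) (\<lambda>_. 1) (X t (snd w))) \<in> borel_measurable (borel \<Otimes>\<^sub>M P x)"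
      by simp
    show "(\<lambda>(s, \<omega>). ?k \<omega> * (indicator {0<..} s * surv K s (\<lambda>_. 1) (X t \<omega>))) \<in> borel_measurable (borel \<Otimes>\<^sub>M P x)"
      unfolding case_prod_beta' by measurable
  qed
  also have "\<dots> = (\<integral>\<^sup>+\<omega>. ?k \<omega> * resolv K 0 (\<lambda>_. 1) (X t \<omega>) \<partial>P x)"
  proof (rule nn_integral_cong)
    fix \<omega>
    have "laplace 0 (\<lambda>s. ?k \<omega> * (indicator {0<..} s * surv K s (\<lambda>_. 1) (X t \<omega>)))
        = (\<integral>\<^sup>+s. ?k \<omega> * (indicator {0<..} s * surv K s (\<lambda>_. 1) (X t \<omega>)) \<partial>lborel)"
      by (intro nn_integral_cong) (auto simp: indicator_def)
    also have "\<dots> = ?k \<omega> * (\<integral>\<^sup>+s. indicator {0<..} s * surv K s (\<lambda>_. 1) (X t \<omega>) \<partial>lborel)"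
      by (rule nn_integral_cmult) measurable
    finally show "laplace 0 (\<lambda>s. ?k \<omega> * (indicator {0<..} s * surv K s (\<lambda>_. 1) (X t \<omega>)))
        = ?k \<omega> * resolv K 0 (\<lambda>_. 1) (X t \<omega>)"
      by (simp add: resolv_def)
  qed
  also have "\<dots> \<le> (\<integral>\<^sup>+\<omega>. ?k \<omega> * M \<partial>P x)"
    using t M by (intro nn_integral_mono) (auto simp: killed_0 stays_def)
  also have "\<dots> = surv K t (\<lambda>_. 1) x * M"
    unfolding surv_def by (rule nn_integral_multc) measurable
  finally show ?thesis by (simp add: add_left_mono)
qed

end

text \<open>The mean exit bounds are put in terms of closed balls, since killing is developed for
  closed sets. They follow from those for open balls with a larger constant and a smaller range of
  radii.\<close>

locale regular_diffusion = lc_diffusion P X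
  for P :: "'a::{metric_space, second_countable_topology} \<Rightarrow> 'w measure" and X :: "real \<Rightarrow> 'w \<Rightarrow> 'a" +
  fixes \<beta> C R :: real
  assumes \<beta>: "1 < \<beta>" and C: "0 < C" and R: "0 < R"
    and mean_exit_lower: "0 < r \<Longrightarrow> r < R \<Longrightarrow> ennreal (r powr \<beta> / C) \<le> resolv (cball x r) 0 (\<lambda>_. 1) x"
    and mean_exit_upper: "0 < r \<Longrightarrow> r < R \<Longrightarrow> resolv (cball x r) 0 (\<lambda>_. 1) x \<le> ennreal (C * r powr \<beta>)"
begin

lemma resolv_cball_upper:
  assumes r: "0 < r" "2 * r < R"
  shows "resolv (cball x r) 0 (\<lambda>_. 1) z \<le> ennreal (C * (2 * r) powr \<beta>)"
proof (cases "z \<in> cball x r")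
  case True
  then have "cball x r \<subseteq> cball z (2 * r)"
  proof (intro subsetI)
    fix y assume "y \<in> cball x r"
    then show "y \<in> cball z (2 * r)" using True dist_triangle[of z y x] by (simp add: dist_commute)
  qed
  then have "resolv (cball x r) 0 (\<lambda>_. 1) z \<le> resolv (cball z (2 * r)) 0 (\<lambda>_. 1) z"
    by (rule resolv_mono_set)
  also have "\<dots> \<le> ennreal (C * (2 * r) powr \<beta>)" using r by (intro mean_exit_upper) auto
  finally show ?thesis .
qed (simp add: resolv_outside)

text \<open>The survival probability in \<open>stay_lower\<close>. There
  \<open>r^\<beta> / C \<le> t + v * C * (2 * r)^\<beta>\<close> with
  \<open>t \<le> r^\<beta> / (2 * C)\<close> forces
  \<open>v \<ge> 1 / (2 * C^2 * 2^\<beta>)\<close>; the minimum with 1/2 only keeps the value below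
  1.\<close>

definition \<epsilon> :: real where "\<epsilon> = min (1/2) (1 / (2 * C\<^sup>2 * 2 powr \<beta>))"

lemma eps: "0 < \<epsilon>" "\<epsilon> < 1"
  using C by (auto simp: \<epsilon>_def)

text \<open>A too likely exit before time \<open>t\<close> would contradict the lower bound for the
  mean exit time, because the expected time remaining after \<open>t\<close> is bounded by
  \<open>resolv_cball_upper\<close> from every point of the ball.\<close>

lemma stay_lower:
  assumes r: "0 < r" "2 * r < R" and t: "0 \<le> t" "t \<le> r powr \<beta> / (2 * C)"
  shows "ennreal \<epsilon> \<le> surv (cball x r) t (\<lambda>_. 1) x"
proof -
  have "surv (cball x r) t (\<lambda>_. 1) x \<le> 1" by (rule surv_le_1) simp
  then obtain v where v: "surv (cball x r) t (\<lambda>_. 1) x = ennreal v" "0 \<le> v"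
    using ennreal_le_real_obtain[of _ 1] by auto
  have rb: "0 < r powr \<beta>" using r by simp
  have "ennreal (r powr \<beta> / C) \<le> resolv (cball x r) 0 (\<lambda>_. 1) x" using r by (intro mean_exit_lower) auto
  also have "\<dots> \<le> ennreal t + ennreal v * ennreal (C * (2 * r) powr \<beta>)"
    unfolding v(1)[symmetric] using r by (intro resolv_le_split t resolv_cball_upper) auto
  also have "\<dots> = ennreal (t + v * (C * (2 * r) powr \<beta>))"
    using t v C by (simp add: ennreal_mult')
  finally have "r powr \<beta> / C \<le> t + v * (C * (2 * r) powr \<beta>)"
    using t v C by (subst (asm) ennreal_le_iff) auto
  also have "(2 * r) powr \<beta> = 2 powr \<beta> * r powr \<beta>" using r by (simp add: powr_mult)
  finally have "r powr \<beta> / (2 * C) \<le> v * (C * (2 powr \<beta> * r powr \<beta>))"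
    using t(2) by (simp add: field_simps)
  then have "r powr \<beta> * (1 / (2 * C)) \<le> r powr \<beta> * (v * (C * 2 powr \<beta>))"
    by (simp add: mult_ac)
  then have "1 / (2 * C) \<le> v * (C * 2 powr \<beta>)" using rb by (subst (asm) mult_le_cancel_left_pos) auto
  then have "1 / (2 * C\<^sup>2 * 2 powr \<beta>) \<le> v" using C by (simp add: field_simps power2_eq_square)
  then have "\<epsilon> \<le> v" by (simp add: \<epsilon>_def)
  then show ?thesis unfolding v(1) by (rule ennreal_leI)
qed

text \<open>Bound for the Laplace transform of the exit time from a ball at the parameter
  \<open>rate r\<close>; the deficit \<epsilon> exp(-1) comes from the paths that survive until time
  \<open>1 / rate r\<close>.\<close>

definition \<rho> :: real where "\<rho> = 1 - \<epsilon> * exp (-1)"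

lemma rho: "0 < \<rho>" "\<rho> < 1"
proof -
  have "\<epsilon> * exp (-1) < 1 * 1" using eps by (intro mult_strict_mono) auto
  then show "0 < \<rho>" by (simp add: \<rho>_def)
qed (use eps in \<open>simp add: \<rho>_def\<close>)

definition rate :: "real \<Rightarrow> real" where "rate r = 2 * C * 2 powr \<beta> / r powr \<beta>"

lemma resolv_UNIV: "0 < l \<Longrightarrow> resolv UNIV l (\<lambda>_. 1) x = ennreal (1 / l)"
  using nn_integral_exp_tail[of l 0] by (simp add: resolv_def surv_def killed_def)

text \<open>For \<open>K = UNIV\<close> Dynkin's formula reads \<open>1 / l = resolv U l 1 x + E e\<^sup>-\<^sup>l\<^sup>T / l\<close>, so a lower bound
  for the resolvent bounds the Laplace transform of the exit time from above.\<close>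

lemma dynkin_exponential:
  assumes r: "0 < r" "r < R"
  defines "l \<equiv> rate r"
  obtains u q where "0 \<le> u" "0 \<le> q" "q \<le> \<rho>" "1 / l = u + q / l" "resolv (ball x r) l (\<lambda>_. 1) x = ennreal u"
    "(\<integral>\<^sup>+\<omega>. discount (ball x r) l \<omega> \<partial>P x) = ennreal q"
proof -
  have l: "0 < l" using r C by (simp add: l_def rate_def)
  let ?U = "ball x r"
  let ?q = "\<integral>\<^sup>+\<omega>. discount ?U l \<omega> \<partial>P x"
  note [measurable] = discount_measurable[OF open_ball, of x r l x]
  have "?q \<le> (\<integral>\<^sup>+\<omega>. 1 \<partial>P x)"
    using l by (intro nn_integral_mono discount_le_1) simp
  then have "?q \<le> 1" by simp
  then obtain q where q: "?q = ennreal q" "0 \<le> q" using ennreal_le_real_obtain[of ?q 1] by auto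
  have "ennreal (1 / l) = resolv ?U l (\<lambda>_. 1) x +
      (\<integral>\<^sup>+\<omega>. discount ?U l \<omega> * resolv UNIV l (\<lambda>_. 1) (X (etime ?U \<omega>) \<omega>) \<partial>P x)"
    unfolding resolv_UNIV[OF l, of x, symmetric]
    by (rule dynkin_eq[OF open_ball _ less_imp_le[OF l] closed_UNIV _ test_fun_1]) (use r in auto)
  also have "(\<integral>\<^sup>+\<omega>. discount ?U l \<omega> * resolv UNIV l (\<lambda>_. 1) (X (etime ?U \<omega>) \<omega>) \<partial>P x)
    = (\<integral>\<^sup>+\<omega>. discount ?U l \<omega> * ennreal (1 / l) \<partial>P x)"
    by (intro nn_integral_cong) (simp add: resolv_UNIV[OF l])
  also have "\<dots> = ?q * ennreal (1 / l)" by (rule nn_integral_multc) measurable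
  finally have eq: "ennreal (1 / l) = resolv ?U l (\<lambda>_. 1) x + ennreal (q / l)"
    using q l by (simp add: ennreal_mult'[symmetric])
  then have "resolv ?U l (\<lambda>_. 1) x \<le> ennreal (1 / l)" by simp
  then obtain u where u: "resolv ?U l (\<lambda>_. 1) x = ennreal u" "0 \<le> u"
    using ennreal_le_real_obtain by blast
  have ul: "1 / l = u + q / l"
    using eq u q l by (simp add: ennreal_plus[symmetric] del: ennreal_plus)
  \<comment> \<open>Up to time \<open>1 / l\<close> the exponential is at least exp(-1) and survival
    has probability at least \<epsilon>. This bounds the resolvent \<open>u\<close> from below, and
    \<open>q = 1 - l * u\<close> is then at most \<rho>.\<close>
  have "ennreal (\<epsilon> * exp (-1) / l) \<le> ennreal u"
  proof -
    have il: "1 / l = (r / 2) powr \<beta> / (2 * C)" using r C by (simp add: l_def rate_def powr_divide)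
    have "ennreal (\<epsilon> * exp (-1) / l) = ennreal (\<epsilon> * exp (-1)) * ennreal (1 / l)"
      using eps l by (simp add: ennreal_mult'[symmetric])
    also have "\<dots> = (\<integral>\<^sup>+s. ennreal (\<epsilon> * exp (-1)) * indicator {0<..1 / l} s \<partial>lborel)"
      using l by (subst nn_integral_cmult_indicator) auto
    also have "\<dots> \<le> resolv ?U l (\<lambda>_. 1) x"
      unfolding resolv_def
    proof (intro nn_integral_mono)
      fix s :: real
      show "ennreal (\<epsilon> * exp (-1)) * indicator {0<..1 / l} s \<le>
        indicator {0<..} s * (ennreal (exp (- l * s)) * surv ?U s (\<lambda>_. 1) x)"
      proof (cases "s \<in> {0<..1 / l}")
        case True
        have "ennreal \<epsilon> \<le> surv (cball x (r / 2)) s (\<lambda>_. 1) x"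
          using True r il by (intro stay_lower) auto
        also have "\<dots> \<le> surv ?U s (\<lambda>_. 1) x" using r by (intro surv_mono_set) auto
        finally have "ennreal \<epsilon> \<le> surv ?U s (\<lambda>_. 1) x" .
        moreover have "exp (- 1) \<le> exp (- l * s)" using True l by (simp add: field_simps)
        ultimately have "ennreal (exp (-1)) * ennreal \<epsilon> \<le> ennreal (exp (- l * s)) * surv ?U s (\<lambda>_. 1) x"
          by (intro mult_mono ennreal_leI) auto
        then show ?thesis using True eps by (simp add: ennreal_mult'[symmetric] mult.commute)
      qed simp
    qed
    finally show ?thesis using u by simp
  qed
  then have "\<epsilon> * exp (-1) / l \<le> u" using u by (subst (asm) ennreal_le_iff) auto
  then have "q / l \<le> \<rho> / l" using ul by (simp add: \<rho>_def diff_divide_distrib)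
  then have "q \<le> \<rho>" using l by (simp add: divide_le_cancel)
  then show thesis using that[of u q] u q ul by simp
qed

text \<open>Successive exits from balls of radius \<open>r\<close> multiply the Laplace transforms
  of the exit times: after the first exit, the ball of radius \<open>n * r\<close> around the exit
  position still lies in the large one. Dynkin's formula gives
  \<open>u + q * (1 - \<rho>^n) / l = (1 - q * \<rho>^n) / l\<close>, and
  \<open>q \<le> \<rho>\<close>.\<close>

lemma resolv_lower:
  assumes r: "0 < r" "r < R"
  shows "ennreal ((1 - \<rho> ^ n) / rate r) \<le> resolv (cball x (real n * r)) (rate r) (\<lambda>_. 1) x"
proof (induction n arbitrary: x)
  case 0
  then show ?case by simp
next
  case (Suc n)
  define l where "l = rate r"
  have l: "0 < l" using r C by (simp add: l_def rate_def)
  obtain u q where uq: "0 \<le> u" "0 \<le> q" "q \<le> \<rho>" "1 / l = u + q / l" "resolv (ball x r) l (\<lambda>_. 1) x = ennreal u"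
    "(\<integral>\<^sup>+\<omega>. discount (ball x r) l \<omega> \<partial>P x) = ennreal q"
    unfolding l_def using dynkin_exponential[OF r] by blast
  let ?K = "cball x (real (Suc n) * r)"
  have p1: "0 \<le> 1 - \<rho> ^ n" using rho by (simp add: power_le_one)
  have UK: "ball x r \<subseteq> ?K"
  proof
    fix y assume "y \<in> ball x r"
    moreover have "0 \<le> real n * r" using r by simp
    ultimately show "y \<in> ?K" by (simp add: algebra_simps)
  qed
  note [measurable] = discount_measurable[OF open_ball, of x r l x]
  have AEg: "AE \<omega> in P x. \<omega> \<in> space (P x) \<and> X 0 \<omega> \<in> ball x r"
    using X_start[of x] r by (auto elim: AE_mp)
  have "ennreal ((1 - \<rho> ^ Suc n) / l) \<le> ennreal (u + q * ((1 - \<rho> ^ n) / l))"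
  proof (intro ennreal_leI)
    have "q * \<rho> ^ n \<le> \<rho> * \<rho> ^ n" using uq rho by (intro mult_right_mono) auto
    then have "(1 - \<rho> ^ Suc n) / l \<le> (1 - q * \<rho> ^ n) / l" using l by (intro divide_right_mono) auto
    also have "\<dots> = u + q / l - q * \<rho> ^ n / l" by (simp add: diff_divide_distrib uq(4))
    also have "\<dots> = u + q * ((1 - \<rho> ^ n) / l)" by (simp add: right_diff_distrib diff_divide_distrib)
    finally show "(1 - \<rho> ^ Suc n) / l \<le> u + q * ((1 - \<rho> ^ n) / l)" .
  qed
  also have "\<dots> = ennreal u + ennreal q * ennreal ((1 - \<rho> ^ n) / l)"
    using uq p1 l by (simp add: ennreal_mult'[symmetric])
  also have "ennreal q * ennreal ((1 - \<rho> ^ n) / l) =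
     (\<integral>\<^sup>+\<omega>. discount (ball x r) l \<omega> * ennreal ((1 - \<rho> ^ n) / l) \<partial>P x)"
    unfolding uq(6)[symmetric] by (rule nn_integral_multc[symmetric]) measurable
  also have "\<dots> \<le> (\<integral>\<^sup>+\<omega>. discount (ball x r) l \<omega> * resolv ?K l (\<lambda>_. 1) (X (etime (ball x r) \<omega>) \<omega>) \<partial>P x)"
  proof (rule nn_integral_mono_AE)
    show "AE \<omega> in P x. discount (ball x r) l \<omega> * ennreal ((1 - \<rho> ^ n) / l)
      \<le> discount (ball x r) l \<omega> * resolv ?K l (\<lambda>_. 1) (X (etime (ball x r) \<omega>) \<omega>)"
      using AEg
    proof eventually_elim
      case (elim \<omega>)
      show ?case
      proof (cases "exit_time X (ball x r) \<omega> < \<top>")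
        case True
        define z where "z = X (etime (ball x r) \<omega>) \<omega>"
        have "z \<in> closure (ball x r)" unfolding z_def using exit_time_finiteD(4)[OF _ _ open_ball True] elim by blast
        then have z: "dist x z \<le> r" using closure_minimal[OF ball_subset_cball closed_cball] by fastforce
        have "cball z (real n * r) \<subseteq> ?K"
        proof
          fix y assume "y \<in> cball z (real n * r)"
          then show "y \<in> ?K" using z dist_triangle[of x y z] by (simp add: algebra_simps)
        qed
        then have "ennreal ((1 - \<rho> ^ n) / l) \<le> resolv ?K l (\<lambda>_. 1) z"
          using Suc.IH[of z] resolv_mono_set order_trans unfolding l_def by blast
        then show ?thesis unfolding z_def by (simp add: mult_left_mono)
      qed (simp add: discount_def)
    qed
  qed
  also have "ennreal u + \<dots> = resolv ?K l (\<lambda>_. 1) x"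
    unfolding uq(5)[symmetric] using r UK l
    by (intro dynkin_eq[symmetric] test_fun_1) auto
  finally show ?case unfolding l_def by (simp add: add_left_mono)
qed

text \<open>Survival probabilities decrease in time, so the resolvent is at most
  \<open>(1 - exp (- l * t)) / l + v * exp (- l * t) / l\<close> with \<open>v\<close> the
  probability of surviving until \<open>t\<close>. Comparing with \<open>resolv_lower\<close> and
  solving for \<open>v\<close> gives the bound; this takes the place of Markov's inequality for the
  Laplace transform.\<close>

lemma stay_exponential:
  assumes r: "0 < r" "r < R" and t: "0 \<le> t"
  shows "ennreal (1 - exp (rate r * t) * \<rho> ^ n) \<le> surv (cball x (real n * r)) t (\<lambda>_. 1) x"
proof -
  define l where "l = rate r"
  have l: "0 < l" using r C by (simp add: l_def rate_def)
  let ?K = "cball x (real n * r)"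
  have "surv ?K t (\<lambda>_. 1) x \<le> 1" by (rule surv_le_1) simp
  then obtain v where v: "surv ?K t (\<lambda>_. 1) x = ennreal v" "0 \<le> v"
    using ennreal_le_real_obtain[of _ 1] by auto
  have tail: "(\<integral>\<^sup>+s. indicator {t<..} s * ennreal (exp (- l * s)) \<partial>lborel) = ennreal (exp (- l * t) / l)"
    by (rule nn_integral_exp_tail[OF l])
  have "(\<integral>\<^sup>+s. indicator {0<..t} s * ennreal (exp (- l * s)) \<partial>lborel) + ennreal (exp (- l * t) / l)
    = (\<integral>\<^sup>+s. indicator {0<..} s * ennreal (exp (- l * s)) \<partial>lborel)"
    unfolding tail[symmetric]
    by (subst nn_integral_add[symmetric]) (use t in \<open>auto intro!: nn_integral_cong simp: indicator_def\<close>)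
  also have "\<dots> = ennreal (1 / l)" using nn_integral_exp_tail[OF l, of 0] by simp
  finally have "(\<integral>\<^sup>+s. indicator {0<..t} s * ennreal (exp (- l * s)) \<partial>lborel) + ennreal (exp (- l * t) / l) = ennreal (1 / l)" .
  then have "(\<integral>\<^sup>+s. indicator {0<..t} s * ennreal (exp (- l * s)) \<partial>lborel) = ennreal (1 / l) - ennreal (exp (- l * t) / l)"
    using ennreal_add_diff_cancel_right by (metis ennreal_neq_top)
  then have head: "(\<integral>\<^sup>+s. indicator {0<..t} s * ennreal (exp (- l * s)) \<partial>lborel) = ennreal (1 / l - exp (- l * t) / l)"
    using l by (simp add: ennreal_minus)
  have h0: "0 \<le> 1 / l - exp (- l * t) / l"
    using l t by (simp add: diff_divide_distrib[symmetric])
  have "ennreal ((1 - \<rho> ^ n) / l) \<le> resolv ?K l (\<lambda>_. 1) x" unfolding l_def by (rule resolv_lower[OF r])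
  also have "\<dots> \<le> (\<integral>\<^sup>+s. indicator {0<..t} s * ennreal (exp (- l * s)) + ennreal v * (indicator {t<..} s * ennreal (exp (- l * s))) \<partial>lborel)"
    unfolding resolv_def
  proof (intro nn_integral_mono)
    fix s :: real
    consider "s \<le> 0" | "0 < s" "s \<le> t" | "t < s" by linarith
    then show "indicator {0<..} s * (ennreal (exp (- l * s)) * surv ?K s (\<lambda>_. 1) x) \<le>
      indicator {0<..t} s * ennreal (exp (- l * s)) + ennreal v * (indicator {t<..} s * ennreal (exp (- l * s)))"
    proof cases
      case 2
      then show ?thesis using mult_left_mono[OF surv_le_1[of "\<lambda>_. 1" ?K s x] zero_le, of "ennreal (exp (- l * s))"]
        by simp
    next
      case 3
      then have "surv ?K s (\<lambda>_. 1) x \<le> ennreal v" unfolding v(1)[symmetric] by (intro surv_antimono_time) simp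
      from mult_right_mono[OF this zero_le, of "ennreal (exp (- l * s))"]
      show ?thesis using 3 t by (simp add: mult.commute)
    qed simp
  qed
  also have "\<dots> = ennreal (1 / l - exp (- l * t) / l) + ennreal v * ennreal (exp (- l * t) / l)"
    unfolding head[symmetric] tail[symmetric] by (subst nn_integral_add) (auto simp: nn_integral_cmult)
  also have "\<dots> = ennreal ((1 / l - exp (- l * t) / l) + v * (exp (- l * t) / l))"
    using h0 v l by (simp add: ennreal_mult'[symmetric] ennreal_plus[symmetric] del: ennreal_plus)
  finally have "(1 - \<rho> ^ n) / l \<le> (1 / l - exp (- l * t) / l) + v * (exp (- l * t) / l)"
    using h0 v l by (subst (asm) ennreal_le_iff) auto
  then have "(1 - \<rho> ^ n) / l \<le> (1 - exp (- l * t) + v * exp (- l * t)) / l"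
    by (simp add: add_divide_distrib diff_divide_distrib)
  then have "exp (- l * t) - \<rho> ^ n \<le> v * exp (- l * t)" using l by (simp add: divide_le_cancel)
  then have "exp (l * t) * (exp (- l * t) - \<rho> ^ n) \<le> exp (l * t) * (v * exp (- l * t))"
    by (intro mult_left_mono) auto
  then have "1 - exp (l * t) * \<rho> ^ n \<le> v"
    by (simp add: right_diff_distrib mult.left_commute exp_add[symmetric])
  then show ?thesis unfolding v(1) l_def by (rule ennreal_leI)
qed

lemma escape_probability:
  assumes r: "0 < r" "r < R" and t: "0 \<le> t" and B: "B \<in> sets borel" "B \<inter> cball x (real n * r) = {}"
  shows "measure (P x) {\<omega> \<in> space (P x). X t \<omega> \<in> B} \<le> exp (rate r * t) * \<rho> ^ n"
proof -
  interpret prob_space "P x" by (rule prob_space_P)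
  note [measurable] = B(1) X_measurable[OF t, of x]
  let ?S = "{\<omega> \<in> space (P x). stays (cball x (real n * r)) t \<omega>}"
  have S: "?S \<in> sets (P x)" using stays_measurable[OF t closed_cball, of x "real n * r" x] by measurable
  have B': "{\<omega> \<in> space (P x). X t \<omega> \<in> B} \<in> sets (P x)" by measurable
  have "ennreal (1 - exp (rate r * t) * \<rho> ^ n) \<le> ennreal (prob ?S)"
    using stay_exponential[OF r t, of n x] surv_1_eq[OF t closed_cball, of x "real n * r" x]
    by (simp add: emeasure_eq_measure)
  then have 1: "1 - exp (rate r * t) * \<rho> ^ n \<le> prob ?S" by (subst (asm) ennreal_le_iff) simp_all
  have "?S \<inter> {\<omega> \<in> space (P x). X t \<omega> \<in> B} = {}"
    using B(2) t by (auto simp: stays_def disjoint_iff)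
  then have "prob (?S \<union> {\<omega> \<in> space (P x). X t \<omega> \<in> B}) = prob ?S + prob {\<omega> \<in> space (P x). X t \<omega> \<in> B}"
    by (intro finite_measure_Union S B')
  then show ?thesis using 1 prob_le_1[of "?S \<union> {\<omega> \<in> space (P x). X t \<omega> \<in> B}"] by linarith
qed

end

section \<open>The upper bound\<close>

text \<open>Constant prefactors and rounding errors are collected in \<open>a\<close>, which the
  factor \<open>t powr \<gamma>\<close> removes in the limit, while it turns the main term into the
  constant \<open>- L\<close>.\<close>

lemma Limsup_elog_le:
  assumes \<gamma>: "0 < \<gamma>" and ev: "\<forall>\<^sub>F t in at_right 0. F t \<le> exp (a - L * t powr (- \<gamma>))"
  shows "Limsup (at_right 0) (\<lambda>t. ereal (t powr \<gamma>) * elog (F t)) \<le> ereal (- L)"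
proof -
  have "\<forall>\<^sub>F t::real in at_right 0. 0 < t" by (simp add: eventually_at_right_less)
  with ev have "\<forall>\<^sub>F t in at_right 0. ereal (t powr \<gamma>) * elog (F t) \<le> ereal (a * t powr \<gamma> - L)"
  proof eventually_elim
    case (elim t)
    show ?case
    proof (cases "0 < F t")
      case True
      then have "ln (F t) \<le> ln (exp (a - L * t powr (- \<gamma>)))"
        using elim by (subst ln_le_cancel_iff) auto
      then have "ln (F t) \<le> a - L * t powr (- \<gamma>)" by simp
      then have "t powr \<gamma> * ln (F t) \<le> t powr \<gamma> * (a - L * t powr (- \<gamma>))"
        by (intro mult_left_mono) auto
      also have "\<dots> = a * t powr \<gamma> - L * (t powr \<gamma> * t powr (- \<gamma>))" by (simp add: algebra_simps)
      also have "t powr \<gamma> * t powr (- \<gamma>) = 1" using elim by (simp add: powr_add[symmetric])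
      finally show ?thesis using True by (simp add: elog_def)
    next
      \<comment> \<open>Here \<open>elog (F t)\<close> is -\<infinity>, and so is its product with
        the positive number \<open>t powr \<gamma>\<close>.\<close>
      case False
      then show ?thesis using elim by (simp add: elog_def)
    qed
  qed
  then have "Limsup (at_right 0) (\<lambda>t. ereal (t powr \<gamma>) * elog (F t)) \<le> Limsup (at_right 0) (\<lambda>t. ereal (a * t powr \<gamma> - L))"
    by (rule Limsup_mono)
  also have "\<dots> = ereal (- L)"
  proof (rule lim_imp_Limsup)
    have "((\<lambda>t. a * t powr \<gamma> - L) \<longlongrightarrow> - L) (at_right 0)" using \<gamma> by real_asymp
    then show "((\<lambda>t. ereal (a * t powr \<gamma> - L)) \<longlongrightarrow> ereal (- L)) (at_right 0)" by simp
  qed simp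
  finally show ?thesis .
qed

lemma Liminf_elog_ge:
  assumes \<gamma>: "0 < \<gamma>" and ev: "\<forall>\<^sub>F t in at_right 0. exp (a - L * t powr (- \<gamma>)) \<le> F t"
  shows "ereal (- L) \<le> Liminf (at_right 0) (\<lambda>t. ereal (t powr \<gamma>) * elog (F t))"
proof -
  have "\<forall>\<^sub>F t::real in at_right 0. 0 < t" by (simp add: eventually_at_right_less)
  with ev have "\<forall>\<^sub>F t in at_right 0. ereal (a * t powr \<gamma> - L) \<le> ereal (t powr \<gamma>) * elog (F t)"
  proof eventually_elim
    case (elim t)
    have F: "0 < F t" using elim(1) exp_gt_zero less_le_trans by blast
    then have "a - L * t powr (- \<gamma>) \<le> ln (F t)" using elim by (simp add: ln_ge_iff)
    then have "t powr \<gamma> * (a - L * t powr (- \<gamma>)) \<le> t powr \<gamma> * ln (F t)"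
      by (intro mult_left_mono) auto
    moreover have "t powr \<gamma> * (a - L * t powr (- \<gamma>)) = a * t powr \<gamma> - L * (t powr \<gamma> * t powr (- \<gamma>))"
      by (simp add: algebra_simps)
    moreover have "t powr \<gamma> * t powr (- \<gamma>) = 1" using elim by (simp add: powr_add[symmetric])
    ultimately show ?case using F by (simp add: elog_def)
  qed
  then have "Liminf (at_right 0) (\<lambda>t. ereal (a * t powr \<gamma> - L)) \<le> Liminf (at_right 0) (\<lambda>t. ereal (t powr \<gamma>) * elog (F t))"
    by (rule Liminf_mono)
  moreover have "Liminf (at_right 0) (\<lambda>t. ereal (a * t powr \<gamma> - L)) = ereal (- L)"
  proof (rule lim_imp_Liminf)
    have "((\<lambda>t. a * t powr \<gamma> - L) \<longlongrightarrow> - L) (at_right 0)" using \<gamma> by real_asymp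
    then show "((\<lambda>t. ereal (a * t powr \<gamma> - L)) \<longlongrightarrow> ereal (- L)) (at_right 0)" by simp
  qed simp
  ultimately show ?thesis by simp
qed

locale heat_kernel_diffusion = regular_diffusion P X \<beta> C R
  for P :: "'a::{metric_space, second_countable_topology} \<Rightarrow> 'w measure" and X :: "real \<Rightarrow> 'w \<Rightarrow> 'a"
    and \<beta> C R :: real +
  fixes \<mu> :: "'a measure" and p :: "real \<Rightarrow> 'a \<Rightarrow> 'a \<Rightarrow> real"
  assumes radon: "radon_measure \<mu>" and support: "full_support \<mu>"
    and density: "transition_density \<mu> P X p"
begin

section \<open>Transitions between sets in terms of probabilities, and the upper bound\<close>

lemma sets_\<mu>: "sets \<mu> = sets borel" using radon by (simp add: radon_measure_def)

lemma space_\<mu>: "space \<mu> = UNIV" using sets_eq_imp_space_eq[OF sets_\<mu>] by simp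

lemma borel_measurable_\<mu>: "borel_measurable \<mu> = borel_measurable borel"
  using sets_\<mu> by (auto cong: measurable_cong_sets)

lemma p_measurable:
  assumes "0 < t"
  shows "(\<lambda>y. ennreal (p t x y)) \<in> borel_measurable \<mu>"
proof -
  have "distributed (P x) \<mu> (X t) (\<lambda>y. ennreal (p t x y))"
    using density assms unfolding transition_density_def by blast
  then show ?thesis by (rule distributed_borel_measurable)
qed

lemma p_nonneg: "0 < t \<Longrightarrow> 0 \<le> p t x y"
  using density unfolding transition_density_def by blast

lemma transition_prob:
  assumes t: "0 < t" and B: "B \<in> sets borel"
  shows "(LINT y:B|\<mu>. p t x y) = measure (P x) {\<omega> \<in> space (P x). X t \<omega> \<in> B}"
proof -
  have D: "distributed (P x) \<mu> (X t) (\<lambda>y. ennreal (p t x y))"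
    using density t unfolding transition_density_def by blast
  have pm: "p t x \<in> borel_measurable \<mu>"
  proof -
    have "(\<lambda>y. enn2real (ennreal (p t x y))) \<in> borel_measurable \<mu>" using p_measurable[OF t] by measurable
    then show ?thesis using p_nonneg[OF t] by simp
  qed
  have B': "B \<in> sets \<mu>" using B sets_\<mu> by simp
  have Bi: "(\<lambda>y. indicator B y * p t x y) \<in> borel_measurable \<mu>" using pm B' by measurable
  have "emeasure (P x) {\<omega> \<in> space (P x). X t \<omega> \<in> B} = emeasure (P x) (X t -` B \<inter> space (P x))"
    by (rule arg_cong[where f = "emeasure (P x)"]) auto
  also have "\<dots> = (\<integral>\<^sup>+y. ennreal (p t x y) * indicator B y \<partial>\<mu>)"
    by (rule distributed_emeasure[OF D B'])
  also have "\<dots> = (\<integral>\<^sup>+y. ennreal (indicator B y * p t x y) \<partial>\<mu>)"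
    by (intro nn_integral_cong) (simp add: indicator_def)
  finally have eq: "emeasure (P x) {\<omega> \<in> space (P x). X t \<omega> \<in> B} = (\<integral>\<^sup>+y. ennreal (indicator B y * p t x y) \<partial>\<mu>)" .
  have "(LINT y:B|\<mu>. p t x y) = enn2real (\<integral>\<^sup>+y. ennreal (indicator B y * p t x y) \<partial>\<mu>)"
    unfolding set_lebesgue_integral_def using Bi p_nonneg[OF t]
    by (subst integral_eq_nn_integral[symmetric]) (auto simp: indicator_def)
  then show ?thesis by (simp add: eq[symmetric] measure_def)
qed

lemma prob_measurable:
  assumes t: "0 \<le> t" and B: "B \<in> sets borel"
  shows "(\<lambda>x. measure (P x) {\<omega> \<in> space (P x). X t \<omega> \<in> B}) \<in> borel_measurable borel"
proof -
  have "step t (indicator B) x = emeasure (P x) {\<omega> \<in> space (P x). X t \<omega> \<in> B}" for x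
  proof -
    note [measurable] = B X_measurable[OF t, of x]
    have "step t (indicator B) x = (\<integral>\<^sup>+\<omega>. indicator {\<omega> \<in> space (P x). X t \<omega> \<in> B} \<omega> \<partial>P x)"
      unfolding step_def by (intro nn_integral_cong) (auto simp: indicator_def)
    then show ?thesis by simp
  qed
  then have "measure (P x) {\<omega> \<in> space (P x). X t \<omega> \<in> B} = enn2real (step t (indicator B) x)" for x
    by (simp add: measure_def)
  then show ?thesis using step_measurable[OF t, of "indicator B"] B by simp
qed

lemma transition_between_le:
  assumes t: "0 < t" and A: "A \<in> sets borel" "emeasure \<mu> A < \<infinity>" and B: "B \<in> sets borel" and M: "0 \<le> M"
    "\<And>x. x \<in> A \<Longrightarrow> measure (P x) {\<omega> \<in> space (P x). X t \<omega> \<in> B} \<le> M"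
  shows "transition_between \<mu> p t A B \<le> M * measure \<mu> A"
proof -
  have A': "A \<in> sets \<mu>" using A sets_\<mu> by simp
  have "(\<integral>x. indicator A x * measure (P x) {\<omega> \<in> space (P x). X t \<omega> \<in> B} \<partial>\<mu>) \<le> (\<integral>x. indicator A x * M \<partial>\<mu>)"
  proof (rule integral_mono')
    show "integrable \<mu> (\<lambda>x. indicator A x * M)"
      using A A' by (intro integrable_mult_left integrable_real_indicator) auto
  qed (use M in \<open>auto simp: indicator_def\<close>)
  also have "\<dots> = M * measure \<mu> A" using A' space_\<mu> by simp
  finally show ?thesis
    unfolding transition_between_def set_lebesgue_integral_def[of \<mu> A] using transition_prob[OF t B] by simp
qed

text \<open>Lower bounds for the transition probabilities will be available only from a part
  \<open>A0\<close> of \<open>A\<close>; the rest contributes a nonnegative amount.\<close>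

lemma transition_between_ge:
  assumes t: "0 < t" and A: "A \<in> sets borel" "emeasure \<mu> A < \<infinity>" and B: "B \<in> sets borel"
    and A0: "A0 \<in> sets borel" "A0 \<subseteq> A"
    and m: "\<And>x. x \<in> A0 \<Longrightarrow> m \<le> measure (P x) {\<omega> \<in> space (P x). X t \<omega> \<in> B}"
  shows "m * measure \<mu> A0 \<le> transition_between \<mu> p t A B"
proof -
  have A': "A \<in> sets \<mu>" "A0 \<in> sets \<mu>" using A A0 sets_\<mu> by auto
  have A0fin: "emeasure \<mu> A0 < \<infinity>" using A A' A0 emeasure_mono[OF A0(2), of \<mu>] by auto
  have g: "(\<lambda>x. measure (P x) {\<omega> \<in> space (P x). X t \<omega> \<in> B}) \<in> borel_measurable \<mu>"
    using prob_measurable[OF less_imp_le[OF t] B] measurable_cong_sets[OF sets_\<mu> refl] by blast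
  have "(\<integral>x. indicator A0 x * m \<partial>\<mu>) \<le> (\<integral>x. indicator A x * measure (P x) {\<omega> \<in> space (P x). X t \<omega> \<in> B} \<partial>\<mu>)"
  proof (rule integral_mono)
    show "integrable \<mu> (\<lambda>x. indicator A0 x * m)"
      using A0fin A' by (intro integrable_mult_left integrable_real_indicator) auto
    show "integrable \<mu> (\<lambda>x. indicator A x * measure (P x) {\<omega> \<in> space (P x). X t \<omega> \<in> B})"
    proof (rule Bochner_Integration.integrable_bound[where f = "indicator A :: 'a \<Rightarrow> real"])
      show "integrable \<mu> (indicator A :: 'a \<Rightarrow> real)" using A A' by (intro integrable_real_indicator) auto
      show "AE x in \<mu>. norm (indicator A x * measure (P x) {\<omega> \<in> space (P x). X t \<omega> \<in> B}) \<le> norm (indicator A x :: real)"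
        using prob_space.prob_le_1[OF prob_space_P] by (intro AE_I2) (auto simp: indicator_def)
    qed (use g A' in measurable)
    show "indicator A0 x * m \<le> indicator A x * measure (P x) {\<omega> \<in> space (P x). X t \<omega> \<in> B}" for x
      using m A0 by (auto simp: indicator_def)
  qed
  moreover have "(\<integral>x. indicator A0 x * m \<partial>\<mu>) = m * measure \<mu> A0" using A' space_\<mu> by simp
  ultimately have "m * measure \<mu> A0 \<le> (\<integral>x. indicator A x * measure (P x) {\<omega> \<in> space (P x). X t \<omega> \<in> B} \<partial>\<mu>)"
    by (simp only:)
  then show ?thesis
    unfolding transition_between_def set_lebesgue_integral_def[of \<mu> A] using transition_prob[OF t B] by simp
qed

text \<open>With \<open>r0\<close> half the distance and \<open>r = r0 / n\<close>,
  \<open>escape_probability\<close> gives the bound exp(\<kappa> t n^\<beta> / r0^\<beta> - n l).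
  The positive term is at most half the negative one as long as n^(\<beta>-1) \<le> r0^\<beta> l /
  (2 \<kappa> t), which leads to n of order t^(-\<gamma>).\<close>

lemma upper_bound:
  shows "\<exists>c>0. \<forall>A\<in>sets \<mu>. \<forall>B\<in>sets \<mu>.
            0 < emeasure \<mu> A \<and> emeasure \<mu> A < \<infinity> \<and> 0 < emeasure \<mu> B \<and> emeasure \<mu> B < \<infinity> \<longrightarrow>
            Limsup (at_right 0)
              (\<lambda>t. ereal (t powr (1 / (\<beta> - 1))) * elog (transition_between \<mu> p t A B))
            \<le> ereal (- c * setdist A B powr (\<beta> / (\<beta> - 1)))"
proof -
  define \<gamma> where "\<gamma> = 1 / (\<beta> - 1)"
  define l where "l = - ln \<rho>"
  define \<kappa> where "\<kappa> = 2 * C * 2 powr \<beta>"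
  have \<gamma>: "0 < \<gamma>" and \<gamma>\<beta>: "\<gamma> * (\<beta> - 1) = 1" "\<beta> / (\<beta> - 1) = \<beta> * \<gamma>" using \<beta> by (auto simp: \<gamma>_def)
  have l: "0 < l" using rho by (simp add: l_def)
  have \<kappa>: "0 < \<kappa>" using C by (simp add: \<kappa>_def)
  define c where "c = l / 2 * (l / (2 * \<kappa>)) powr \<gamma> * (1/2) powr (\<beta> * \<gamma>)"
  have c: "0 < c" using l \<kappa> by (simp add: c_def)
  have "Limsup (at_right 0) (\<lambda>t. ereal (t powr \<gamma>) * elog (transition_between \<mu> p t A B))
     \<le> ereal (- (c * setdist A B powr (\<beta> * \<gamma>)))"
    if A: "A \<in> sets \<mu>" "0 < emeasure \<mu> A" "emeasure \<mu> A < \<infinity>" and B: "B \<in> sets \<mu>" for A B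
  proof -
    have A': "A \<in> sets borel" and B': "B \<in> sets borel" using A B sets_\<mu> by auto
    have mA: "0 < measure \<mu> A" using A by (simp add: measure_def enn2real_positive_iff)
    show ?thesis
    proof (cases "setdist A B = 0")
      \<comment> \<open>At distance 0 only a bound independent of \<open>t\<close> is needed, and
        the measure of \<open>A\<close> is one.\<close>
      case True
      have "Limsup (at_right 0) (\<lambda>t. ereal (t powr \<gamma>) * elog (transition_between \<mu> p t A B)) \<le> ereal (- 0)"
      proof (rule Limsup_elog_le[OF \<gamma>])
        have "\<forall>\<^sub>F t::real in at_right 0. 0 < t" by (simp add: eventually_at_right_less)
        then show "\<forall>\<^sub>F t in at_right 0. transition_between \<mu> p t A B \<le> exp (ln (measure \<mu> A) - 0 * t powr (- \<gamma>))"
        proof eventually_elim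
          case (elim t)
          then show ?case
            using transition_between_le[OF elim A' A(3) B', of 1] prob_space.prob_le_1[OF prob_space_P] mA by simp
        qed
      qed
      then show ?thesis using True by simp
    next
      case False
      then have d: "0 < setdist A B" using setdist_pos_le[of A B] by linarith
      define r0 where "r0 = setdist A B / 2"
      have r0: "0 < r0" using d by (simp add: r0_def)
      \<comment> \<open>The largest \<open>b\<close> for which
        \<open>n \<le> b * t powr (- \<gamma>)\<close> guarantees that \<open>rate r * t\<close> is
        at most \<open>n * l / 2\<close>.\<close>
      define b where "b = (r0 powr \<beta> * l / (2 * \<kappa>)) powr \<gamma>"
      have b: "0 < b" using r0 l \<kappa> by (simp add: b_def)
      have bpow: "b powr (\<beta> - 1) = r0 powr \<beta> * l / (2 * \<kappa>)"
        unfolding b_def using r0 l \<kappa> \<gamma>\<beta> by (simp add: powr_powr)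
      have Ldef: "l / 2 * b = c * setdist A B powr (\<beta> * \<gamma>)"
      proof -
        have "b = (r0 powr \<beta>) powr \<gamma> * (l / (2 * \<kappa>)) powr \<gamma>"
          unfolding b_def using r0 l \<kappa> by (simp add: powr_mult[symmetric])
        also have "(r0 powr \<beta>) powr \<gamma> = setdist A B powr (\<beta> * \<gamma>) * (1/2) powr (\<beta> * \<gamma>)"
          unfolding r0_def using d by (simp add: powr_powr powr_mult[symmetric])
        finally show ?thesis by (simp add: c_def)
      qed
      have "Limsup (at_right 0) (\<lambda>t. ereal (t powr \<gamma>) * elog (transition_between \<mu> p t A B)) \<le> ereal (- (l / 2 * b))"
      proof (rule Limsup_elog_le[OF \<gamma>])
        have e1: "\<forall>\<^sub>F t::real in at_right 0. 0 < t" by (simp add: eventually_at_right_less)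
        have "filterlim (\<lambda>t. b * t powr (- \<gamma>)) at_top (at_right 0)" using b \<gamma> by real_asymp
        \<comment> \<open>The summand 1 absorbs rounding down to \<open>n\<close>; then
          \<open>n > r0 / R\<close>, which ensures \<open>r < R\<close>.\<close>
        then have e2: "\<forall>\<^sub>F t in at_right 0. r0 / R + 1 < b * t powr (- \<gamma>)"
          by (rule filterlim_at_top_dense[THEN iffD1, rule_format])
        show "\<forall>\<^sub>F t in at_right 0. transition_between \<mu> p t A B \<le> exp (ln (measure \<mu> A) + l / 2 - l / 2 * b * t powr (- \<gamma>))"
          using e1 e2
        proof eventually_elim
          case (elim t)
          define Y where "Y = b * t powr (- \<gamma>)"
          define n where "n = nat \<lfloor>Y\<rfloor>"
          have Y: "0 < Y" using b elim by (simp add: Y_def)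
          have n: "real n \<le> Y" "Y - 1 \<le> real n" unfolding n_def using Y by (simp_all add: of_nat_nat)
          have "r0 / R < real n" using n elim unfolding Y_def by linarith
          moreover have "0 < r0 / R" using r0 R by simp
          ultimately have n0: "0 < real n" by linarith
          with \<open>r0 / R < real n\<close> have rn: "r0 / real n < R"
            using R by (simp add: divide_less_eq mult.commute)
          define r where "r = r0 / real n"
          have r: "0 < r" "r < R" "real n * r = r0" using n0 rn r0 by (auto simp: r_def)
          have "rate r * t \<le> real n * (l / 2)"
          proof -
            have Ypow: "Y powr (\<beta> - 1) = b powr (\<beta> - 1) / t"
            proof -
              have "(t powr (- \<gamma>)) powr (\<beta> - 1) = t powr (- 1)"
                using \<gamma>\<beta>(1) by (simp add: powr_powr)
              moreover have "(b * t powr (- \<gamma>)) powr (\<beta> - 1) = b powr (\<beta> - 1) * (t powr (- \<gamma>)) powr (\<beta> - 1)"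
                by (rule powr_mult)
              moreover have "t powr (- 1) = 1 / t" using elim by (simp add: powr_minus_divide)
              ultimately show ?thesis unfolding Y_def by simp
            qed
            have "real n powr (\<beta> - 1) \<le> Y powr (\<beta> - 1)" using n n0 \<beta> by (intro powr_mono2) auto
            also have "\<dots> = r0 powr \<beta> * l / (2 * \<kappa>) / t" unfolding Ypow bpow ..
            finally have h: "real n powr (\<beta> - 1) \<le> r0 powr \<beta> * l / (2 * \<kappa>) / t" .
            have "rate r * t = \<kappa> * t / r0 powr \<beta> * real n powr \<beta>"
              using r0 n0 by (simp add: rate_def \<kappa>_def r_def powr_divide)
            also have "real n powr \<beta> = real n * real n powr (\<beta> - 1)"
              using n0 by (simp add: powr_diff)
            also have "\<kappa> * t / r0 powr \<beta> * (real n * real n powr (\<beta> - 1))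
              \<le> \<kappa> * t / r0 powr \<beta> * (real n * (r0 powr \<beta> * l / (2 * \<kappa>) / t))"
              using \<kappa> elim by (intro mult_left_mono h) auto
            also have "\<dots> = real n * (l / 2)" using \<kappa> elim r0 by (simp add: field_simps)
            finally show ?thesis .
          qed
          moreover have "\<rho> ^ n = exp (- (real n * l))"
          proof -
            have "\<rho> ^ n = exp (ln \<rho>) ^ n" using rho by simp
            also have "\<dots> = exp (real n * ln \<rho>)" by (rule exp_of_nat_mult[symmetric])
            finally show ?thesis by (simp add: l_def)
          qed
          ultimately have le: "exp (rate r * t) * \<rho> ^ n \<le> exp (- (real n * (l / 2)))"
            by (simp add: exp_add[symmetric])
          have "real n * (l / 2) \<ge> (Y - 1) * (l / 2)" using n l by (intro mult_right_mono) auto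
          then have "exp (- (real n * (l / 2))) \<le> exp (l / 2 - l / 2 * Y)" by (simp add: algebra_simps)
          with le have M: "exp (rate r * t) * \<rho> ^ n \<le> exp (l / 2 - l / 2 * Y)" by linarith
          have "transition_between \<mu> p t A B \<le> exp (l / 2 - l / 2 * Y) * measure \<mu> A"
          proof (rule transition_between_le[OF elim(1) A' A(3) B'])
            fix x assume x: "x \<in> A"
            have "B \<inter> cball x (real n * r) = {}"
            proof -
              have "y \<notin> cball x r0" if "y \<in> B" for y
                using setdist_le_dist[OF x that] d by (simp add: r0_def)
              then show ?thesis using r by blast
            qed
            from escape_probability[OF r(1,2) less_imp_le[OF elim(1)] B' this]
            show "measure (P x) {\<omega> \<in> space (P x). X t \<omega> \<in> B} \<le> exp (l / 2 - l / 2 * Y)" using M by linarith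
          qed simp
          also have "\<dots> = exp (ln (measure \<mu> A) + l / 2 - l / 2 * b * t powr (- \<gamma>))"
          proof -
            have "exp (ln (measure \<mu> A) + l / 2 - l / 2 * b * t powr (- \<gamma>)) = exp (ln (measure \<mu> A) + (l / 2 - l / 2 * Y))"
              by (simp add: Y_def mult.assoc)
            also have "\<dots> = measure \<mu> A * exp (l / 2 - l / 2 * Y)" using mA by (simp only: exp_add exp_ln)
            finally show ?thesis by simp
          qed
          finally show ?case .
        qed
      qed
      then show ?thesis unfolding Ldef .
    qed
  qed
  then show ?thesis
    unfolding \<gamma>\<beta>(2) \<gamma>_def[symmetric] using c by (intro exI[of _ c]) simp
qed

end

section \<open>Symmetry and Harnack comparison of Green functions\<close>

context heat_kernel_diffusion
begin

lemma sigma_finite_\<mu>: "sigma_finite_measure \<mu>"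
proof
  obtain \<eta> where \<eta>: "\<And>z::'a. \<eta> z > 0" "\<And>z. compact (cball z (\<eta> z))"
    using locally_compact_small_cball[OF locally_compact] by metis
  obtain B where B: "countable B" "B \<subseteq> range (\<lambda>z. ball z (\<eta> z))" "\<Union>B = \<Union>(range (\<lambda>z. ball z (\<eta> z)))"
    using Lindelof[of "range (\<lambda>z. ball z (\<eta> z))"] by (metis (no_types, lifting) imageE open_ball)
  have "emeasure \<mu> (ball z (\<eta> z)) \<noteq> \<infinity>" for z
  proof -
    have "emeasure \<mu> (ball z (\<eta> z)) \<le> emeasure \<mu> (cball z (\<eta> z))"
      using sets_\<mu> by (intro emeasure_mono) auto
    also have "\<dots> < \<infinity>" using radon \<eta>(2) unfolding radon_measure_def by blast
    finally show ?thesis by simp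
  qed
  then show "\<exists>A. countable A \<and> A \<subseteq> sets \<mu> \<and> \<Union>A = space \<mu> \<and> (\<forall>a\<in>A. emeasure \<mu> a \<noteq> \<infinity>)"
    using B \<eta>(1) sets_\<mu> space_\<mu> by (intro exI[of _ B]) auto
qed

section \<open>Symmetry of the killed semigroup and of its resolvent\<close>

lemma step_density:
  assumes t: "0 < t" and f: "f \<in> borel_measurable borel"
  shows "step t f x = (\<integral>\<^sup>+y. ennreal (p t x y) * f y \<partial>\<mu>)"
proof -
  have D: "distributed (P x) \<mu> (X t) (\<lambda>y. ennreal (p t x y))"
    using density t unfolding transition_density_def by blast
  show ?thesis
    unfolding step_def using distributed_nn_integral[OF D, of f] f by (simp add: borel_measurable_\<mu>)
qed

lemma step_symmetric:
  assumes t: "0 < t" and f: "f \<in> borel_measurable borel" and g: "g \<in> borel_measurable borel"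
  shows "(\<integral>\<^sup>+x. g x * step t f x \<partial>\<mu>) = (\<integral>\<^sup>+x. f x * step t g x \<partial>\<mu>)"
proof -
  interpret sigma_finite_measure \<mu> by (rule sigma_finite_\<mu>)
  interpret pair_sigma_finite \<mu> \<mu> ..
  have [measurable]: "f \<in> borel_measurable \<mu>" "g \<in> borel_measurable \<mu>"
    using f g by (simp_all add: borel_measurable_\<mu>)
  have pm [measurable]: "(\<lambda>(x, y). p t x y) \<in> borel_measurable (\<mu> \<Otimes>\<^sub>M \<mu>)"
    using density t unfolding transition_density_def by blast
  have sym: "p t x y = p t y x" for x y using density t unfolding transition_density_def by blast
  have sec [measurable]: "(\<lambda>y. ennreal (p t x y)) \<in> borel_measurable \<mu>" for x by (rule p_measurable[OF t])
  have "(\<integral>\<^sup>+x. g x * step t f x \<partial>\<mu>) = (\<integral>\<^sup>+x. (\<integral>\<^sup>+y. g x * (ennreal (p t x y) * f y) \<partial>\<mu>) \<partial>\<mu>)"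
    unfolding step_density[OF t f] by (intro nn_integral_cong nn_integral_cmult[symmetric]) measurable
  also have "\<dots> = (\<integral>\<^sup>+y. (\<integral>\<^sup>+x. g x * (ennreal (p t x y) * f y) \<partial>\<mu>) \<partial>\<mu>)"
    by (rule Fubini'[symmetric]) measurable
  also have "\<dots> = (\<integral>\<^sup>+y. (\<integral>\<^sup>+x. f y * (ennreal (p t y x) * g x) \<partial>\<mu>) \<partial>\<mu>)"
    by (simp add: sym mult_ac)
  also have "\<dots> = (\<integral>\<^sup>+y. f y * step t g y \<partial>\<mu>)"
    unfolding step_density[OF t g] by (intro nn_integral_cong nn_integral_cmult) measurable
  finally show ?thesis .
qed

lemma chain_Suc_right:
  "chain \<phi> h (Suc N) f = chain \<phi> h N (step h (\<lambda>z. \<phi> z * f z))"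
  by (induction N) simp_all

text \<open>Each induction step moves one transition operator to the other function by
  \<open>step_symmetric\<close>, and \<open>chain_Suc_right\<close> recognises the result as a chain
  that has grown at its other end.\<close>

lemma chain_symmetric:
  assumes h: "0 < h" and \<phi>: "\<phi> \<in> borel_measurable borel"
    and f: "f \<in> borel_measurable borel" and g: "g \<in> borel_measurable borel"
  shows "(\<integral>\<^sup>+x. g x * chain \<phi> h N f x \<partial>\<mu>) = (\<integral>\<^sup>+x. f x * chain \<phi> h N g x \<partial>\<mu>)"
  using f g
proof (induction N arbitrary: f g)
  case 0
  then show ?case by (simp add: mult_ac)
next
  case (Suc N)
  note [measurable] = \<phi> Suc.prems
  have h0: "0 \<le> h" using h by simp
  have pg [measurable]: "(\<lambda>z. \<phi> z * g z) \<in> borel_measurable borel" by measurable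
  have sg: "step h (\<lambda>z. \<phi> z * g z) \<in> borel_measurable borel" by (rule step_measurable[OF h0 pg])
  have "(\<integral>\<^sup>+x. g x * chain \<phi> h (Suc N) f x \<partial>\<mu>) = (\<integral>\<^sup>+x. (\<phi> x * g x) * step h (chain \<phi> h N f) x \<partial>\<mu>)"
    by (simp add: mult_ac)
  also have "\<dots> = (\<integral>\<^sup>+x. chain \<phi> h N f x * step h (\<lambda>z. \<phi> z * g z) x \<partial>\<mu>)"
    by (rule step_symmetric[OF h chain_measurable[OF h0 \<phi> Suc.prems(1)] pg])
  also have "\<dots> = (\<integral>\<^sup>+x. step h (\<lambda>z. \<phi> z * g z) x * chain \<phi> h N f x \<partial>\<mu>)"
    by (simp add: mult.commute)
  also have "\<dots> = (\<integral>\<^sup>+x. f x * chain \<phi> h N (step h (\<lambda>z. \<phi> z * g z)) x \<partial>\<mu>)"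
    by (rule Suc.IH[OF Suc.prems(1) sg])
  finally show ?case unfolding chain_Suc_right[symmetric] .
qed

text \<open>The limit of \<open>chain_symmetric\<close> along the grids. The measure may be
  infinite, so domination combines the bound on one function with the integrability of the
  other.\<close>

lemma surv_symmetric:
  assumes s: "0 < s" and K: "closed K" "K \<noteq> {}"
    and f: "f \<in> borel_measurable borel" "\<And>z. f z \<le> c" "(\<integral>\<^sup>+x. ennreal (f x) \<partial>\<mu>) < \<infinity>"
    and g: "g \<in> borel_measurable borel" "\<And>z. g z \<le> c" "(\<integral>\<^sup>+x. ennreal (g x) \<partial>\<mu>) < \<infinity>"
  shows "(\<integral>\<^sup>+x. ennreal (g x) * surv K s f x \<partial>\<mu>) = (\<integral>\<^sup>+x. ennreal (f x) * surv K s g x \<partial>\<mu>)"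
proof -
  have s0: "0 \<le> s" and h: "0 < s / real (Suc n)" for n using s by simp_all
  have lim: "(\<lambda>n. \<integral>\<^sup>+x. ennreal (g x) * grid K s n f x \<partial>\<mu>) \<longlonglongrightarrow> (\<integral>\<^sup>+x. ennreal (g x) * surv K s f x \<partial>\<mu>)"
    if f: "f \<in> borel_measurable borel" "\<And>z. f z \<le> c"
      and g: "g \<in> borel_measurable borel" "(\<integral>\<^sup>+x. ennreal (g x) \<partial>\<mu>) < \<infinity>" for f g
  proof (rule nn_integral_dominated_convergence[where w = "\<lambda>x. ennreal (g x) * ennreal c"])
    have gm [measurable]: "(\<lambda>x. ennreal (g x)) \<in> borel_measurable \<mu>" using g(1) by (simp add: borel_measurable_\<mu>)
    show "(\<lambda>x. ennreal (g x) * grid K s n f x) \<in> borel_measurable \<mu>" for n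
      using grid_measurable[OF s0 f(1), of K n] g(1) by (simp add: borel_measurable_\<mu> del: chain.simps)
    show "(\<lambda>x. ennreal (g x) * surv K s f x) \<in> borel_measurable \<mu>"
      using surv_measurable[OF s0 K f] g(1) by (simp add: borel_measurable_\<mu>)
    show "(\<lambda>x. ennreal (g x) * ennreal c) \<in> borel_measurable \<mu>" by measurable
    show "(\<integral>\<^sup>+x. ennreal (g x) * ennreal c \<partial>\<mu>) < \<infinity>"
      using g(2) by (simp add: nn_integral_multc ennreal_mult_less_top)
    show "AE x in \<mu>. ennreal (g x) * grid K s n f x \<le> ennreal (g x) * ennreal c" for n
      by (intro AE_I2 mult_left_mono grid_le s0 f) auto
    have "surv K s f z \<noteq> \<top>" for z using surv_le[of f c K s z] f(2) by (auto simp: top_unique)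
    then show "AE x in \<mu>. (\<lambda>n. ennreal (g x) * grid K s n f x) \<longlonglongrightarrow> ennreal (g x) * surv K s f x"
      by (intro AE_I2 tendsto_mult_ennreal tendsto_const grid_LIMSEQ[OF s0 K f]) auto
  qed
  have eq: "(\<integral>\<^sup>+x. ennreal (g x) * grid K s n f x \<partial>\<mu>) = (\<integral>\<^sup>+x. ennreal (f x) * grid K s n g x \<partial>\<mu>)" for n
    by (rule chain_symmetric[OF h]) (use f(1) g(1) in measurable)
  show ?thesis
    using LIMSEQ_unique[OF lim[OF f(1,2) g(1,3), unfolded eq] lim[OF g(1,2) f(1,3)]] .
qed

lemma resolv_symmetric:
  fixes f g :: "'a \<Rightarrow> real"
  assumes K: "closed K" "K \<noteq> {}"
    and f: "continuous_on UNIV f" "\<And>z. f z \<le> c" "(\<integral>\<^sup>+x. ennreal (f x) \<partial>\<mu>) < \<infinity>"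
    and g: "continuous_on UNIV g" "\<And>z. g z \<le> c" "(\<integral>\<^sup>+x. ennreal (g x) \<partial>\<mu>) < \<infinity>"
  shows "(\<integral>\<^sup>+x. ennreal (g x) * resolv K l f x \<partial>\<mu>) = (\<integral>\<^sup>+x. ennreal (f x) * resolv K l g x \<partial>\<mu>)"
proof -
  interpret sigma_finite_measure \<mu> by (rule sigma_finite_\<mu>)
  interpret pair_sigma_finite \<mu> lborel ..
  have swap: "(\<integral>\<^sup>+x. ennreal (g x) * resolv K l f x \<partial>\<mu>) =
      (\<integral>\<^sup>+s. indicator {0<..} s * (ennreal (exp (- l * s)) * (\<integral>\<^sup>+x. ennreal (g x) * surv K s f x \<partial>\<mu>)) \<partial>lborel)"
    if f: "continuous_on UNIV f" "\<And>z. f z \<le> c" and g: "continuous_on UNIV g" for f g :: "'a \<Rightarrow> real"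
  proof -
    have gm: "g \<in> borel_measurable \<mu>" using borel_measurable_continuous_onI[OF g] by (simp add: borel_measurable_\<mu>)
    have jm: "(\<lambda>(z, s). indicator {0<..} s * (ennreal (exp (- l * s)) * surv K s f z))
      \<in> borel_measurable (\<mu> \<Otimes>\<^sub>M lborel)"
      using resolv_joint_measurable[OF K f(1), of c l] f(2) sets_\<mu>
      by (simp cong: measurable_cong_sets sets_pair_measure_cong)
    have sec: "(\<lambda>s. indicator {0<..} s * (ennreal (exp (- l * s)) * surv K s f z)) \<in> borel_measurable lborel" for z
      using measurable_compose[OF measurable_Pair[OF measurable_const measurable_ident] jm, of z] space_\<mu> by simp
    have fm: "f \<in> borel_measurable borel" by (rule borel_measurable_continuous_onI[OF f(1)])
    have sm: "surv K s f \<in> borel_measurable \<mu>" if "0 < s" for s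
      using surv_measurable[OF less_imp_le[OF that] K fm f(2)] by (simp add: borel_measurable_\<mu>)
    have "(\<integral>\<^sup>+x. ennreal (g x) * resolv K l f x \<partial>\<mu>) =
      (\<integral>\<^sup>+x. (\<integral>\<^sup>+s. ennreal (g x) * (indicator {0<..} s * (ennreal (exp (- l * s)) * surv K s f x)) \<partial>lborel) \<partial>\<mu>)"
      unfolding resolv_def by (intro nn_integral_cong nn_integral_cmult[symmetric] sec)
    also have "\<dots> = (\<integral>\<^sup>+s. (\<integral>\<^sup>+x. ennreal (g x) * (indicator {0<..} s * (ennreal (exp (- l * s)) * surv K s f x)) \<partial>\<mu>) \<partial>lborel)"
    proof (rule Fubini'[symmetric])
      have "(\<lambda>w. ennreal (g (fst w)) * (case w of (z, s) \<Rightarrow> indicator {0<..} s * (ennreal (exp (- l * s)) * surv K s f z)))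
        \<in> borel_measurable (\<mu> \<Otimes>\<^sub>M lborel)"
        using jm measurable_compose[OF measurable_fst gm]
        by (intro borel_measurable_times_ennreal measurable_compose[OF _ measurable_ennreal])
      then show "(\<lambda>(x, s). ennreal (g x) * (indicator {0<..} s * (ennreal (exp (- l * s)) * surv K s f x)))
        \<in> borel_measurable (\<mu> \<Otimes>\<^sub>M lborel)" by (simp add: case_prod_beta')
    qed
    also have "\<dots> = (\<integral>\<^sup>+s. indicator {0<..} s * (ennreal (exp (- l * s)) * (\<integral>\<^sup>+x. ennreal (g x) * surv K s f x \<partial>\<mu>)) \<partial>lborel)"
    proof (rule nn_integral_cong)
      fix s :: real
      show "(\<integral>\<^sup>+x. ennreal (g x) * (indicator {0<..} s * (ennreal (exp (- l * s)) * surv K s f x)) \<partial>\<mu>)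
        = indicator {0<..} s * (ennreal (exp (- l * s)) * (\<integral>\<^sup>+x. ennreal (g x) * surv K s f x \<partial>\<mu>))"
      proof (cases "0 < s")
        case True
        note [measurable] = sm[OF True] gm
        have "(\<lambda>x. ennreal (g x) * surv K s f x) \<in> borel_measurable \<mu>" by measurable
        from nn_integral_cmult[OF this, of "ennreal (exp (- l * s))"] show ?thesis
          using True by (simp add: mult.left_commute)
      qed simp
    qed
    finally show ?thesis .
  qed
  have "(\<integral>\<^sup>+x. ennreal (g x) * surv K s f x \<partial>\<mu>) = (\<integral>\<^sup>+x. ennreal (f x) * surv K s g x \<partial>\<mu>)" if "0 < s" for s
    using f g by (intro surv_symmetric[OF that K, where c = c]) (auto intro!: borel_measurable_continuous_onI)
  then show ?thesis
    unfolding swap[OF f(1,2) g(1)] swap[OF g(1,2) f(1)]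
    by (intro nn_integral_cong) (auto simp: indicator_def)
qed

section \<open>Potentials are bounded, and harmonic off their source\<close>

lemma resolv_bounded:
  assumes r: "0 < r" "2 * r < R" and f: "\<And>z. f z \<le> c"
  shows "resolv (cball x r) 0 f z \<le> ennreal c * ennreal (C * (2 * r) powr \<beta>)"
proof -
  have jm: "(\<lambda>(z, s). indicator {0<..} s * (ennreal (exp (- 0 * s)) * surv (cball x r) s (\<lambda>_. 1) z)) \<in> borel_measurable (borel \<Otimes>\<^sub>M borel)"
    using resolv_joint_measurable[of "cball x r" "\<lambda>_. 1" 1 0] r by auto
  have sec: "(\<lambda>s. indicator {0<..} s * (ennreal (exp (- 0 * s)) * surv (cball x r) s (\<lambda>_. 1) z)) \<in> borel_measurable lborel"
    using measurable_compose[OF measurable_Pair1' jm, of z] by simp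
  have le: "surv (cball x r) s f z \<le> ennreal c * surv (cball x r) s (\<lambda>_. 1) z" if s: "0 < s" for s
  proof -
    have km: "killed (cball x r) (\<lambda>_. 1) 0 s \<in> borel_measurable (P z)"
      using killed_measurable[of s "\<lambda>_. 0"] s by simp
    have "surv (cball x r) s f z \<le> (\<integral>\<^sup>+\<omega>. ennreal c * killed (cball x r) (\<lambda>_. 1) 0 s \<omega> \<partial>P z)"
      unfolding surv_def using f by (intro nn_integral_mono) (auto simp: killed_def intro: ennreal_leI)
    also have "\<dots> = ennreal c * surv (cball x r) s (\<lambda>_. 1) z"
      unfolding surv_def by (rule nn_integral_cmult[OF km])
    finally show ?thesis .
  qed
  have "resolv (cball x r) 0 f z \<le> (\<integral>\<^sup>+s. ennreal c * (indicator {0<..} s * (ennreal (exp (- 0 * s)) * surv (cball x r) s (\<lambda>_. 1) z)) \<partial>lborel)"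
    unfolding resolv_def using le by (intro nn_integral_mono) (auto simp: indicator_def)
  also have "\<dots> = ennreal c * resolv (cball x r) 0 (\<lambda>_. 1) z"
    unfolding resolv_def by (rule nn_integral_cmult[OF sec])
  also have "\<dots> \<le> ennreal c * ennreal (C * (2 * r) powr \<beta>)"
    by (intro mult_left_mono resolv_cball_upper r) auto
  finally show ?thesis .
qed

lemma resolv_open_zero:
  assumes "\<And>z. z \<in> U \<Longrightarrow> f z = 0"
  shows "resolv U l f x = 0"
proof -
  have "surv U s f x = 0" if "0 < s" for s
  proof -
    have "killed U f 0 s = (\<lambda>_. 0)"
      using assms that by (auto simp: killed_0 stays_def fun_eq_iff)
    then show ?thesis unfolding surv_def by simp
  qed
  then have "(\<lambda>s. indicator {0<..} s * (ennreal (exp (- l * s)) * surv U s f x)) = (\<lambda>_. 0)"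
    by (auto simp: indicator_def fun_eq_iff)
  then show ?thesis unfolding resolv_def by simp
qed

text \<open>Dynkin's formula at \<open>l = 0\<close>, whose first term vanishes because
  \<open>f\<close> is 0 on \<open>U\<close>. Paths that never leave \<open>U\<close> count 0 both in
  \<open>discount\<close> and in \<open>exit_value\<close>.\<close>

lemma resolv_harmonic:
  assumes r: "0 < r" "2 * r < R" and f: "test_fun f" and U: "open U" "U \<subseteq> cball x r"
    and f0: "\<And>z. z \<in> U \<Longrightarrow> f z = 0"
  shows "harmonic_on P X (\<lambda>z. enn2real (resolv (cball x r) 0 f z)) U"
  unfolding harmonic_on_def
proof (intro conjI ballI)
  let ?h = "\<lambda>z. enn2real (resolv (cball x r) 0 f z)"
  obtain c where c: "0 \<le> c" "\<And>z. f z \<le> c" using test_fun_bounded[OF f] by blast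
  have K: "closed (cball x r)" "cball x r \<noteq> {}" using r by auto
  have "resolv (cball x r) 0 f \<in> borel_measurable borel"
    by (rule resolv_measurable[OF K test_fun_continuous[OF f] c(2)])
  then have hm: "?h \<in> borel_measurable borel" by measurable
  then show "?h \<in> borel_measurable (restrict_space borel (closure U))"
    by (rule measurable_restrict_space1)
  show "open U" by fact
  fix z assume z: "z \<in> U"
  have fin: "ennreal (?h y) = resolv (cball x r) 0 f y" for y
  proof -
    have "resolv (cball x r) 0 f y < \<top>"
      by (rule le_less_trans[OF resolv_bounded[OF r c(2)]]) (simp add: ennreal_mult_less_top)
    then show ?thesis by simp
  qed
  note [measurable] = exit_time_measurable[OF U(1), of z] X_etime_measurable[OF U(1), of z] hm
  have zero: "resolv U 0 f z = 0" by (rule resolv_open_zero) (rule f0)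
  show "has_bochner_integral (P z) (exit_value X ?h U) (?h z)"
  proof (rule has_bochner_integral_nn_integral)
    show "exit_value X ?h U \<in> borel_measurable (P z)"
      unfolding exit_value_def[abs_def] by measurable
    have "resolv (cball x r) 0 f z = resolv U 0 f z + (\<integral>\<^sup>+\<omega>. discount U 0 \<omega> * resolv (cball x r) 0 f (X (etime U \<omega>) \<omega>) \<partial>P z)"
      by (rule dynkin_eq[OF U(1) z _ K f U(2)]) simp
    also have "\<dots> = (\<integral>\<^sup>+\<omega>. ennreal (exit_value X ?h U \<omega>) \<partial>P z)"
      unfolding zero add_0
      by (intro nn_integral_cong) (auto simp: exit_value_def discount_def fin top.not_eq_extremum)
    finally show "(\<integral>\<^sup>+\<omega>. ennreal (exit_value X ?h U \<omega>) \<partial>P z) = ennreal (?h z)" unfolding fin ..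
  qed (auto simp: exit_value_def)
qed

end

locale harnack_diffusion = heat_kernel_diffusion P X \<beta> C R \<mu> p
  for P :: "'a::{metric_space, second_countable_topology} \<Rightarrow> 'w measure" and X :: "real \<Rightarrow> 'w \<Rightarrow> 'a"
    and \<beta> C R :: real and \<mu> :: "'a measure" and p :: "real \<Rightarrow> 'a \<Rightarrow> 'a \<Rightarrow> real" +
  fixes H :: real
  assumes geodesic: "geodesic_metric TYPE('a)" and H: "1 \<le> H"
    and harnack: "\<And>x r u. 0 < r \<Longrightarrow> harmonic_on P X u (ball x (2 * r)) \<Longrightarrow>
      (\<And>y. y \<in> closure (ball x (2 * r)) \<Longrightarrow> 0 \<le> u y) \<Longrightarrow>
      (SUP y\<in>ball x r. ereal (u y)) \<le> ereal H * (INF y\<in>ball x r. ereal (u y))"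
begin

section \<open>Harnack's inequality in pointwise form, and the bumps used as sources\<close>

lemma harnack_le:
  assumes "0 < r" "harmonic_on P X u (ball x (2 * r))" "\<And>y. 0 \<le> u y" "a \<in> ball x r" "b \<in> ball x r"
  shows "u a \<le> H * u b"
proof -
  have "ereal (u a) \<le> (SUP y\<in>ball x r. ereal (u y))" using assms by (intro SUP_upper)
  also have "\<dots> \<le> ereal H * (INF y\<in>ball x r. ereal (u y))" by (rule harnack) (use assms in auto)
  also have "\<dots> \<le> ereal H * ereal (u b)" using assms H by (intro ereal_mult_left_mono INF_lower) auto
  finally show ?thesis by simp
qed

text \<open>Local compactness provides compact balls whose radius depends on the centre without any
  uniformity, so the sources have varying widths; beyond compactness, the estimates use only that
  the width is positive and at most \<open>\<delta>\<close>.\<close>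

definition width :: "real \<Rightarrow> 'a \<Rightarrow> real" where
  "width \<delta> b = (SOME \<eta>. 0 < \<eta> \<and> \<eta> \<le> \<delta> \<and> compact (cball b \<eta>))"

lemma width:
  assumes "0 < \<delta>"
  shows "0 < width \<delta> b" "width \<delta> b \<le> \<delta>" "compact (cball b (width \<delta> b))"
proof -
  obtain \<eta> where \<eta>: "\<eta> > 0" "compact (cball b \<eta>)"
    using locally_compact_small_cball[OF locally_compact] by blast
  have "compact (cball b (min \<eta> \<delta>))"
  proof -
    have "cball b (min \<eta> \<delta>) = cball b \<eta> \<inter> cball b (min \<eta> \<delta>)" by auto
    then show ?thesis using compact_Int_closed[OF \<eta>(2) closed_cball] by metis
  qed
  then have "\<exists>\<eta>. 0 < \<eta> \<and> \<eta> \<le> \<delta> \<and> compact (cball b \<eta>)"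
    using \<eta> assms by (intro exI[of _ "min \<eta> \<delta>"]) auto
  from someI_ex[OF this] show "0 < width \<delta> b" "width \<delta> b \<le> \<delta>" "compact (cball b (width \<delta> b))"
    by (auto simp: width_def)
qed

definition source :: "real \<Rightarrow> 'a \<Rightarrow> 'a \<Rightarrow> real" where "source \<delta> b = tent b (width \<delta> b)"

lemma source_test: "0 < \<delta> \<Longrightarrow> test_fun (source \<delta> b)"
  unfolding source_def test_fun_def using tent_C0[OF width(3)] by simp

lemma source_le: "0 < \<delta> \<Longrightarrow> source \<delta> b z \<le> \<delta>"
  using width[of \<delta> b] zero_le_dist[of z b] unfolding source_def tent_def by linarith

lemma source_zero: "0 < \<delta> \<Longrightarrow> \<delta> \<le> dist z b \<Longrightarrow> source \<delta> b z = 0"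
  unfolding source_def tent_def using width[of \<delta> b] by simp

lemma source_pos_iff: "source \<delta> b z > 0 \<longleftrightarrow> z \<in> ball b (width \<delta> b)"
  by (auto simp: source_def tent_def dist_commute)

definition mass :: "real \<Rightarrow> 'a \<Rightarrow> ennreal" where "mass \<delta> b = (\<integral>\<^sup>+z. ennreal (source \<delta> b z) \<partial>\<mu>)"

text \<open>Full support makes the mass of a bump positive, and compactness of its closed ball makes
  it finite.\<close>

lemma mass:
  assumes "0 < \<delta>"
  shows "0 < mass \<delta> b" "mass \<delta> b < \<infinity>"
proof -
  have sm: "source \<delta> b \<in> borel_measurable \<mu>"
    using test_fun_measurable[OF source_test[OF assms]] by (simp add: borel_measurable_\<mu>)
  have b: "ball b (width \<delta> b) \<in> sets \<mu>" and cb: "cball b (width \<delta> b) \<in> sets \<mu>" using sets_\<mu> by auto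
  have "mass \<delta> b \<le> (\<integral>\<^sup>+z. ennreal \<delta> * indicator (cball b (width \<delta> b)) z \<partial>\<mu>)"
    unfolding mass_def
  proof (rule nn_integral_mono)
    fix z
    show "ennreal (source \<delta> b z) \<le> ennreal \<delta> * indicator (cball b (width \<delta> b)) z"
    proof (cases "z \<in> cball b (width \<delta> b)")
      case True
      then show ?thesis using source_le[OF assms] by (simp add: ennreal_leI)
    next
      case False
      then show ?thesis by (simp add: source_def tent_def dist_commute)
    qed
  qed
  also have "\<dots> < \<infinity>"
  proof -
    have "emeasure \<mu> (cball b (width \<delta> b)) < \<infinity>"
      using radon width(3)[OF assms] unfolding radon_measure_def by blast
    then show ?thesis using cb by (simp add: nn_integral_cmult_indicator ennreal_mult_less_top)
  qed
  finally show "mass \<delta> b < \<infinity>" .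
  show "0 < mass \<delta> b"
  proof (rule ccontr)
    assume "\<not> 0 < mass \<delta> b"
    then have "AE z in \<mu>. ennreal (source \<delta> b z) = 0"
      using sm unfolding mass_def by (subst nn_integral_0_iff_AE[symmetric]) auto
    then have "AE z in \<mu>. z \<notin> ball b (width \<delta> b)"
    proof eventually_elim
      case (elim z)
      then show ?case using source_pos_iff[of \<delta> b z] by (auto simp: ennreal_eq_0_iff)
    qed
    then have "emeasure \<mu> (ball b (width \<delta> b)) = 0"
      using b space_\<mu> by (subst (asm) AE_iff_measurable[OF b]) auto
    moreover have "0 < emeasure \<mu> (ball b (width \<delta> b))"
      using support width(1)[OF assms, of b] unfolding full_support_def by force
    ultimately show False by simp
  qed
qed

end

text \<open>Sources have width at most \<open>d\<close> and Harnack's inequality is applied in balls of radius \<open>2 * d\<close>.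
  Points at distance between \<open>16 * d\<close> and \<open>64 * d\<close> from \<open>y\<close> are compared; geodesics between them, with the
  Harnack balls around their points, stay inside the ball of radius \<open>256 * d\<close>.\<close>

locale green_ball = harnack_diffusion P X \<beta> C R \<mu> p H
  for P :: "'a::{metric_space, second_countable_topology} \<Rightarrow> 'w measure" and X :: "real \<Rightarrow> 'w \<Rightarrow> 'a"
    and \<beta> C R :: real and \<mu> :: "'a measure" and p :: "real \<Rightarrow> 'a \<Rightarrow> 'a \<Rightarrow> real" and H :: real +
  fixes y :: 'a and d :: real
  assumes d: "0 < d" "2 * (256 * d) < R"
begin

abbreviation "K \<equiv> cball y (256 * d)"

definition G :: "'a \<Rightarrow> 'a \<Rightarrow> real" where "G b z = enn2real (resolv K 0 (source d b) z)"

lemma K: "closed K" "K \<noteq> {}" using d by auto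

lemma G_eq: "resolv K 0 (source d b) z = ennreal (G b z)"
proof -
  have "resolv K 0 (source d b) z < \<top>"
    by (rule le_less_trans[OF resolv_bounded[OF _ d(2) source_le[OF d(1)]]])
       (use d in \<open>simp_all add: ennreal_mult_less_top\<close>)
  then show ?thesis by (simp add: G_def)
qed

lemma G_nonneg [simp]: "0 \<le> G b z" by (simp add: G_def)

text \<open>The potential is harmonic in the ball of radius \<open>2 * d\<close> around
  \<open>z\<close>: this ball lies in \<open>K\<close>, and its points keep distance
  \<open>d\<close> from \<open>b\<close>, where the source is 0.\<close>

lemma G_harnack:
  assumes z: "dist y z \<le> 200 * d" "3 * d \<le> dist z b" and a: "a \<in> ball z d" "a' \<in> ball z d"
  shows "G b a \<le> H * G b a'"
proof (rule harnack_le[OF d(1) _ _ a])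
  have "ball z (2 * d) \<subseteq> K"
  proof
    fix v assume "v \<in> ball z (2 * d)"
    then show "v \<in> K" using z dist_triangle[of y v z] d by simp
  qed
  moreover have "source d b v = 0" if "v \<in> ball z (2 * d)" for v
    using that z dist_triangle[of z b v] by (intro source_zero d(1)) simp
  ultimately show "harmonic_on P X (G b) (ball z (2 * d))"
    unfolding G_def[abs_def] using d by (intro resolv_harmonic source_test) auto
qed simp

text \<open>Symmetry of the resolvent is an identity between integrals against the two sources.
  Harnack's inequality, used once near \<open>a\<close> and once near \<open>b\<close>, replaces
  these means by point values, each time at the price of a factor \<open>H\<close>.\<close>

lemma G_symmetric:
  assumes a: "dist y a \<le> 200 * d" and b: "dist y b \<le> 200 * d" and ab: "3 * d \<le> dist a b"
  shows "ennreal (G b a) * mass d a \<le> ennreal (H\<^sup>2) * (ennreal (G a b) * mass d b)"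
proof -
  have H0: "0 \<le> H" using H by simp
  have m [measurable]: "(\<lambda>z. ennreal (source d c z)) \<in> borel_measurable \<mu>" for c
    using test_fun_measurable[OF source_test[OF d(1)]] by (simp add: borel_measurable_\<mu>)
  have Gm [measurable]: "(\<lambda>z. ennreal (G c z)) \<in> borel_measurable \<mu>" for c
    using resolv_measurable[OF K test_fun_continuous[OF source_test[OF d(1)]] source_le[OF d(1)], of 0 c]
    unfolding G_eq by (simp add: borel_measurable_\<mu>)
  have near: "ennreal (source d c z) * ennreal (G e v) \<le> ennreal (source d c z) * (ennreal H * ennreal (G e v'))"
    if "dist y c \<le> 200 * d" "3 * d \<le> dist c e" "v \<in> {c, z}" "v' \<in> {c, z}" for c e v v' z
  proof (cases "dist z c < d")
    case True
    then have "v \<in> ball c d" "v' \<in> ball c d" using that d by (auto simp: dist_commute)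
    then have "G e v \<le> H * G e v'" using G_harnack[of c e v v'] that by blast
    then have "ennreal (G e v) \<le> ennreal H * ennreal (G e v')"
      using H0 by (simp add: ennreal_mult'[symmetric] ennreal_leI)
    then show ?thesis by (rule mult_left_mono) simp
  qed (use source_zero[OF d(1)] in simp)
  have "ennreal (G b a) * mass d a = (\<integral>\<^sup>+z. ennreal (source d a z) * ennreal (G b a) \<partial>\<mu>)"
    unfolding mass_def by (simp add: nn_integral_multc mult.commute)
  also have "\<dots> \<le> (\<integral>\<^sup>+z. ennreal (source d a z) * (ennreal H * ennreal (G b z)) \<partial>\<mu>)"
    by (intro nn_integral_mono near a ab) auto
  also have "\<dots> = ennreal H * (\<integral>\<^sup>+z. ennreal (source d a z) * ennreal (G b z) \<partial>\<mu>)"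
    by (subst nn_integral_cmult[symmetric]) (auto simp: mult.left_commute)
  also have "(\<integral>\<^sup>+z. ennreal (source d a z) * ennreal (G b z) \<partial>\<mu>) = (\<integral>\<^sup>+z. ennreal (source d b z) * ennreal (G a z) \<partial>\<mu>)"
    unfolding G_eq[symmetric]
    using mass(2)[OF d(1)] unfolding mass_def
    by (intro resolv_symmetric[OF K, where c = d] test_fun_continuous source_test source_le d(1))
  also have "\<dots> \<le> (\<integral>\<^sup>+z. ennreal (source d b z) * (ennreal H * ennreal (G a b)) \<partial>\<mu>)"
    using ab by (intro nn_integral_mono near b) (auto simp: dist_commute)
  also have "\<dots> = ennreal H * (ennreal (G a b) * mass d b)"
    unfolding mass_def by (subst nn_integral_multc) (simp_all add: mult_ac)
  finally show ?thesis using H0 by (simp add: power2_eq_square ennreal_mult' mult.assoc mult_left_mono)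
qed

text \<open>A weighted average of the Green function of \<open>K\<close> over a small ball at
  \<open>b\<close>, which makes sense without any continuity of the density. With this normalisation
  \<open>G_symmetric\<close> becomes symmetry up to the factor \<open>H^2\<close>.\<close>

definition k :: "'a \<Rightarrow> 'a \<Rightarrow> real" where "k a b = G b a / enn2real (mass d b)"

lemma mass_real: "mass d b = ennreal (enn2real (mass d b))" "0 < enn2real (mass d b)"
  using mass[OF d(1), of b] by (auto simp: enn2real_positive_iff less_top)

lemma k_nonneg [simp]: "0 \<le> k a b" by (simp add: k_def)

lemma k_symmetric:
  assumes "dist y a \<le> 200 * d" "dist y b \<le> 200 * d" "3 * d \<le> dist a b"
  shows "k a b \<le> H\<^sup>2 * k b a"
proof -
  define ma mb where "ma = enn2real (mass d a)" and "mb = enn2real (mass d b)"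
  have m: "mass d a = ennreal ma" "mass d b = ennreal mb" "0 < ma" "0 < mb"
    using mass_real unfolding ma_def mb_def by auto
  have "ennreal (G b a * ma) \<le> ennreal (H\<^sup>2 * (G a b * mb))"
    using G_symmetric[OF assms] m by (simp add: ennreal_mult'[symmetric])
  then have "G b a * ma \<le> H\<^sup>2 * (G a b * mb)"
    using m by (subst (asm) ennreal_le_iff) auto
  then have "G b a / mb \<le> H\<^sup>2 * (G a b / ma)" using m by (simp add: field_simps)
  then show ?thesis by (simp add: k_def ma_def mb_def)
qed

lemma k_harnack:
  assumes "dist y z \<le> 200 * d" "3 * d \<le> dist z b" "a \<in> ball z d" "a' \<in> ball z d"
  shows "k a b \<le> H * k a' b"
  using divide_right_mono[OF G_harnack[OF assms], of "enn2real (mass d b)"] by (simp add: k_def)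

text \<open>A Harnack chain of 256 steps along a geodesic of length at most \<open>128 * d\<close>,
  so that each step has length at most \<open>d / 2\<close>.\<close>

lemma k_geodesic:
  assumes \<gamma>: "\<gamma> 0 = a" "\<gamma> (dist a a') = a'"
    "\<And>s t. s \<in> {0..dist a a'} \<Longrightarrow> t \<in> {0..dist a a'} \<Longrightarrow> dist (\<gamma> s) (\<gamma> t) = \<bar>s - t\<bar>"
    and L: "dist a a' \<le> 128 * d"
    and away: "\<And>t. t \<in> {0..dist a a'} \<Longrightarrow> dist y (\<gamma> t) \<le> 200 * d \<and> 3 * d \<le> dist (\<gamma> t) b"
  shows "k a b \<le> H ^ 256 * k a' b"
proof -
  define t where "t i = real i * (dist a a' / 256)" for i :: nat
  have t: "t i \<in> {0..dist a a'}" if "i \<le> 256" for i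
  proof -
    have "real i / 256 * dist a a' \<le> 1 * dist a a'" using that by (intro mult_right_mono) auto
    then show ?thesis by (simp add: t_def)
  qed
  have "k a b \<le> H ^ i * k (\<gamma> (t i)) b" if "i \<le> 256" for i
    using that
  proof (induction i)
    case 0
    then show ?case by (simp add: t_def \<gamma>)
  next
    case (Suc i)
    have "dist (\<gamma> (t i)) (\<gamma> (t (Suc i))) = \<bar>t i - t (Suc i)\<bar>" using Suc.prems by (intro \<gamma> t) auto
    also have "\<dots> = dist a a' / 256" by (simp add: t_def algebra_simps)
    also have "\<dots> < d" using L d by simp
    finally have st: "\<gamma> (t (Suc i)) \<in> ball (\<gamma> (t i)) d" by simp
    have "k (\<gamma> (t i)) b \<le> H * k (\<gamma> (t (Suc i))) b"
      using Suc.prems away[OF t[of i]] st d by (intro k_harnack[of "\<gamma> (t i)"]) auto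
    then have "H ^ i * k (\<gamma> (t i)) b \<le> H ^ i * (H * k (\<gamma> (t (Suc i))) b)"
      using H by (intro mult_left_mono) auto
    then show ?case using Suc by (simp add: mult.assoc mult.left_commute)
  qed
  from this[of 256] show ?thesis by (simp add: t_def \<gamma>)
qed

lemma geodesicE:
  fixes a a' :: 'a
  obtains \<gamma> where "\<gamma> 0 = a" "\<gamma> (dist a a') = a'"
    "\<And>s t. s \<in> {0..dist a a'} \<Longrightarrow> t \<in> {0..dist a a'} \<Longrightarrow> dist (\<gamma> s) (\<gamma> t) = \<bar>s - t\<bar>"
  using geodesic unfolding geodesic_metric_def by blast

text \<open>In the second case the pole moves from \<open>y\<close> to \<open>v\<close>, then to
  \<open>w\<close>, and back to \<open>y\<close>. Three changes of pole cost \<open>H^2\<close> each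
  and two chains cost \<open>H^256\<close> each, whence the exponent 518 = 3 * 2 + 2 * 256. The
  first case needs a single chain.\<close>

lemma k_compare:
  assumes v: "16 * d \<le> dist y v" "dist y v \<le> 64 * d" and w: "16 * d \<le> dist y w" "dist y w \<le> 64 * d"
  shows "k v y \<le> H ^ 518 * k w y"
proof -
  obtain \<gamma> where \<gamma>: "\<gamma> 0 = v" "\<gamma> (dist v w) = w"
    "\<And>s t. s \<in> {0..dist v w} \<Longrightarrow> t \<in> {0..dist v w} \<Longrightarrow> dist (\<gamma> s) (\<gamma> t) = \<bar>s - t\<bar>"
    using geodesicE[of v w] by blast
  have vw: "dist v w \<le> 128 * d" using v w dist_triangle[of v w y] by (simp add: dist_commute)
  have \<gamma>d: "dist v (\<gamma> t) = t" "dist (\<gamma> t) w = dist v w - t" if "t \<in> {0..dist v w}" for t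
    using \<gamma>(3)[of 0 t] \<gamma>(3)[of t "dist v w"] that \<gamma>(1,2) by auto
  show ?thesis
  proof (cases "\<forall>t\<in>{0..dist v w}. 4 * d \<le> dist (\<gamma> t) y")
    case True
    have "k v y \<le> H ^ 256 * k w y"
    proof (rule k_geodesic[OF \<gamma> vw])
      fix t assume t: "t \<in> {0..dist v w}"
      have "dist y (\<gamma> t) \<le> 64 * d + 128 * d"
        using dist_triangle[of y "\<gamma> t" v] \<gamma>d(1)[OF t] t v vw by auto
      then show "dist y (\<gamma> t) \<le> 200 * d \<and> 3 * d \<le> dist (\<gamma> t) y"
        using bspec[OF True t] d by simp
    qed auto
    also have "\<dots> \<le> H ^ 518 * k w y" using H by (intro mult_right_mono power_increasing) auto
    finally show ?thesis .
  next
    case False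
    then obtain t where t: "t \<in> {0..dist v w}" "dist (\<gamma> t) y < 4 * d" by force
    \<comment> \<open>The points \<open>v\<close>, \<open>y\<close> and \<open>w\<close> are nearly
      aligned, because the geodesic from \<open>v\<close> to \<open>w\<close> passes near
      \<open>y\<close>. Hence the geodesic from \<open>y\<close> to \<open>w\<close> keeps distance
      at least \<open>8 * d\<close> from \<open>v\<close>, and so does the one from \<open>v\<close>
      to \<open>y\<close> from \<open>w\<close>.\<close>
    have far: "dist y v + dist y w - 8 * d \<le> dist v w"
      using \<gamma>d[OF t(1)] t(2) dist_triangle[of y v "\<gamma> t"] dist_triangle[of y w "\<gamma> t"]
      by (simp add: dist_commute)
    have yw: "k y v \<le> H ^ 256 * k w v"
    proof -
      obtain \<gamma> where \<gamma>: "\<gamma> 0 = y" "\<gamma> (dist y w) = w"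
        "\<And>s t. s \<in> {0..dist y w} \<Longrightarrow> t \<in> {0..dist y w} \<Longrightarrow> dist (\<gamma> s) (\<gamma> t) = \<bar>s - t\<bar>"
        using geodesicE[of y w] by blast
      show ?thesis
      proof (rule k_geodesic[OF \<gamma>])
        fix t assume t: "t \<in> {0..dist y w}"
        have "dist y (\<gamma> t) = t" "dist (\<gamma> t) w = dist y w - t"
          using \<gamma>(3)[of 0 t] \<gamma>(3)[of t "dist y w"] t \<gamma>(1,2) by auto
        then show "dist y (\<gamma> t) \<le> 200 * d \<and> 3 * d \<le> dist (\<gamma> t) v"
          using t v w far d dist_triangle[of v w "\<gamma> t"] by (simp add: dist_commute)
      qed (use w d in auto)
    qed
    have yv: "k v w \<le> H ^ 256 * k y w"
    proof -
      obtain \<gamma> where \<gamma>: "\<gamma> 0 = v" "\<gamma> (dist v y) = y"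
        "\<And>s t. s \<in> {0..dist v y} \<Longrightarrow> t \<in> {0..dist v y} \<Longrightarrow> dist (\<gamma> s) (\<gamma> t) = \<bar>s - t\<bar>"
        using geodesicE[of v y] by blast
      show ?thesis
      proof (rule k_geodesic[OF \<gamma>])
        fix t assume t: "t \<in> {0..dist v y}"
        have "dist v (\<gamma> t) = t" "dist (\<gamma> t) y = dist v y - t"
          using \<gamma>(3)[of 0 t] \<gamma>(3)[of t "dist v y"] t \<gamma>(1,2) by auto
        then show "dist y (\<gamma> t) \<le> 200 * d \<and> 3 * d \<le> dist (\<gamma> t) w"
          using t v w far d dist_triangle[of v w "\<gamma> t"] by (simp add: dist_commute)
      qed (use v d in \<open>auto simp: dist_commute\<close>)
    qed
    have s1: "k v y \<le> H\<^sup>2 * k y v" using v d by (intro k_symmetric) (auto simp: dist_commute)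
    have s2: "k w v \<le> H\<^sup>2 * k v w" using v w d far by (intro k_symmetric) (auto simp: dist_commute)
    have s3: "k y w \<le> H\<^sup>2 * k w y" using w d by (intro k_symmetric) auto
    have mul: "H ^ n * a \<le> H ^ n * b" if "a \<le> b" for a b n using that H by (intro mult_left_mono) auto
    have "k v y \<le> H\<^sup>2 * (H ^ 256 * (H\<^sup>2 * (H ^ 256 * (H\<^sup>2 * k w y))))"
      using s1 mul[OF yw] mul[OF s2] mul[OF yv] mul[OF s3]
      by (meson mul order_trans)
    also have "\<dots> = H ^ 518 * k w y"
      by (simp add: mult.assoc[symmetric] power_add[symmetric])
    finally show ?thesis .
  qed
qed

lemma G_compare:
  assumes "16 * d \<le> dist y v" "dist y v \<le> 64 * d" "16 * d \<le> dist y w" "dist y w \<le> 64 * d"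
  shows "G y v \<le> H ^ 518 * G y w"
  using k_compare[OF assms] mass_real(2)[of y] by (simp add: k_def divide_le_cancel)

end

section \<open>Hitting probabilities\<close>

context green_ball
begin

text \<open>Almost every path from \<open>y\<close> leaves the ball of radius \<open>64 * d\<close>,
  hence crosses the sphere of radius \<open>40 * d\<close> and spends a positive time in the ball of
  some source centred between the two radii. The widths have no lower bound, so the Lindeloef
  property reduces the centres to countably many; if all their potentials vanished at
  \<open>y\<close>, almost surely no time would be spent in any of these balls before leaving
  \<open>K\<close>.\<close>

lemma positive_source:
  "\<exists>a. 16 * d \<le> dist y a \<and> dist y a \<le> 64 * d \<and> 0 < G a y"
proof (rule ccontr)
  assume "\<not> (\<exists>a. 16 * d \<le> dist y a \<and> dist y a \<le> 64 * d \<and> 0 < G a y)"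
  then have none: "G a y = 0" if "16 * d \<le> dist y a" "dist y a \<le> 64 * d" for a
    using that G_nonneg[of a y] by (metis less_eq_real_def)
  define S where "S = {a. 16 * d \<le> dist y a \<and> dist y a \<le> 64 * d}"
  let ?b = "\<lambda>a. ball a (width d a)"
  obtain F where F: "F \<subseteq> ?b ` S" "countable F" "\<Union>F = \<Union>(?b ` S)"
    using Lindelof[of "?b ` S"] by (metis (no_types, lifting) imageE open_ball)
  then obtain A where A: "A \<subseteq> S" "countable A" "F = ?b ` A"
    using countable_subset_image[of F ?b S] by blast
  have cover: "\<exists>a\<in>A. z \<in> ?b a" if "z \<in> S" for z
  proof -
    have "z \<in> ?b z" using width(1)[OF d(1), of z] by simp
    then have "z \<in> \<Union>(?b ` S)" using that by blast
    then have "z \<in> \<Union>F" unfolding F(3) .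
    then show ?thesis unfolding A(3) by blast
  qed
  let ?\<Phi> = "\<lambda>a s. killed K (source d a) 0 (max 0 s)"
  have \<Phi>m: "(\<lambda>(s, \<omega>). ?\<Phi> a s \<omega>) \<in> borel_measurable (borel \<Otimes>\<^sub>M P y)" for a
    using killed_joint_measurable[of "\<lambda>_. 0", OF _ _ K(1) test_fun_continuous[OF source_test[OF d(1)]]] by simp
  let ?I = "\<lambda>a \<omega>. laplace 0 (\<lambda>s. ?\<Phi> a s \<omega>)"
  have zero: "AE \<omega> in P y. ?I a \<omega> = 0" if "a \<in> A" for a
  proof -
    have "(\<integral>\<^sup>+\<omega>. ?I a \<omega> \<partial>P y) = resolv K 0 (source d a) y"
      by (rule resolv_closed_eq[OF K(1) test_fun_continuous[OF source_test[OF d(1)]], symmetric])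
    also have "\<dots> = 0" unfolding G_eq using none[of a] that A(1) by (auto simp: S_def)
    finally show ?thesis
      by (subst (asm) nn_integral_0_iff_AE[OF time_integral_measurable[OF \<Phi>m]])
  qed
  then have AEz: "AE \<omega> in P y. \<forall>a\<in>A. ?I a \<omega> = 0" using A(2) by (subst AE_ball_countable) auto
  have yU: "y \<in> ball y (64 * d)" using d by simp
  have AEf: "AE \<omega> in P y. exit_time X (ball y (64 * d)) \<omega> \<noteq> \<infinity>"
  proof (rule nn_integral_noteq_infinite)
    have "(\<integral>\<^sup>+\<omega>. exit_time X (ball y (64 * d)) \<omega> \<partial>P y) \<le> resolv K 0 (\<lambda>_. 1) y"
      unfolding mean_exit_open[OF open_ball yU] using d by (intro resolv_mono_set) auto
    also have "\<dots> < \<infinity>"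
      by (rule le_less_trans[OF resolv_cball_upper[OF _ d(2)]]) (use d in auto)
    finally show "(\<integral>\<^sup>+\<omega>. exit_time X (ball y (64 * d)) \<omega> \<partial>P y) \<noteq> \<infinity>" by simp
  qed (rule exit_time_measurable[OF open_ball])
  have path: False if \<omega>: "\<omega> \<in> space (P y)" "X 0 \<omega> = y" "exit_time X (ball y (64 * d)) \<omega> \<noteq> \<infinity>"
    "\<forall>a\<in>A. ?I a \<omega> = 0" for \<omega>
  proof -
    define T where "T = etime (ball y (64 * d)) \<omega>"
    have fin: "exit_time X (ball y (64 * d)) \<omega> < \<top>" using \<omega>(3) by (simp add: less_top)
    have X0: "X 0 \<omega> \<in> ball y (64 * d)" using \<omega>(2) yU by simp
    note T = exit_time_finiteD[OF \<omega>(1) X0 open_ball fin, folded T_def]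
    have Xc: "continuous_on {0..} (\<lambda>t. X t \<omega>)" by (rule X_continuous[OF \<omega>(1)])
    have "continuous_on {0..T} (\<lambda>t. dist y (X t \<omega>))"
      by (intro continuous_intros continuous_on_subset[OF Xc]) auto
    moreover have "dist y (X 0 \<omega>) \<le> 40 * d" "40 * d \<le> dist y (X T \<omega>)"
      using \<omega>(2) T(2) d by auto
    ultimately obtain u where u: "0 \<le> u" "u \<le> T" "dist y (X u \<omega>) = 40 * d"
      using IVT'[of "\<lambda>t. dist y (X t \<omega>)" 0 "40 * d" T] T(1) by auto
    have uT: "u < T" using u T(2) d by (cases "u = T") auto
    have "X u \<omega> \<in> S" using u d by (simp add: S_def)
    then obtain a where a: "a \<in> A" "X u \<omega> \<in> ?b a" using cover by blast
    have "open (?b a)" by simp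
    then obtain e where e: "e > 0" "ball (X u \<omega>) e \<subseteq> ?b a" using a(2) openE by blast
    obtain \<delta> where \<delta>: "\<delta> > 0" "\<And>v. 0 \<le> v \<Longrightarrow> dist v u < \<delta> \<Longrightarrow> dist (X v \<omega>) (X u \<omega>) < e"
      using Xc u(1) e(1) unfolding continuous_on_iff by (metis atLeast_iff)
    \<comment> \<open>Between the times \<open>u\<close> and \<open>u'\<close> the path is still in
      the ball of radius \<open>64 * d\<close>, hence has not left \<open>K\<close>, and it is in
      the ball of the source at \<open>a\<close>. The time integral of this source can therefore not
      be 0.\<close>
    define u' where "u' = min T (u + \<delta>)"
    have uu': "u < u'" using uT \<delta> by (simp add: u'_def)
    have pos: "indicator {0<..} s * (ennreal (exp (- 0 * s)) * ?\<Phi> a s \<omega>) \<noteq> 0" if s: "s \<in> {u<..<u'}" for s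
    proof -
      have s': "0 < s" "s < T" "dist s u < \<delta>" using s u by (auto simp: u'_def dist_real_def)
      have "X s \<omega> \<in> ?b a" using \<delta>(2)[of s] s' e(2) by (auto simp: dist_commute)
      then have "0 < source d a (X s \<omega>)" using source_pos_iff by blast
      moreover have "stays K s \<omega>"
        unfolding stays_def
      proof
        fix v assume "v \<in> {0..s}"
        then have "X v \<omega> \<in> ball y (64 * d)" using T(3)[of v] s' by auto
        then show "X v \<omega> \<in> K" using d by auto
      qed
      ultimately show ?thesis using s' by (simp add: killed_0 max_def)
    qed
    have sm: "(\<lambda>s. indicator {0<..} s * (ennreal (exp (- 0 * s)) * ?\<Phi> a s \<omega>)) \<in> borel_measurable lborel"
      using time_section[OF \<Phi>m \<omega>(1)] by measurable
    have "?I a \<omega> = 0" using \<omega>(4) a(1) by blast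
    then have "AE s in lborel. indicator {0<..} s * (ennreal (exp (- 0 * s)) * ?\<Phi> a s \<omega>) = 0"
      using nn_integral_0_iff_AE[OF sm] by blast
    then have "AE s in lborel. s \<notin> {u<..<u'}"
      by eventually_elim (use pos in blast)
    then have "{u<..<u'} \<in> null_sets lborel" by (subst AE_iff_null_sets) auto
    then have "emeasure lborel {u<..<u'} = 0" by (rule null_setsD1)
    then show False using uu' by simp
  qed
  have "AE \<omega> in P y. False"
    using AEz AEf X_start[of y] AE_space[of "P y"] by eventually_elim (use path in blast)
  then show False using prob_space.AE_False[OF prob_space_P[of y]] by simp
qed

text \<open>The potential in \<open>positive_source\<close> has its pole at \<open>a\<close>.
  Symmetry moves the pole to \<open>y\<close>, and \<open>G_compare\<close> spreads positivity to
  all points in the given range of distances.\<close>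

lemma G_positive:
  assumes "16 * d \<le> dist y w" "dist y w \<le> 64 * d"
  shows "0 < G y w"
proof -
  obtain a where a: "16 * d \<le> dist y a" "dist y a \<le> 64 * d" "0 < G a y" using positive_source by blast
  have "0 < k y a" using a(3) mass_real(2) by (simp add: k_def)
  also have "k y a \<le> H\<^sup>2 * k a y" using a d by (intro k_symmetric) auto
  finally have "k a y \<noteq> 0" by auto
  then have "0 < k a y" using k_nonneg[of a y] by linarith
  then have "0 < G y a" using mass_real(2)[of y] by (simp add: k_def zero_less_divide_iff)
  also have "G y a \<le> H ^ 518 * G y w" using a assms by (intro G_compare)
  finally have "G y w \<noteq> 0" by auto
  then show ?thesis using G_nonneg[of y w] by linarith
qed

text \<open>The outer radius exceeds the radius \<open>256 * d\<close> of \<open>K\<close>, so the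
  potential is 0 at the outer boundary and only exits through the inner sphere contribute. The
  annulus need not be contained in \<open>K\<close>, but \<open>dynkin_le\<close> has the direction
  that is needed.\<close>

definition annulus :: "'a set" where "annulus = {z. 16 * d < dist y z \<and> dist y z < 272 * d}"

lemma open_annulus: "open annulus"
proof -
  have "annulus = {z. 16 * d < dist y z} \<inter> {z. dist y z < 272 * d}" by (auto simp: annulus_def)
  then show ?thesis by (auto intro!: open_Int open_Collect_less continuous_intros)
qed

text \<open>The value \<open>G y w\<close> is at most the mean of \<open>G y\<close> at the exit
  from the annulus, hence at most \<open>H ^ 518 * G y w\<close> times the probability of leaving
  through the inner sphere. It is positive and cancels.\<close>

lemma inner_exit:
  assumes w: "w \<in> annulus" "dist y w \<le> 64 * d"
  shows "ennreal (1 / H ^ 518) \<le> emeasure (P w) {\<omega> \<in> space (P w). exit_time X annulus \<omega> < \<top> \<and> dist y (X (etime annulus \<omega>) \<omega>) = 16 * d}"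
    (is "_ \<le> emeasure _ ?E")
proof -
  define M where "M = H ^ 518"
  have M: "0 < M" using H by (simp add: M_def)
  note [measurable] = exit_time_measurable[OF open_annulus, of w]
  note [measurable] = X_etime_measurable[OF open_annulus, of w]
  have [measurable]: "?E \<in> sets (P w)" by measurable
  have Gw: "0 < G y w" using w by (intro G_positive) (auto simp: annulus_def)
  have closure: "closure annulus \<subseteq> {z. 16 * d \<le> dist y z \<and> dist y z \<le> 272 * d}"
  proof (rule closure_minimal)
    have "{z. 16 * d \<le> dist y z \<and> dist y z \<le> 272 * d} = {z. 16 * d \<le> dist y z} \<inter> {z. dist y z \<le> 272 * d}" by auto
    then show "closed {z. 16 * d \<le> dist y z \<and> dist y z \<le> 272 * d}"
      by (auto intro!: closed_Int closed_Collect_le continuous_intros)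
  qed (auto simp: annulus_def)
  have AEw: "AE \<omega> in P w. \<omega> \<in> space (P w) \<and> X 0 \<omega> \<in> annulus"
    using X_start[of w] w by (auto elim: AE_mp)
  have "ennreal (G y w) = resolv K 0 (source d y) w" by (simp add: G_eq)
  also have "\<dots> \<le> resolv annulus 0 (source d y) w + (\<integral>\<^sup>+\<omega>. discount annulus 0 \<omega> * resolv K 0 (source d y) (X (etime annulus \<omega>) \<omega>) \<partial>P w)"
    by (rule dynkin_le[OF open_annulus w(1) _ K source_test[OF d(1)]]) simp
  also have "resolv annulus 0 (source d y) w = 0"
    by (rule resolv_open_zero) (use d in \<open>auto simp: annulus_def dist_commute intro!: source_zero\<close>)
  also have "0 + (\<integral>\<^sup>+\<omega>. discount annulus 0 \<omega> * resolv K 0 (source d y) (X (etime annulus \<omega>) \<omega>) \<partial>P w)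
    \<le> (\<integral>\<^sup>+\<omega>. ennreal (M * G y w) * indicator ?E \<omega> \<partial>P w)"
    unfolding add_0
  proof (rule nn_integral_mono_AE)
    show "AE \<omega> in P w. discount annulus 0 \<omega> * resolv K 0 (source d y) (X (etime annulus \<omega>) \<omega>)
      \<le> ennreal (M * G y w) * indicator ?E \<omega>"
      using AEw
    proof eventually_elim
      case (elim \<omega>)
      show ?case
      proof (cases "exit_time X annulus \<omega> < \<top>")
        case True
        define v where "v = X (etime annulus \<omega>) \<omega>"
        have "v \<notin> annulus" "v \<in> closure annulus"
          unfolding v_def using exit_time_finiteD[OF _ _ open_annulus True] elim by auto
        then consider "dist y v = 16 * d" | "dist y v = 272 * d"
          using closure by (force simp: annulus_def)
        then show ?thesis
        proof cases
          case 1
          then have "G y v \<le> M * G y w"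
            unfolding M_def using w d by (intro G_compare) (auto simp: annulus_def)
          then show ?thesis using 1 True elim by (simp add: discount_def v_def G_eq ennreal_leI)
        next
          case 2
          then have "v \<notin> K" using d by simp
          then show ?thesis using True by (simp add: v_def resolv_outside)
        qed
      qed (simp add: discount_def)
    qed
  qed
  also have "\<dots> = ennreal (M * G y w) * emeasure (P w) ?E" by (rule nn_integral_cmult_indicator) measurable
  also have "\<dots> = ennreal (M * G y w * measure (P w) ?E)"
    using prob_space.finite_measure[OF prob_space_P] M
    by (simp add: finite_measure.emeasure_eq_measure ennreal_mult')
  finally have "G y w \<le> M * G y w * measure (P w) ?E" using M by (subst (asm) ennreal_le_iff) auto
  then have "G y w * 1 \<le> G y w * (M * measure (P w) ?E)" by (simp add: mult_ac)
  then have "1 \<le> M * measure (P w) ?E" using Gw by (subst (asm) mult_le_cancel_left_pos) auto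
  then have "1 / M \<le> measure (P w) ?E" using M by (simp add: divide_le_eq mult.commute)
  then show ?thesis
    using prob_space.finite_measure[OF prob_space_P]
    by (simp add: finite_measure.emeasure_eq_measure M_def ennreal_leI)
qed

end

section \<open>Reaching a neighbouring ball in bounded time, and chaining\<close>

context harnack_diffusion
begin

text \<open>By \<open>inner_exit\<close> the inner sphere is reached with probability at least
  \<open>1 / H ^ 518\<close>; half of this is given up to bound the time, and half again to pass to
  discrete times.\<close>

definition hit_prob :: real where "hit_prob = 1 / (4 * H ^ 518)"

text \<open>The bound for the mean exit time from the ball of radius \<open>272 * d\<close>,
  multiplied by \<open>2 * H ^ 518\<close>; by Markov's inequality a later exit has probability at
  most \<open>1 / (2 * H ^ 518)\<close>.\<close>

definition hit_time :: "real \<Rightarrow> real" where "hit_time d = 2 * H ^ 518 * C * (544 * d) powr \<beta>"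

lemma hit_prob: "0 < hit_prob" "hit_prob < 1"
proof -
  have "1 \<le> H ^ 518" using H by (rule one_le_power)
  then show "0 < hit_prob" "hit_prob < 1" by (auto simp: hit_prob_def divide_less_eq)
qed

lemma hitting_far:
  assumes d0: "0 < d" "544 * d < R" and w: "16 * d < dist y w" "dist y w \<le> 64 * d"
  shows "2 * hit_prob \<le> measure (P w) {\<omega> \<in> space (P w). exit_time X (green_ball.annulus y d) \<omega> \<le> ennreal (hit_time d) \<and>
    dist y (X (etime (green_ball.annulus y d) \<omega>) \<omega>) = 16 * d}"
proof -
  interpret green_ball P X \<beta> C R \<mu> p H y d by unfold_locales (use d0 in auto)
  interpret prob_space "P w" by (rule prob_space_P)
  define M where "M = H ^ 518"
  have M: "0 < M" using H by (simp add: M_def)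
  define \<tau> where "\<tau> = hit_time d"
  have \<tau>: "0 < \<tau>" using M C d0 by (simp add: \<tau>_def hit_time_def M_def)
  have wA: "w \<in> annulus" using w d0 by (simp add: annulus_def)
  note [measurable] = exit_time_measurable[OF open_annulus, of w]
  note [measurable] = X_etime_measurable[OF open_annulus, of w]
  let ?E = "{\<omega> \<in> space (P w). exit_time X annulus \<omega> < \<top> \<and> dist y (X (etime annulus \<omega>) \<omega>) = 16 * d}"
  let ?L = "{\<omega> \<in> space (P w). 1 \<le> ennreal (1 / \<tau>) * exit_time X annulus \<omega>}"
  let ?E' = "{\<omega> \<in> space (P w). exit_time X annulus \<omega> \<le> ennreal \<tau> \<and> dist y (X (etime annulus \<omega>) \<omega>) = 16 * d}"
  have [measurable]: "?E \<in> sets (P w)" "?L \<in> sets (P w)" "?E' \<in> sets (P w)" by measurable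
  have "emeasure (P w) ?L \<le> ennreal (1 / \<tau>) * (\<integral>\<^sup>+\<omega>. exit_time X annulus \<omega> \<partial>P w)"
    using nn_integral_Markov_inequality[of "exit_time X annulus" "space (P w)" "P w" "ennreal (1 / \<tau>)"]
    by (simp cong: nn_integral_cong)
  also have "(\<integral>\<^sup>+\<omega>. exit_time X annulus \<omega> \<partial>P w) \<le> ennreal (C * (544 * d) powr \<beta>)"
  proof -
    have "resolv annulus 0 (\<lambda>_. 1) w \<le> resolv (cball y (272 * d)) 0 (\<lambda>_. 1) w"
      by (rule resolv_mono_set) (auto simp: annulus_def)
    also have "\<dots> \<le> ennreal (C * (2 * (272 * d)) powr \<beta>)" using d0 by (intro resolv_cball_upper) auto
    finally show ?thesis unfolding mean_exit_open[OF open_annulus wA] by (simp add: mult.assoc[symmetric])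
  qed
  also have "ennreal (1 / \<tau>) * ennreal (C * (544 * d) powr \<beta>) = ennreal (1 / (2 * M))"
    using \<tau> C d0 M by (simp add: ennreal_mult'[symmetric] \<tau>_def hit_time_def M_def)
  finally have L: "prob ?L \<le> 1 / (2 * M)"
    using M by (simp add: emeasure_eq_measure mult_left_mono) 
  have E: "1 / M \<le> prob ?E"
    using inner_exit[OF wA w(2)] M by (simp add: emeasure_eq_measure M_def)
  have "?E \<subseteq> ?E' \<union> ?L"
  proof
    fix \<omega> assume \<omega>: "\<omega> \<in> ?E"
    show "\<omega> \<in> ?E' \<union> ?L"
    proof (cases "exit_time X annulus \<omega> \<le> ennreal \<tau>")
      case False
      then have "ennreal (1 / \<tau>) * ennreal \<tau> \<le> ennreal (1 / \<tau>) * exit_time X annulus \<omega>"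
        by (intro mult_left_mono) auto
      moreover have "ennreal (1 / \<tau>) * ennreal \<tau> = 1" using \<tau> by (simp add: ennreal_mult'[symmetric])
      ultimately show ?thesis using \<omega> by auto
    qed (use \<omega> in auto)
  qed
  then have "prob ?E \<le> prob (?E' \<union> ?L)" by (intro finite_measure_mono) auto
  also have "\<dots> \<le> prob ?E' + prob ?L" by (intro measure_Un_le) auto
  finally have "1 / M - 1 / (2 * M) \<le> prob ?E'" using L E by linarith
  then show ?thesis using M by (simp add: hit_prob_def M_def[symmetric] \<tau>_def[symmetric] field_simps)
qed

text \<open>Discrete times are used so that the simple Markov property suffices for chaining. A
  continuous path on the sphere of radius \<open>16 * d\<close> is in the ball of radius
  \<open>32 * d\<close> at nearby dyadic times. The dyadic grids are nested, so these events
  increase with \<open>n\<close>, and some \<open>n\<close>, depending on \<open>y\<close> and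
  \<open>w\<close>, already gives half the probability of the limit.\<close>

lemma hitting:
  assumes d0: "0 < d" "544 * d < R" and w: "dist y w \<le> 64 * d"
  shows "\<exists>n. hit_prob \<le> measure (P w) {\<omega> \<in> space (P w). \<exists>k\<le>2 ^ n. X (real k * (hit_time d / 2 ^ n)) \<omega> \<in> ball y (32 * d)}"
proof -
  interpret prob_space "P w" by (rule prob_space_P)
  define \<tau> where "\<tau> = hit_time d"
  have \<tau>: "0 < \<tau>" using H C d0 by (simp add: \<tau>_def hit_time_def)
  define E where "E n = {\<omega> \<in> space (P w). \<exists>k\<le>2 ^ n. X (real k * (\<tau> / 2 ^ n)) \<omega> \<in> ball y (32 * d)}" for n :: nat
  have Xm: "X (real k * (\<tau> / 2 ^ n)) \<in> borel_measurable (P w)" for k n :: nat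
    using \<tau> by (intro X_measurable) auto
  have E_eq: "E n = (\<Union>k\<in>{..2 ^ n}. X (real k * (\<tau> / 2 ^ n)) -` ball y (32 * d) \<inter> space (P w))" for n
    unfolding E_def by blast
  have Em [measurable]: "E n \<in> sets (P w)" for n
    unfolding E_eq by (intro sets.finite_UN measurable_sets[OF Xm]) auto
  show ?thesis
  proof (cases "dist y w \<le> 16 * d")
    \<comment> \<open>A start within distance \<open>16 * d\<close> counts as a hit at time 0,
      already on the coarsest grid.\<close>
    case True
    have "AE \<omega> in P w. \<omega> \<in> E 0"
      using X_start[of w] AE_space[of "P w"]
    proof eventually_elim
      case (elim \<omega>)
      then show ?case using True d0 unfolding E_def by (auto intro!: exI[of _ 0])
    qed
    then have "prob (E 0) = 1" by (simp add: prob_eq_1)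
    then show ?thesis using hit_prob by (intro exI[of _ 0]) (simp add: E_def \<tau>_def)
  next
    case False
    let ?A = "green_ball.annulus y d"
    interpret green_ball P X \<beta> C R \<mu> p H y d by unfold_locales (use d0 in auto)
    note [measurable] = exit_time_measurable[OF open_annulus, of w]
    note [measurable] = X_etime_measurable[OF open_annulus, of w]
    let ?E' = "{\<omega> \<in> space (P w). exit_time X annulus \<omega> \<le> ennreal \<tau> \<and> dist y (X (etime annulus \<omega>) \<omega>) = 16 * d}"
    have sub: "?E' \<subseteq> (\<Union>n. E n)"
    proof
      fix \<omega> assume \<omega>: "\<omega> \<in> ?E'"
      define T where "T = etime annulus \<omega>"
      have T: "0 \<le> T" "T \<le> \<tau>" "dist y (X T \<omega>) = 16 * d"
        using \<omega> \<tau> by (auto simp: T_def enn2real_leI)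
      obtain \<delta> where \<delta>: "\<delta> > 0" "\<And>v. 0 \<le> v \<Longrightarrow> dist v T < \<delta> \<Longrightarrow> dist (X v \<omega>) (X T \<omega>) < 16 * d"
        using X_continuous[of \<omega> w] \<omega> T(1) d0 unfolding continuous_on_iff
        by (metis (no_types, lifting) CollectD atLeast_iff mult_pos_pos zero_less_numeral)
      obtain n :: nat where n: "\<tau> / \<delta> < 2 ^ n" using real_arch_pow[of 2 "\<tau> / \<delta>"] by auto
      define h where "h = \<tau> / 2 ^ n"
      have h: "0 < h" "h < \<delta>" using \<tau> n \<delta> by (auto simp: h_def field_simps)
      define k where "k = nat \<lfloor>T / h\<rfloor>"
      have Th: "0 \<le> T / h" using T h by simp
      have k1: "real k \<le> T / h" "T / h < real k + 1" unfolding k_def using Th by (auto simp: of_nat_nat)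
      have kb: "real k * h \<le> T" "T < real k * h + h" using k1 h by (auto simp: field_simps)
      have "T / h \<le> 2 ^ n" using T \<tau> by (simp add: h_def field_simps)
      then have "real k \<le> 2 ^ n" using k1 by linarith
      then have k2: "k \<le> 2 ^ n" by (metis of_nat_le_iff of_nat_numeral of_nat_power)
      have "dist (X (real k * h) \<omega>) (X T \<omega>) < 16 * d"
        using kb h by (intro \<delta>(2)) (auto simp: dist_real_def)
      then have "dist y (X (real k * h) \<omega>) < 32 * d"
        using T(3) dist_triangle[of y "X (real k * h) \<omega>" "X T \<omega>"] by (simp add: dist_commute)
      then have "\<omega> \<in> E n" unfolding E_def h_def using \<omega> k2 by auto
      then show "\<omega> \<in> (\<Union>n. E n)" by blast
    qed
    have "2 * hit_prob \<le> prob ?E'" unfolding \<tau>_def using False w by (intro hitting_far d0) auto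
    also have "\<dots> \<le> prob (\<Union>n. E n)" using sub by (intro finite_measure_mono) auto
    finally have *: "hit_prob < prob (\<Union>n. E n)" using hit_prob by linarith
    have "incseq E"
    proof (rule incseq_SucI, rule subsetI)
      fix n \<omega> assume "\<omega> \<in> E n"
      then obtain k where k: "\<omega> \<in> space (P w)" "k \<le> 2 ^ n" "X (real k * (\<tau> / 2 ^ n)) \<omega> \<in> ball y (32 * d)"
        unfolding E_def by blast
      have "real (2 * k) * (\<tau> / 2 ^ Suc n) = real k * (\<tau> / 2 ^ n)" by simp
      then have "X (real (2 * k) * (\<tau> / 2 ^ Suc n)) \<omega> \<in> ball y (32 * d)" using k(3) by (simp only:)
      then show "\<omega> \<in> E (Suc n)" unfolding E_def using k by (auto intro!: exI[of _ "2 * k"])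
    qed
    then have "(\<lambda>n. prob (E n)) \<longlonglongrightarrow> prob (\<Union>n. E n)" by (intro finite_Lim_measure_incseq) auto
    then have "\<forall>\<^sub>F n in sequentially. hit_prob < prob (E n)" using * by (rule order_tendstoD)
    then obtain n where "hit_prob < prob (E n)" by (auto simp: eventually_sequentially)
    then show ?thesis unfolding E_def \<tau>_def by (intro exI[of _ n]) simp
  qed
qed

text \<open>Reaching the next ball is split according to the first grid time at which it happens,
  and the Markov property is applied at each of these fixed times. The time left depends on that
  grid time but suffices for the remaining moves; the surplus at the end is not controlled, which is
  why \<open>final\<close> covers all times up to \<open>t\<close>.\<close>

lemma chain_lower:
  assumes d: "0 < d" "544 * d < R" and B: "B \<in> sets borel" and q: "0 \<le> q"
    and steps: "\<And>i. i < n \<Longrightarrow> dist (c i) (c (Suc i)) \<le> 32 * d"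
    and final: "\<And>z s. z \<in> ball (c n) (32 * d) \<Longrightarrow> 0 \<le> s \<Longrightarrow> s \<le> t \<Longrightarrow> q \<le> measure (P z) {\<omega> \<in> space (P z). X s \<omega> \<in> B}"
    and z: "z \<in> ball (c 0) (32 * d)" and s: "real n * hit_time d \<le> s" "s \<le> t"
  shows "hit_prob ^ n * q \<le> measure (P z) {\<omega> \<in> space (P z). X s \<omega> \<in> B}"
  using steps final z s
proof (induction n arbitrary: c z s)
  case 0
  then show ?case by simp
next
  case (Suc n)
  interpret prob_space "P z" by (rule prob_space_P)
  define \<tau> where "\<tau> = hit_time d"
  have \<tau>: "0 < \<tau>" using H C d by (simp add: \<tau>_def hit_time_def)
  have IH: "hit_prob ^ n * q \<le> measure (P z') {\<omega> \<in> space (P z'). X s' \<omega> \<in> B}"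
    if "z' \<in> ball (c 1) (32 * d)" "real n * \<tau> \<le> s'" "s' \<le> t" for z' s'
    using Suc.IH[of "\<lambda>i. c (Suc i)" z' s'] Suc.prems(1,2) that by (simp add: \<tau>_def)
  have "dist (c 1) z \<le> 64 * d"
    using Suc.prems(1)[of 0] Suc.prems(3) dist_triangle[of "c 1" z "c 0"] by (simp add: dist_commute)
  then obtain N where N: "hit_prob \<le> prob {\<omega> \<in> space (P z). \<exists>k\<le>2 ^ N. X (real k * (\<tau> / 2 ^ N)) \<omega> \<in> ball (c 1) (32 * d)}"
    using hitting[OF d, of "c 1" z] unfolding \<tau>_def by blast
  define h where "h = \<tau> / 2 ^ N"
  have h: "0 < h" using \<tau> by (simp add: h_def)
  let ?V = "ball (c 1) (32 * d)"
  \<comment> \<open>Recording the first grid time in the ball makes the events disjoint, so that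
    their probabilities add up.\<close>
  define A where "A k = {\<omega> \<in> space (P z). X (real k * h) \<omega> \<in> ?V \<and> (\<forall>j<k. X (real j * h) \<omega> \<notin> ?V)}" for k :: nat
  have AF: "A k \<in> sets (\<F> z (real k * h))" for k
  proof -
    have Xm: "X (real j * h) \<in> borel_measurable (\<F> z (real k * h))" if "j \<le> k" for j
      using h that by (intro X_in_filtration mult_right_mono) auto
    have "A k = (X (real k * h) -` ?V \<inter> space (\<F> z (real k * h))) -
        (\<Union>j\<in>{..<k}. X (real j * h) -` ?V \<inter> space (\<F> z (real k * h)))"
      unfolding space_filtration A_def by blast
    also have "\<dots> \<in> sets (\<F> z (real k * h))"
      by (intro sets.Diff sets.finite_UN measurable_sets[OF Xm]) auto
    finally show ?thesis .
  qed
  have AP [measurable]: "A k \<in> sets (P z)" for k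
    using AF[of k] subalgebra_filtration[of z "real k * h"] by (auto simp: subalgebra_def)
  have disj: "disjoint_family_on A I" for I
    unfolding disjoint_family_on_def A_def by (auto simp: nat_neq_iff)
  have hit_eq: "{\<omega> \<in> space (P z). \<exists>k\<le>2 ^ N. X (real k * (\<tau> / 2 ^ N)) \<omega> \<in> ?V} \<subseteq> (\<Union>k\<le>2 ^ N. A k)"
  proof
    fix \<omega> assume "\<omega> \<in> {\<omega> \<in> space (P z). \<exists>k\<le>2 ^ N. X (real k * (\<tau> / 2 ^ N)) \<omega> \<in> ?V}"
    then obtain k where k: "\<omega> \<in> space (P z)" "k \<le> 2 ^ N" "X (real k * h) \<omega> \<in> ?V" unfolding h_def by blast
    define k0 where "k0 = (LEAST k. X (real k * h) \<omega> \<in> ?V)"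
    have "X (real k0 * h) \<omega> \<in> ?V" unfolding k0_def using k(3) by (rule LeastI)
    moreover have "k0 \<le> k" unfolding k0_def using k(3) by (rule Least_le)
    moreover have "\<forall>j<k0. X (real j * h) \<omega> \<notin> ?V" unfolding k0_def using not_less_Least by blast
    ultimately show "\<omega> \<in> (\<Union>k\<le>2 ^ N. A k)" using k by (auto simp: A_def)
  qed
  have s0: "0 \<le> s" using Suc.prems(4) \<tau> by (simp add: \<tau>_def[symmetric]) (meson order_trans mult_nonneg_nonneg less_imp_le of_nat_0_le_iff add_nonneg_nonneg zero_le_one)
  note [measurable] = X_measurable[OF s0, of z] B
  have [measurable]: "{\<omega> \<in> space (P z). X s \<omega> \<in> B} \<in> sets (P z)" by measurable
  let ?Q = "hit_prob ^ n * q"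
  have Q0: "0 \<le> ?Q" using hit_prob q by simp
  have piece: "ennreal ?Q * emeasure (P z) (A k) \<le> emeasure (P z) (A k \<inter> {\<omega> \<in> space (P z). X s \<omega> \<in> B})"
    if k: "k \<le> 2 ^ N" for k
  proof -
    have kN: "real k \<le> 2 ^ N" using k by (metis of_nat_le_iff of_nat_numeral of_nat_power)
    have "real k * h \<le> 2 ^ N * h" using kN h by (intro mult_right_mono) auto
    then have kh: "0 \<le> real k * h" "real k * h \<le> \<tau>" using h \<tau> by (auto simp: h_def)
    have rest: "real n * \<tau> \<le> s - real k * h" "s - real k * h \<le> t" "0 \<le> s - real k * h"
    proof -
      have "real n * \<tau> + \<tau> \<le> s" using Suc.prems(4) by (simp add: \<tau>_def distrib_right)
      then show 1: "real n * \<tau> \<le> s - real k * h" using kh by linarith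
      show "s - real k * h \<le> t" using Suc.prems(5) kh by linarith
      show "0 \<le> s - real k * h" using 1 \<tau> by (meson less_imp_le mult_nonneg_nonneg of_nat_0_le_iff order_trans)
    qed
    have st: "ennreal ?Q \<le> step (s - real k * h) (indicator B) z'" if "z' \<in> ?V" for z'
    proof -
      interpret Z: prob_space "P z'" by (rule prob_space_P)
      note [measurable] = X_measurable[OF rest(3), of z']
      have "ennreal ?Q \<le> ennreal (Z.prob {\<omega> \<in> space (P z'). X (s - real k * h) \<omega> \<in> B})"
        using IH[OF that rest(1,2)] by (rule ennreal_leI)
      also have "\<dots> = (\<integral>\<^sup>+\<omega>. indicator {\<omega> \<in> space (P z'). X (s - real k * h) \<omega> \<in> B} \<omega> \<partial>P z')"
        by (subst nn_integral_indicator) (auto simp: Z.emeasure_eq_measure)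
      also have "\<dots> = step (s - real k * h) (indicator B) z'"
        unfolding step_def by (intro nn_integral_cong) (auto simp: indicator_def)
      finally show ?thesis .
    qed
    have "ennreal ?Q * emeasure (P z) (A k) = (\<integral>\<^sup>+\<omega>. indicator (A k) \<omega> * ennreal ?Q \<partial>P z)"
      by (simp add: nn_integral_multc mult.commute)
    also have "\<dots> \<le> (\<integral>\<^sup>+\<omega>. indicator (A k) \<omega> * step (s - real k * h) (indicator B) (X (real k * h) \<omega>) \<partial>P z)"
      using st by (intro nn_integral_mono) (auto simp: indicator_def A_def)
    also have "\<dots> = (\<integral>\<^sup>+\<omega>. indicator (A k) \<omega> * indicator B (X (real k * h + (s - real k * h)) \<omega>) \<partial>P z)"
      by (rule markov_sets[OF kh(1) rest(3) AF B, symmetric])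
    also have "\<dots> = (\<integral>\<^sup>+\<omega>. indicator (A k \<inter> {\<omega> \<in> space (P z). X s \<omega> \<in> B}) \<omega> \<partial>P z)"
      by (intro nn_integral_cong) (auto simp: indicator_def)
    finally show ?thesis by simp
  qed
  have "ennreal (hit_prob * ?Q) = ennreal ?Q * ennreal hit_prob"
    using Q0 hit_prob by (simp add: ennreal_mult'[symmetric] mult.commute)
  also have "\<dots> \<le> ennreal ?Q * emeasure (P z) (\<Union>k\<le>2 ^ N. A k)"
  proof (rule mult_left_mono)
    have "ennreal hit_prob \<le> emeasure (P z) {\<omega> \<in> space (P z). \<exists>k\<le>2 ^ N. X (real k * (\<tau> / 2 ^ N)) \<omega> \<in> ?V}"
      using N by (simp add: emeasure_eq_measure ennreal_leI)
    also have "\<dots> \<le> emeasure (P z) (\<Union>k\<le>2 ^ N. A k)" by (intro emeasure_mono hit_eq) auto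
    finally show "ennreal hit_prob \<le> emeasure (P z) (\<Union>k\<le>2 ^ N. A k)" .
  qed simp
  also have "emeasure (P z) (\<Union>k\<le>2 ^ N. A k) = (\<Sum>k\<le>2 ^ N. emeasure (P z) (A k))"
    by (rule sum_emeasure[symmetric]) (auto intro: disj)
  also have "ennreal ?Q * \<dots> = (\<Sum>k\<le>2 ^ N. ennreal ?Q * emeasure (P z) (A k))" by (rule sum_distrib_left)
  also have "\<dots> \<le> (\<Sum>k\<le>2 ^ N. emeasure (P z) (A k \<inter> {\<omega> \<in> space (P z). X s \<omega> \<in> B}))"
    by (intro sum_mono piece) auto
  also have "\<dots> = emeasure (P z) (\<Union>k\<le>2 ^ N. A k \<inter> {\<omega> \<in> space (P z). X s \<omega> \<in> B})"
    using disj[of "{..2 ^ N}"] by (intro sum_emeasure) (auto simp: disjoint_family_on_def)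
  also have "\<dots> \<le> emeasure (P z) {\<omega> \<in> space (P z). X s \<omega> \<in> B}" by (intro emeasure_mono) auto
  finally show ?case by (simp add: emeasure_eq_measure mult.assoc)
qed

end

section \<open>The lower bound\<close>

context harnack_diffusion
begin

text \<open>This bridges the time left over at the end of a chain. The number \<open>n\<close> of
  exits is fixed first, with \<open>\<rho> ^ n \<le> 1 / 4\<close>, and \<open>t\<close> is then so
  small that \<open>exp (rate r * t) < 2\<close>; the starting point does not enter.\<close>

lemma stay_near:
  assumes \<rho>0: "0 < \<rho>\<^sub>0"
  shows "\<forall>\<^sub>F t in at_right 0. \<forall>z s. 0 \<le> s \<longrightarrow> s \<le> t \<longrightarrow> (\<forall>B\<in>sets borel. cball z \<rho>\<^sub>0 \<subseteq> B \<longrightarrow>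
    1 / 2 \<le> measure (P z) {\<omega> \<in> space (P z). X s \<omega> \<in> B})"
proof -
  obtain N :: nat where N: "\<rho> ^ N < 1 / 4" using real_arch_pow_inv[of "1/4" \<rho>] rho by auto
  obtain N' :: nat where N': "real N' > \<rho>\<^sub>0 / R" using reals_Archimedean2 by blast
  define n where "n = max N N' + 1"
  define r where "r = \<rho>\<^sub>0 / real n"
  have n: "0 < real n" by (simp add: n_def)
  have "\<rho>\<^sub>0 / R < real n" using N' by (simp add: n_def)
  then have r: "0 < r" "r < R" "real n * r = \<rho>\<^sub>0"
    using n \<rho>0 R by (auto simp: r_def divide_less_eq mult.commute)
  have pn: "\<rho> ^ n \<le> 1 / 4"
  proof -
    have "\<rho> ^ n \<le> \<rho> ^ N" using rho by (intro power_decreasing) (auto simp: n_def)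
    then show ?thesis using N by simp
  qed
  have "((\<lambda>t. exp (rate r * t)) \<longlongrightarrow> exp (rate r * 0)) (at_right 0)" by (intro tendsto_intros)
  then have "\<forall>\<^sub>F t in at_right 0. exp (rate r * t) < 2" by (rule order_tendstoD) simp
  then show ?thesis
  proof eventually_elim
    case (elim t)
    show ?case
    proof (intro allI impI ballI)
      fix z :: 'a and s and B :: "'a set"
      assume s: "0 \<le> s" "s \<le> t" and B: "B \<in> sets borel" "cball z \<rho>\<^sub>0 \<subseteq> B"
      interpret prob_space "P z" by (rule prob_space_P)
      note [measurable] = X_measurable[OF s(1), of z] B(1)
      have rate0: "0 \<le> rate r" using C by (simp add: rate_def)
      have "prob {\<omega> \<in> space (P z). X s \<omega> \<in> - B} \<le> exp (rate r * s) * \<rho> ^ n"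
        using B r(3) by (intro escape_probability r s) auto
      also have "\<dots> \<le> 2 * (1 / 4)"
      proof (intro mult_mono pn)
        have "exp (rate r * s) \<le> exp (rate r * t)" using s rate0 by (simp add: mult_left_mono)
        then show "exp (rate r * s) \<le> 2" using elim by linarith
      qed (use rho in auto)
      finally have le: "prob {\<omega> \<in> space (P z). X s \<omega> \<in> - B} \<le> 1 / 2" by simp
      have "{\<omega> \<in> space (P z). X s \<omega> \<in> - B} = space (P z) - {\<omega> \<in> space (P z). X s \<omega> \<in> B}" by auto
      moreover have "{\<omega> \<in> space (P z). X s \<omega> \<in> B} \<in> sets (P z)" by measurable
      ultimately show "1 / 2 \<le> prob {\<omega> \<in> space (P z). X s \<omega> \<in> B}" using le by (simp add: prob_compl)
    qed
  qed
qed

text \<open>With \<open>32 * d = D / n\<close>, a chain of \<open>n\<close> moves takes time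
  \<open>n * hit_time d = \<kappa> * D^\<beta> * n^(1 - \<beta>)\<close>. This is at most
  \<open>t\<close> for n of order t^(-\<gamma>), and the probability of the chain is at least
  \<open>hit_prob ^ n\<close>.\<close>

lemma lower_bound:
  shows "\<exists>c>0. \<forall>A B. open A \<and> open B \<and> emeasure \<mu> A < \<infinity> \<and> A \<noteq> {} \<and> B \<noteq> {} \<longrightarrow>
            Liminf (at_right 0)
              (\<lambda>t. ereal (t powr (1 / (\<beta> - 1))) * elog (transition_between \<mu> p t A B))
            \<ge> ereal (- c * setdist A B powr (\<beta> / (\<beta> - 1)))"
proof -
  define \<gamma> where "\<gamma> = 1 / (\<beta> - 1)"
  define l where "l = - ln hit_prob"
  \<comment> \<open>The base 17 is 544 / 32, because \<open>d = D / (32 * n)\<close>.\<close>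
  define \<kappa> where "\<kappa> = 2 * H ^ 518 * C * 17 powr \<beta>"
  have \<gamma>: "0 < \<gamma>" and \<gamma>\<beta>: "\<gamma> * (\<beta> - 1) = 1" "\<beta> / (\<beta> - 1) = \<beta> * \<gamma>" using \<beta> by (auto simp: \<gamma>_def)
  have l: "0 < l" using hit_prob by (simp add: l_def)
  have \<kappa>: "0 < \<kappa>" using C H by (simp add: \<kappa>_def)
  define c where "c = l * \<kappa> powr \<gamma>"
  have c: "0 < c" using l \<kappa> by (simp add: c_def)
  \<comment> \<open>The distance need not be attained and may be 0, so a slightly larger
    \<open>D\<close> is used. The constant \<open>c\<close> does not depend on \<open>D\<close>,
    which tends to the distance at the end.\<close>
  have main: "ereal (- (c * D powr (\<beta> * \<gamma>))) \<le> Liminf (at_right 0) (\<lambda>t. ereal (t powr \<gamma>) * elog (transition_between \<mu> p t A B))"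
    if A: "open A" "emeasure \<mu> A < \<infinity>" "A \<noteq> {}" and B: "open B" "B \<noteq> {}" and D: "setdist A B < D" for A B D
  proof -
    have D0: "0 < D" using D setdist_pos_le[of A B] by linarith
    obtain a b where ab: "a \<in> A" "b \<in> B" "dist a b < D" using setdist_ltE[OF D A(3) B(2)] by blast
    obtain e1 where e1: "e1 > 0" "ball a e1 \<subseteq> A" using A ab openE by blast
    obtain e2 where e2: "e2 > 0" "cball b e2 \<subseteq> B" using B(1) ab(2) open_contains_cball by blast
    \<comment> \<open>Starting points in \<open>A\<close> at distance less than \<open>D\<close>
      from \<open>b\<close>; being open and nonempty, this set has positive measure.\<close>
    define A0 where "A0 = ball a (min e1 (D - dist a b))"
    have A0: "A0 \<in> sets borel" "A0 \<subseteq> A" using e1 by (auto simp: A0_def)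
    have A0d: "dist x b < D" if "x \<in> A0" for x
      using that dist_triangle[of x b a] by (simp add: A0_def dist_commute)
    have mA0: "0 < measure \<mu> A0"
    proof -
      have "a \<in> A0" using e1 ab by (simp add: A0_def)
      then have "0 < emeasure \<mu> A0" using support unfolding full_support_def A0_def by blast
      moreover have "emeasure \<mu> A0 < \<infinity>"
        using A(1,2) A0 emeasure_mono[OF A0(2), of \<mu>] sets_\<mu> by auto
      ultimately show ?thesis by (simp add: measure_def enn2real_positive_iff)
    qed
    \<comment> \<open>The smallest value for which \<open>n \<ge> b1 * t powr (- \<gamma>)\<close>
      gives \<open>n * hit_time d \<le> t\<close>.\<close>
    define b1 where "b1 = (\<kappa> * D powr \<beta>) powr \<gamma>"
    have b1: "0 < b1" using \<kappa> D0 by (simp add: b1_def)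
    have b1pow: "b1 powr (\<beta> - 1) = \<kappa> * D powr \<beta>"
      unfolding b1_def using \<gamma>\<beta>(1) \<kappa> D0 by (simp add: powr_powr)
    have L: "l * b1 = c * D powr (\<beta> * \<gamma>)"
      unfolding b1_def c_def using \<kappa> D0 by (simp add: powr_mult powr_powr)
    \<comment> \<open>The three entries ensure that \<open>544 * d < R\<close>, that every point of
      the last ball of the chain has room \<open>e2 / 2\<close> inside \<open>B\<close>, and that
      \<open>n\<close> is positive.\<close>
    define thr where "thr = max (max (544 * (D / 32) / R) (2 * D / e2)) 1"
    have e_pos: "\<forall>\<^sub>F t::real in at_right 0. 0 < t" by (simp add: eventually_at_right_less)
    have "filterlim (\<lambda>t. b1 * t powr (- \<gamma>)) at_top (at_right 0)" using b1 \<gamma> by real_asymp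
    then have e_thr: "\<forall>\<^sub>F t in at_right 0. thr < b1 * t powr (- \<gamma>)"
      by (rule filterlim_at_top_dense[THEN iffD1, rule_format])
    have "0 < e2 / 2" using e2 by simp
    note e_stay = stay_near[OF this]
    have "ereal (- (l * b1)) \<le> Liminf (at_right 0) (\<lambda>t. ereal (t powr \<gamma>) * elog (transition_between \<mu> p t A B))"
    proof (rule Liminf_elog_ge[OF \<gamma>])
      show "\<forall>\<^sub>F t in at_right 0. exp (ln (measure \<mu> A0 / 2) - l - l * b1 * t powr (- \<gamma>)) \<le> transition_between \<mu> p t A B"
        using e_pos e_thr e_stay
      proof eventually_elim
        case (elim t)
        define Y where "Y = b1 * t powr (- \<gamma>)"
        have Y: "1 < Y" "544 * (D / 32) / R < Y" "2 * D / e2 < Y" using elim(2) by (auto simp: thr_def Y_def)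
        define n where "n = nat \<lceil>Y\<rceil>"
        have n: "Y \<le> real n" "real n \<le> Y + 1" unfolding n_def using Y(1) by (auto simp: of_nat_nat)
        have n0: "0 < real n" using n Y by linarith
        define d where "d = D / 32 / real n"
        have "544 * (D / 32) / R < real n" using Y n by linarith
        then have d: "0 < d" "544 * d < R"
          using R D0 n0 by (auto simp: d_def divide_less_eq mult.commute)
        have "2 * D / e2 < real n" using Y n by linarith
        then have de: "32 * d < e2 / 2" using e2 n0 by (simp add: d_def field_simps)
        have time: "real n * hit_time d \<le> t"
        proof -
          have "Y powr (\<beta> - 1) = b1 powr (\<beta> - 1) * (t powr (- \<gamma>)) powr (\<beta> - 1)"
            unfolding Y_def by (rule powr_mult)
          also have "(t powr (- \<gamma>)) powr (\<beta> - 1) = t powr (- 1)" using \<gamma>\<beta>(1) by (simp add: powr_powr)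
          also have "t powr (- 1) = 1 / t" using elim(1) by (simp add: powr_minus_divide)
          finally have Yp: "Y powr (\<beta> - 1) = \<kappa> * D powr \<beta> / t" by (simp add: b1pow)
          have "Y powr (\<beta> - 1) \<le> real n powr (\<beta> - 1)" using n Y \<beta> by (intro powr_mono2) auto
          then have le: "\<kappa> * D powr \<beta> \<le> t * real n powr (\<beta> - 1)" using elim(1) by (simp add: Yp divide_le_eq mult.commute)
          have "544 * d = 17 * D / real n" by (simp add: d_def)
          then have "(544 * d) powr \<beta> = 17 powr \<beta> * D powr \<beta> / real n powr \<beta>"
            using D0 n0 by (simp add: powr_divide powr_mult)
          then have "hit_time d = \<kappa> * D powr \<beta> / real n powr \<beta>" by (simp add: hit_time_def \<kappa>_def)
          also have "\<dots> \<le> t * real n powr (\<beta> - 1) / real n powr \<beta>" using le by (intro divide_right_mono) auto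
          also have "\<dots> = t / real n" using n0 by (simp add: powr_diff)
          finally show ?thesis using n0 by (simp add: le_divide_eq mult.commute)
        qed
        have prob: "hit_prob ^ n * (1 / 2) \<le> measure (P x) {\<omega> \<in> space (P x). X t \<omega> \<in> B}" if x: "x \<in> A0" for x
        proof -
          obtain \<gamma>' where g: "\<gamma>' 0 = x" "\<gamma>' (dist x b) = b"
            "\<And>s u. s \<in> {0..dist x b} \<Longrightarrow> u \<in> {0..dist x b} \<Longrightarrow> dist (\<gamma>' s) (\<gamma>' u) = \<bar>s - u\<bar>"
            using geodesic unfolding geodesic_metric_def by blast
          define ctr where "ctr i = \<gamma>' (real i * (dist x b / real n))" for i
          have inr: "real i * (dist x b / real n) \<in> {0..dist x b}" if "i \<le> n" for i
          proof -
            have "real i / real n * dist x b \<le> 1 * dist x b" using that n0 by (intro mult_right_mono) auto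
            then show ?thesis by simp
          qed
          show ?thesis
          proof (rule chain_lower[OF d, where c = ctr and t = t])
            show "B \<in> sets borel" using B by simp
            show "dist (ctr i) (ctr (Suc i)) \<le> 32 * d" if "i < n" for i
            proof -
              have "dist (ctr i) (ctr (Suc i)) = \<bar>real i * (dist x b / real n) - real (Suc i) * (dist x b / real n)\<bar>"
                unfolding ctr_def using that by (intro g inr) auto
              also have "\<dots> = dist x b / real n" by (simp add: add_divide_distrib distrib_right)
              also have "\<dots> \<le> D / real n" using A0d[OF x] n0 by (intro divide_right_mono) auto
              also have "\<dots> = 32 * d" by (simp add: d_def)
              finally show ?thesis .
            qed
            have cn: "ctr n = b" using n0 g by (simp add: ctr_def)
            show "1 / 2 \<le> measure (P z) {\<omega> \<in> space (P z). X s \<omega> \<in> B}"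
              if z: "z \<in> ball (ctr n) (32 * d)" and s: "0 \<le> s" "s \<le> t" for z s
            proof -
              have "cball z (e2 / 2) \<subseteq> cball b e2"
              proof
                fix v assume "v \<in> cball z (e2 / 2)"
                then show "v \<in> cball b e2" using z de dist_triangle[of b v z] unfolding cn by simp
              qed
              then have sub: "cball z (e2 / 2) \<subseteq> B" using e2(2) by blast
              have "B \<in> sets borel" using B(1) by simp
              from elim(3)[rule_format, OF s this sub] show ?thesis .
            qed
            show "x \<in> ball (ctr 0) (32 * d)" using d g by (simp add: ctr_def)
          qed (use time in auto)
        qed
        have "exp (ln (measure \<mu> A0 / 2) - l - l * b1 * t powr (- \<gamma>)) = measure \<mu> A0 / 2 * exp (- l * (Y + 1))"
        proof -
          have "exp (ln (measure \<mu> A0 / 2) - l - l * b1 * t powr (- \<gamma>)) = exp (ln (measure \<mu> A0 / 2) + (- l * (Y + 1)))"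
            by (simp add: Y_def algebra_simps)
          also have "\<dots> = measure \<mu> A0 / 2 * exp (- l * (Y + 1))" using mA0 by (subst exp_add) simp
          finally show ?thesis .
        qed
        also have "\<dots> \<le> measure \<mu> A0 / 2 * hit_prob ^ n"
        proof (rule mult_left_mono)
          have "hit_prob ^ n = exp (ln hit_prob) ^ n" using hit_prob by simp
          also have "\<dots> = exp (real n * ln hit_prob)" by (rule exp_of_nat_mult[symmetric])
          finally have "hit_prob ^ n = exp (- l * real n)" by (simp add: l_def mult.commute)
          then show "exp (- l * (Y + 1)) \<le> hit_prob ^ n" using n l by simp
        qed (use mA0 in simp)
        also have "\<dots> = hit_prob ^ n * (1 / 2) * measure \<mu> A0" by simp
        also have "\<dots> \<le> transition_between \<mu> p t A B"
          using A B by (intro transition_between_ge[OF elim(1) _ A(2) _ A0 prob]) auto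
        finally show ?case .
      qed
    qed
    then show ?thesis unfolding L .
  qed
  have "ereal (- (c * setdist A B powr (\<beta> * \<gamma>))) \<le> Liminf (at_right 0) (\<lambda>t. ereal (t powr \<gamma>) * elog (transition_between \<mu> p t A B))"
    if A: "open A" "emeasure \<mu> A < \<infinity>" "A \<noteq> {}" and B: "open B" "B \<noteq> {}" for A B
  proof (rule LIMSEQ_le_const2)
    have "(\<lambda>n. setdist A B + 1 / real (Suc n)) \<longlonglongrightarrow> setdist A B + 0"
      by (intro tendsto_intros LIMSEQ_Suc[OF lim_1_over_n])
    then have pw: "(\<lambda>n. (setdist A B + 1 / real (Suc n)) powr (\<beta> * \<gamma>)) \<longlonglongrightarrow> setdist A B powr (\<beta> * \<gamma>)"
      using \<beta> \<gamma> setdist_pos_le[of A B] by (intro tendsto_powr') auto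
    have "(\<lambda>n. - (c * (setdist A B + 1 / real (Suc n)) powr (\<beta> * \<gamma>))) \<longlonglongrightarrow> - (c * setdist A B powr (\<beta> * \<gamma>))"
      by (intro tendsto_minus tendsto_mult tendsto_const pw)
    then show "(\<lambda>n. ereal (- (c * (setdist A B + 1 / real (Suc n)) powr (\<beta> * \<gamma>)))) \<longlonglongrightarrow> ereal (- (c * setdist A B powr (\<beta> * \<gamma>)))"
      by (rule tendsto_ereal)
    show "\<exists>N. \<forall>n\<ge>N. ereal (- (c * (setdist A B + 1 / real (Suc n)) powr (\<beta> * \<gamma>))) \<le>
       Liminf (at_right 0) (\<lambda>t. ereal (t powr \<gamma>) * elog (transition_between \<mu> p t A B))"
      using A B by (intro exI[of _ 0] allI impI main) auto
  qed
  then show ?thesis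
    unfolding \<gamma>\<beta>(2) \<gamma>_def[symmetric] using c by (intro exI[of _ c]) simp
qed

end

section \<open>From the hypothesis on mean exit times to both bounds\<close>

lemma ennreal_ratio_bounds:
  assumes a: "0 < a" "0 < C" and lo: "ennreal (1 / C) < m / ennreal a" and up: "m / ennreal a < ennreal C"
  shows "ennreal (a / C) \<le> m" "m \<le> ennreal (C * a)"
proof -
  have "m / ennreal a * ennreal a = m"
    using a by (simp add: ennreal_divide_times ennreal_mult_divide_eq mult.commute ennreal_times_divide)
  moreover have "ennreal (1 / C) * ennreal a \<le> m / ennreal a * ennreal a" "m / ennreal a * ennreal a \<le> ennreal C * ennreal a"
    using lo up by (auto intro!: mult_right_mono)
  ultimately show "ennreal (a / C) \<le> m" "m \<le> ennreal (C * a)"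
    using a by (simp_all add: ennreal_mult'[symmetric])
qed

theorem theorem1p2:
  fixes \<mu> :: "'a::{metric_space, second_countable_topology} measure"
    and E :: "('a \<Rightarrow> real) \<Rightarrow> ('a \<Rightarrow> real) \<Rightarrow> real"
    and D :: "('a \<Rightarrow> real) set"
    and P :: "'a \<Rightarrow> 'w measure"
    and X :: "real \<Rightarrow> 'w \<Rightarrow> 'a"
    and p :: "real \<Rightarrow> 'a \<Rightarrow> 'a \<Rightarrow> real"
    and R\<^sub>0 \<beta> :: real
  assumes "locally_compact_space (euclidean :: 'a topology)"
    and "radon_measure \<mu>" and "full_support \<mu>"
    and "geodesic_metric TYPE('a)"
    and "dirichlet_form \<mu> E D" and "regular_form \<mu> E D" and "strongly_local \<mu> E D"
    and "diffusion_process P X" and "feller P X"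
    and "associated_with_form \<mu> E D P X"
    and "transition_density \<mu> P X p"
    and "R\<^sub>0 > 0" and "\<beta> > 1"
    and "\<exists>C\<^sub>0>0. \<forall>x r. 0 < r \<and> r < R\<^sub>0 \<longrightarrow>
           ennreal (1 / C\<^sub>0) < mean_exit_time P X x r / ennreal (r powr \<beta>) \<and>
           mean_exit_time P X x r / ennreal (r powr \<beta>) < ennreal C\<^sub>0"
  shows "(\<exists>c>0. \<forall>A\<in>sets \<mu>. \<forall>B\<in>sets \<mu>.
            0 < emeasure \<mu> A \<and> emeasure \<mu> A < \<infinity> \<and> 0 < emeasure \<mu> B \<and> emeasure \<mu> B < \<infinity> \<longrightarrow>
            Limsup (at_right 0)
              (\<lambda>t. ereal (t powr (1 / (\<beta> - 1))) * elog (transition_between \<mu> p t A B))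
            \<le> ereal (- c * setdist A B powr (\<beta> / (\<beta> - 1))))
       \<and> (elliptic_harnack P X \<longrightarrow>
          (\<exists>C>0. \<forall>A B. open A \<and> open B \<and> compact (closure A) \<and> compact (closure B) \<and>
            0 < emeasure \<mu> A \<and> emeasure \<mu> A < \<infinity> \<and> 0 < emeasure \<mu> B \<and> emeasure \<mu> B < \<infinity> \<longrightarrow>
            Liminf (at_right 0)
              (\<lambda>t. ereal (t powr (1 / (\<beta> - 1))) * elog (transition_between \<mu> p t A B))
            \<ge> ereal (- C * setdist A B powr (\<beta> / (\<beta> - 1)))))"
proof -
  interpret lc_diffusion P X by unfold_locales (use assms in auto)
  obtain C\<^sub>0 where C\<^sub>0: "0 < C\<^sub>0" and exit: "\<And>x r. 0 < r \<Longrightarrow> r < R\<^sub>0 \<Longrightarrow>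
      ennreal (1 / C\<^sub>0) < mean_exit_time P X x r / ennreal (r powr \<beta>) \<and>
      mean_exit_time P X x r / ennreal (r powr \<beta>) < ennreal C\<^sub>0"
    using assms(14) by blast
  have bounds: "ennreal (r powr \<beta> / C\<^sub>0) \<le> resolv (ball x r) 0 (\<lambda>_. 1) x"
    "resolv (ball x r) 0 (\<lambda>_. 1) x \<le> ennreal (C\<^sub>0 * r powr \<beta>)" if "0 < r" "r < R\<^sub>0" for x r
    using ennreal_ratio_bounds[of "r powr \<beta>" C\<^sub>0 "mean_exit_time P X x r"] exit[OF that] C\<^sub>0 that(1)
    by (simp_all add: mean_exit_time_eq)
  \<comment> \<open>A closed ball of radius \<open>r\<close> lies in the open ball of radius
    \<open>2 * r\<close>; the upper bound for closed balls thus costs the factor 2^\<beta> and half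
    of the range of radii.\<close>
  define C where "C = C\<^sub>0 * 2 powr \<beta>"
  have C: "0 < C" "C\<^sub>0 \<le> C" using C\<^sub>0 assms(13) by (auto simp: C_def ge_one_powr_ge_zero)
  interpret heat_kernel_diffusion P X \<beta> C "R\<^sub>0 / 2" \<mu> p
  proof unfold_locales
    fix r :: real and x assume r: "0 < r" "r < R\<^sub>0 / 2"
    have "ennreal (r powr \<beta> / C) \<le> ennreal (r powr \<beta> / C\<^sub>0)"
      using C C\<^sub>0 by (intro ennreal_leI divide_left_mono) auto
    also have "\<dots> \<le> resolv (ball x r) 0 (\<lambda>_. 1) x" using r by (intro bounds) auto
    also have "\<dots> \<le> resolv (cball x r) 0 (\<lambda>_. 1) x" by (intro resolv_mono_set) auto
    finally show "ennreal (r powr \<beta> / C) \<le> resolv (cball x r) 0 (\<lambda>_. 1) x" .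
    have "resolv (cball x r) 0 (\<lambda>_. 1) x \<le> resolv (ball x (2 * r)) 0 (\<lambda>_. 1) x"
      using r by (intro resolv_mono_set) auto
    also have "\<dots> \<le> ennreal (C\<^sub>0 * (2 * r) powr \<beta>)" using r by (intro bounds) auto
    also have "C\<^sub>0 * (2 * r) powr \<beta> = C * r powr \<beta>" using r by (simp add: C_def powr_mult)
    finally show "resolv (cball x r) 0 (\<lambda>_. 1) x \<le> ennreal (C * r powr \<beta>)" .
  qed (use assms C in auto)
  show ?thesis
  proof (rule conjI[OF upper_bound], rule impI)
    assume "elliptic_harnack P X"
    then obtain H where "1 \<le> H" and H: "\<And>x R u. 0 < R \<Longrightarrow> harmonic_on P X u (ball x (2 * R)) \<and> (\<forall>y\<in>closure (ball x (2 * R)). 0 \<le> u y) \<Longrightarrow>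
        (SUP y\<in>ball x R. ereal (u y)) \<le> ereal H * (INF y\<in>ball x R. ereal (u y))"
      unfolding elliptic_harnack_def by blast
    interpret harnack_diffusion P X \<beta> C "R\<^sub>0 / 2" \<mu> p H
      by unfold_locales (use \<open>1 \<le> H\<close> H assms(4) in blast)+
    have "A \<noteq> {}" if "0 < emeasure \<mu> A" for A using that by auto
    then show "\<exists>C>0. \<forall>A B. open A \<and> open B \<and> compact (closure A) \<and> compact (closure B) \<and>
            0 < emeasure \<mu> A \<and> emeasure \<mu> A < \<infinity> \<and> 0 < emeasure \<mu> B \<and> emeasure \<mu> B < \<infinity> \<longrightarrow>
            Liminf (at_right 0)
              (\<lambda>t. ereal (t powr (1 / (\<beta> - 1))) * elog (transition_between \<mu> p t A B))
            \<ge> ereal (- C * setdist A B powr (\<beta> / (\<beta> - 1)))"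
      using lower_bound by meson
  qed
qed

end
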